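(* Let $P=\lambda_0M_0+\sum_{i=1}^t\lambda_iM_i$ be a quasi-identity of $M_n$, where $M_0,\dots,M_t$ are noncommutative monomials in the $x_k$ and $\lambda_0,\dots,\lambda_t\in\mathcal C$. If $M_1,\dots,M_t$ are $M_n$-locally linearly independent, then $P$ is a consequence of the Cayley–Hamilton identity, i.e. $P\in(Q_n)$.
   Context: $F$ is a field of characteristic $0$, $n\ge1$, $M_n=M_n(F)$, $\mathcal C=F[x^{(k)}_{ij}:1\le i,j\le n,\ k\ge1]$, $X=\{x_1,x_2,\dots\}$ noncommuting; $\mathcal C\langle X\rangle$ is the free $\mathcal C$-algebra (quasi-polynomials). A quasi-identity vanishes when each $x_k$ is replaced by any $A_k=(a^{(k)}_{ij})\in M_n$ and each $x^{(k)}_{ij}$ by $a^{(k)}_{ij}$. $M_1,\dots,M_t$ are $M_n$-locally linearly independent if there exist matrices at which their values are linearly independent. Generic matrices $\xi_k=(x^{(k)}_{ij})\in M_n(\mathcal C)$; $\mathrm{tr}(x_{i_1}\cdots x_{i_r}):=\mathrm{tr}(\xi_{i_1}\cdots\xi_{i_r})\in\mathcal C$. $Q_n=\sum_{\sigma\in S_{n+1}}\epsilon_\sigma\phi_\sigma(x_1,\dots,x_n)$, where for $\sigma=(i_1,\dots,i_{k_1})\cdots(u_1,\dots,u_h)(s_1,\dots,s_k,n+1)$ (disjoint cycles, the one containing $n+1$ last) $\phi_\sigma=\mathrm{tr}(x_{i_1}\cdots x_{i_{k_1}})\cdots\mathrm{tr}(x_{u_1}\cdots x_{u_h})x_{s_1}\cdots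 x_{s_k}$. A T-ideal is an ideal of $\mathcal C\langle X\rangle$ closed under simultaneous substitutions $x_k\mapsto H_k$, $x^{(k)}_{ij}\mapsto\Phi(H_k)_{ij}$, with $\Phi$ the $\mathcal C$-algebra map $x_k\mapsto\xi_k$; $(Q_n)$ is the T-ideal generated by $Q_n$. *)

theory Defs
  imports "HOL-Analysis.Analysis" "HOL-Library.Poly_Mapping"
begin

text \<open>Conventions. The size n of the matrices is CARD('n) for a finite type 'n
(which indexes rows and columns). The noncommuting variables x_1, x_2, ... are
indexed by natural numbers 0, 1, 2, ... (x_(k+1) corresponds to index k).
The commuting variable x^(k)_(ij) is the triple (k, i, j).\<close>

type_synonym ('a, 'n) cpoly = "((nat \<times> 'n \<times> 'n) \<Rightarrow>\<^sub>0 nat) \<Rightarrow>\<^sub>0 'a"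

text \<open>Quasi-polynomials: elements of the free C-algebra C<X>, i.e. finitely
supported C-linear combinations of words over X.\<close>
type_synonym ('a, 'n) qpoly = "nat list \<Rightarrow>\<^sub>0 ('a, 'n) cpoly"

definition cvar :: "nat \<times> 'n \<times> 'n \<Rightarrow> ('a::comm_ring_1, 'n) cpoly" where
  "cvar v = Poly_Mapping.single (Poly_Mapping.single v 1) 1"

definition cpeval :: "('v \<Rightarrow> 'b::comm_ring_1) \<Rightarrow> (('v \<Rightarrow>\<^sub>0 nat) \<Rightarrow>\<^sub>0 'a::comm_ring_1)
    \<Rightarrow> ('a \<Rightarrow> 'b) \<Rightarrow> 'b" where
  "cpeval s p emb = (\<Sum>m\<in>Poly_Mapping.keys p.
      emb (Poly_Mapping.lookup p m) * (\<Prod>v\<in>Poly_Mapping.keys m. s v ^ Poly_Mapping.lookup m v))"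

definition cconst :: "'a::comm_ring_1 \<Rightarrow> ('a, 'n) cpoly" where
  "cconst c = Poly_Mapping.single 0 c"

definition msmult :: "'b::times \<Rightarrow> 'b^'n^'n \<Rightarrow> 'b^'n^'n" where
  "msmult c A = (\<chi> i j. c * A $ i $ j)"

definition wordmat :: "(nat \<Rightarrow> 'b::semiring_1^'n^'n) \<Rightarrow> nat list \<Rightarrow> 'b^'n^'n" where
  "wordmat A w = foldr (\<lambda>k M. matrix_matrix_mult (A k) M) w (mat 1)"

definition qeval :: "(nat \<Rightarrow> 'a::field^'n^'n) \<Rightarrow> ('a, 'n::finite) qpoly \<Rightarrow> 'a^'n^'n" where
  "qeval A P = (\<Sum>w\<in>Poly_Mapping.keys P.
      msmult (cpeval (\<lambda>(k, i, j). A k $ i $ j) (Poly_Mapping.lookup P w) id) (wordmat A w))"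

definition quasi_identity :: "('a::field, 'n::finite) qpoly \<Rightarrow> bool" where
  "quasi_identity P \<longleftrightarrow> (\<forall>A. qeval A P = 0)"

definition loc_lin_indep :: "'n::finite itself \<Rightarrow> nat \<Rightarrow> (nat \<Rightarrow> nat list) \<Rightarrow> ('a::field) itself \<Rightarrow> bool" where
  "loc_lin_indep _ t M _ \<longleftrightarrow> (\<exists>A :: nat \<Rightarrow> 'a^'n^'n.
      \<forall>c :: nat \<Rightarrow> 'a. (\<Sum>i\<in>{1..t}. msmult (c i) (wordmat A (M i))) = 0 \<longrightarrow> (\<forall>i\<in>{1..t}. c i = 0))"

definition generic :: "nat \<Rightarrow> ('a::comm_ring_1, 'n::finite) cpoly^'n^'n" where
  "generic k = (\<chi> i j. cvar (k, i, j))"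

definition qmul :: "('a::comm_ring_1, 'n) qpoly \<Rightarrow> ('a, 'n) qpoly \<Rightarrow> ('a, 'n) qpoly" where
  "qmul p q = (\<Sum>u\<in>Poly_Mapping.keys p. \<Sum>v\<in>Poly_Mapping.keys q.
      Poly_Mapping.single (u @ v) (Poly_Mapping.lookup p u * Poly_Mapping.lookup q v))"

definition qone :: "('a::comm_ring_1, 'n) qpoly" where
  "qone = Poly_Mapping.single [] 1"

definition qword :: "(nat \<Rightarrow> ('a::comm_ring_1, 'n) qpoly) \<Rightarrow> nat list \<Rightarrow> ('a, 'n) qpoly" where
  "qword H w = foldr (\<lambda>k q. qmul (H k) q) w qone"

definition Phi :: "('a::comm_ring_1, 'n::finite) qpoly \<Rightarrow> ('a, 'n) cpoly^'n^'n" where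
  "Phi P = (\<Sum>w\<in>Poly_Mapping.keys P. msmult (Poly_Mapping.lookup P w) (wordmat generic w))"

definition qsubst :: "(nat \<Rightarrow> ('a::comm_ring_1, 'n::finite) qpoly) \<Rightarrow> ('a, 'n) qpoly \<Rightarrow> ('a, 'n) qpoly" where
  "qsubst H P = (\<Sum>w\<in>Poly_Mapping.keys P.
      qmul (Poly_Mapping.single []
              (cpeval (\<lambda>(k, i, j). Phi (H k) $ i $ j) (Poly_Mapping.lookup P w) cconst))
           (qword H w))"

definition T_ideal :: "('a::comm_ring_1, 'n::finite) qpoly set \<Rightarrow> bool" where
  "T_ideal I \<longleftrightarrow> 0 \<in> I \<and> (\<forall>p\<in>I. \<forall>q\<in>I. p + q \<in> I)
     \<and> (\<forall>p\<in>I. \<forall>a b. qmul (qmul a p) b \<in> I)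
     \<and> (\<forall>p\<in>I. \<forall>H. qsubst H p \<in> I)"

definition T_ideal_gen :: "('a::comm_ring_1, 'n::finite) qpoly \<Rightarrow> ('a, 'n) qpoly set" where
  "T_ideal_gen Q = \<Inter>{I. T_ideal I \<and> Q \<in> I}"

definition qtr :: "nat list \<Rightarrow> ('a::comm_ring_1, 'n::finite) cpoly" where
  "qtr w = trace (wordmat generic w)"

text \<open>Cycle structure of a permutation sigma of {0..n} (these stand for the
indices 1..n+1 of the paper; the distinguished point n+1 is n here).\<close>
definition orb :: "(nat \<Rightarrow> nat) \<Rightarrow> nat \<Rightarrow> nat set" where
  "orb \<sigma> i = range (\<lambda>j. (\<sigma> ^^ j) i)"

definition cycword :: "(nat \<Rightarrow> nat) \<Rightarrow> nat \<Rightarrow> nat list" where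
  "cycword \<sigma> i = map (\<lambda>j. (\<sigma> ^^ j) i) [0..<card (orb \<sigma> i)]"

text \<open>For the cycle (s_1, ..., s_k, n+1) the word s_1 ... s_k.\<close>
definition tailword :: "nat \<Rightarrow> (nat \<Rightarrow> nat) \<Rightarrow> nat list" where
  "tailword n \<sigma> = map (\<lambda>j. (\<sigma> ^^ j) n) [1..<card (orb \<sigma> n)]"

definition phi_sigma :: "nat \<Rightarrow> (nat \<Rightarrow> nat) \<Rightarrow> ('a::comm_ring_1, 'n::finite) qpoly" where
  "phi_sigma n \<sigma> = Poly_Mapping.single (tailword n \<sigma>)
     (\<Prod>Cy\<in>{orb \<sigma> i | i. i < n \<and> n \<notin> orb \<sigma> i}. qtr (cycword \<sigma> (Min Cy)))"

definition Qn :: "('a::comm_ring_1, 'n::finite) qpoly" where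
  "Qn = (\<Sum>\<sigma>\<in>{\<sigma>. \<sigma> permutes {0..CARD('n)}}.
          qmul (Poly_Mapping.single [] (of_int (sign \<sigma>))) (phi_sigma CARD('n) \<sigma>))"

end

theory Submission
  imports Defs "HOL-Computational_Algebra.Polynomial" "HOL-Combinatorics.Cycles" "HOL-Library.List_Lexorder"
    "HOL-Library.Function_Algebras"
begin

text \<open>
  Since \<open>M\<^sub>1, \<dots>, M\<^sub>t\<close> are independent at some point, the coefficient tuples \<open>\<mu>\<close> with
  \<open>\<Sum> \<mu>\<^sub>s M\<^sub>s(\<xi>) = 0\<close> form a module of rank at most one over the factorial ring \<open>C\<close>, so all of them are multiples
  of a single tuple \<open>\<mu>\<close>. The infinitesimal conjugations preserve this module and the degree, hence
  \<open>\<mu>\<close> is a common eigenvector for them and therefore invariant. By the first fundamental theorem for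
  matrices the \<open>\<mu>\<^sub>s\<close> are polynomials in traces of words. Thus \<open>\<Sum> \<mu>\<^sub>s M\<^sub>s\<close> is a trace identity and,
  by the second fundamental theorem, a combination of alternating sums of trace monomials over
  \<open>n + 1\<close> positions. Each of these is obtained from \<open>Q\<^sub>n\<close> by substitution and multiplication.

  The first fundamental theorem rests on the double centraliser theorem for the place permutations of
  tensors. For the second one, the lexicographically greatest permutation in a linear relation must have a
  decreasing sequence of length \<open>n + 1\<close>, since otherwise a suitable pair of index tuples isolates it, and
  alternating over that sequence replaces it by smaller permutations.
\<close>

section \<open>Polynomials and ring homomorphisms\<close>

named_theorems hom_simps

locale comm_ring_hom =
  fixes h :: "'a::comm_ring_1 \<Rightarrow> 'b::comm_ring_1"
  assumes zero [hom_simps]: "h 0 = 0"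
    and one [hom_simps]: "h 1 = 1"
    and add [hom_simps]: "h (x + y) = h x + h y"
    and mult [hom_simps]: "h (x * y) = h x * h y"
begin

lemma sum [hom_simps]: "h (\<Sum>x\<in>A. f x) = (\<Sum>x\<in>A. h (f x))"
  by (induction A rule: infinite_finite_induct) (auto simp: zero add)

lemma prod [hom_simps]: "h (\<Prod>x\<in>A. f x) = (\<Prod>x\<in>A. h (f x))"
  by (induction A rule: infinite_finite_induct) (auto simp: one mult)

lemma power [hom_simps]: "h (x ^ k) = h x ^ k"
  by (induction k) (auto simp: one mult)

lemma uminus [hom_simps]: "h (- x) = - h x"
  by (metis add_eq_0_iff2 add.right_inverse add zero)

lemma diff [hom_simps]: "h (x - y) = h x - h y"
  by (metis diff_conv_add_uminus add uminus)

lemma of_nat [hom_simps]: "h (of_nat k) = of_nat k"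
  by (induction k) (auto simp: zero one add)

lemma of_int [hom_simps]: "h (of_int k) = of_int k"
  by (cases k) (auto simp: of_nat one add uminus diff)

end

lemma comm_ring_hom_comp: "comm_ring_hom g \<Longrightarrow> comm_ring_hom h \<Longrightarrow> comm_ring_hom (\<lambda>x. g (h x))"
  by (simp add: comm_ring_hom_def)

interpretation id_hom: comm_ring_hom id
  by unfold_locales auto

interpretation const_poly: comm_ring_hom "\<lambda>c. [:c:]"
  by unfold_locales auto

interpretation poly_hom: comm_ring_hom "\<lambda>p. poly p x" for x
  by unfold_locales auto

type_synonym ('v, 'a) mpoly = "('v \<Rightarrow>\<^sub>0 nat) \<Rightarrow>\<^sub>0 'a"

definition pvar :: "'v \<Rightarrow> ('v, 'a::comm_ring_1) mpoly" where
  "pvar v = Poly_Mapping.single (Poly_Mapping.single v 1) 1"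

definition pconst :: "'a::comm_ring_1 \<Rightarrow> ('v, 'a) mpoly" where
  "pconst c = Poly_Mapping.single 0 c"

interpretation pconst: comm_ring_hom pconst
  by unfold_locales (auto simp: pconst_def single_add mult_single)

interpretation const_const_poly: comm_ring_hom "\<lambda>c. [:pconst c:]"
  by (rule comm_ring_hom_comp[OF const_poly.comm_ring_hom_axioms pconst.comm_ring_hom_axioms])

lemma pconst_eq_0_iff [simp]: "pconst c = 0 \<longleftrightarrow> c = 0"
  by (metis pconst_def lookup_single_eq lookup_zero single_zero)

definition mval :: "('v \<Rightarrow> 'b::comm_ring_1) \<Rightarrow> ('v \<Rightarrow>\<^sub>0 nat) \<Rightarrow> 'b" where
  "mval s m = (\<Prod>v\<in>Poly_Mapping.keys m. s v ^ Poly_Mapping.lookup m v)"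

lemma mval_superset:
  assumes "finite K" "Poly_Mapping.keys m \<subseteq> K"
  shows "mval s m = (\<Prod>v\<in>K. s v ^ Poly_Mapping.lookup m v)"
  unfolding mval_def using assms
  by (intro prod.mono_neutral_left) (auto simp: in_keys_iff)

lemma mval_0 [simp]: "mval s 0 = 1"
  by (simp add: mval_def)

lemma mval_single [simp]: "mval s (Poly_Mapping.single v k) = s v ^ k"
  by (cases "k = 0") (auto simp: mval_def)

lemma mval_add: "mval s (m + m') = mval s m * mval s m'"
proof -
  let ?K = "Poly_Mapping.keys m \<union> Poly_Mapping.keys m'"
  have "mval s (m + m') = (\<Prod>v\<in>?K. s v ^ Poly_Mapping.lookup (m + m') v)"
    by (intro mval_superset) (auto simp: in_keys_iff lookup_add)
  also have "\<dots> = (\<Prod>v\<in>?K. s v ^ Poly_Mapping.lookup m v) * (\<Prod>v\<in>?K. s v ^ Poly_Mapping.lookup m' v)"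
    by (simp add: lookup_add power_add prod.distrib)
  also have "\<dots> = mval s m * mval s m'"
    by (subst (1 2) mval_superset[where K = ?K]) auto
  finally show ?thesis .
qed

lemma cpeval_eq_sum_mval:
  "cpeval s p emb = (\<Sum>m\<in>Poly_Mapping.keys p. emb (Poly_Mapping.lookup p m) * mval s m)"
  by (simp add: cpeval_def mval_def)

lemma poly_mapping_sum_single:
  "(\<Sum>m\<in>Poly_Mapping.keys p. Poly_Mapping.single m (Poly_Mapping.lookup p m)) = p"
proof (rule poly_mapping_eqI)
  fix k
  show "Poly_Mapping.lookup (\<Sum>m\<in>Poly_Mapping.keys p. Poly_Mapping.single m (Poly_Mapping.lookup p m)) k
      = Poly_Mapping.lookup p k"
    by (cases "k \<in> Poly_Mapping.keys p")
      (auto simp: lookup_sum lookup_single when_def in_keys_iff)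
qed

context comm_ring_hom
begin

lemma cpeval_superset:
  assumes "finite K" "Poly_Mapping.keys p \<subseteq> K"
  shows "cpeval s p h = (\<Sum>m\<in>K. h (Poly_Mapping.lookup p m) * mval s m)"
  unfolding cpeval_eq_sum_mval using assms
  by (intro sum.mono_neutral_left) (auto simp: in_keys_iff zero)

lemma cpeval_single: "cpeval s (Poly_Mapping.single m c) h = h c * mval s m"
  by (subst cpeval_superset[where K = "{m}"]) auto

lemma cpeval_add: "cpeval s (p + q) h = cpeval s p h + cpeval s q h"
proof -
  let ?K = "Poly_Mapping.keys p \<union> Poly_Mapping.keys q"
  have "cpeval s (p + q) h = (\<Sum>m\<in>?K. h (Poly_Mapping.lookup (p + q) m) * mval s m)"
    by (intro cpeval_superset) (auto simp: in_keys_iff lookup_add)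
  also have "\<dots> = (\<Sum>m\<in>?K. h (Poly_Mapping.lookup p m) * mval s m)
      + (\<Sum>m\<in>?K. h (Poly_Mapping.lookup q m) * mval s m)"
    by (simp add: lookup_add add distrib_right sum.distrib)
  also have "\<dots> = cpeval s p h + cpeval s q h"
    by (subst (1 2) cpeval_superset[where K = ?K]) auto
  finally show ?thesis .
qed

lemma cpeval_sum: "cpeval s (\<Sum>x\<in>A. f x) h = (\<Sum>x\<in>A. cpeval s (f x) h)"
proof -
  have "cpeval s 0 h = 0" by (simp add: cpeval_def)
  thus ?thesis by (induction A rule: infinite_finite_induct) (auto simp: cpeval_add)
qed

lemma cpeval_mult: "cpeval s (p * q) h = cpeval s p h * cpeval s q h"
proof -
  have "p * q = (\<Sum>m\<in>Poly_Mapping.keys p. Poly_Mapping.single m (Poly_Mapping.lookup p m))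
     * (\<Sum>m'\<in>Poly_Mapping.keys q. Poly_Mapping.single m' (Poly_Mapping.lookup q m'))"
    by (simp add: poly_mapping_sum_single)
  also have "\<dots> = (\<Sum>m\<in>Poly_Mapping.keys p. \<Sum>m'\<in>Poly_Mapping.keys q.
     Poly_Mapping.single (m + m') (Poly_Mapping.lookup p m * Poly_Mapping.lookup q m'))"
    by (simp add: sum_product mult_single)
  finally have "cpeval s (p * q) h = (\<Sum>m\<in>Poly_Mapping.keys p. \<Sum>m'\<in>Poly_Mapping.keys q.
      h (Poly_Mapping.lookup p m * Poly_Mapping.lookup q m') * mval s (m + m'))"
    by (simp add: cpeval_sum cpeval_single)
  also have "\<dots> = cpeval s p h * cpeval s q h"
    by (simp add: mval_add mult cpeval_eq_sum_mval sum_product mult_ac)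
  finally show ?thesis .
qed

lemma cpeval_hom: "comm_ring_hom (\<lambda>p. cpeval s p h)"
proof
  show "cpeval s 1 h = 1"
    using cpeval_single[of s 0 1] by (simp add: one)
qed (simp_all add: cpeval_add cpeval_mult cpeval_def[of s 0])

lemma cpeval_pvar [simp]: "cpeval s (pvar v) h = s v"
  by (simp add: cpeval_single one pvar_def)

lemma cpeval_pconst [simp]: "cpeval s (pconst c) h = h c"
  by (simp add: cpeval_single pconst_def)

end

interpretation cpeval_id: comm_ring_hom "\<lambda>p. cpeval s p id" for s
  by (rule id_hom.cpeval_hom)

interpretation cpeval_pconst: comm_ring_hom "\<lambda>p. cpeval s p pconst" for s
  by (rule pconst.cpeval_hom)

interpretation cpeval_const_poly: comm_ring_hom "\<lambda>p. cpeval s p (\<lambda>c. [:c:])" for s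
  by (rule const_poly.cpeval_hom)

interpretation cpeval_const_const_poly: comm_ring_hom "\<lambda>p. cpeval s p (\<lambda>c. [:pconst c:])" for s
  by (rule const_const_poly.cpeval_hom)

lemma pvar_power: "pvar v ^ k = Poly_Mapping.single (Poly_Mapping.single v k) 1"
  by (induction k) (auto simp: mult_single pvar_def simp flip: single_add)

lemma mval_pvar: "mval pvar m = (Poly_Mapping.single m 1 :: ('v, 'a::comm_ring_1) mpoly)"
proof -
  have "(\<Prod>v\<in>A. Poly_Mapping.single (g v) (1::'a)) = Poly_Mapping.single (\<Sum>v\<in>A. g v) 1"
    for A and g :: "'v \<Rightarrow> 'v \<Rightarrow>\<^sub>0 nat"
    by (induction A rule: infinite_finite_induct) (auto simp: mult_single)
  thus ?thesis
    by (simp add: mval_def pvar_power poly_mapping_sum_single)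
qed

lemma mpoly_eq_sum_mval:
  "p = (\<Sum>m\<in>Poly_Mapping.keys p. pconst (Poly_Mapping.lookup p m) * mval pvar m)"
  by (simp add: mval_pvar pconst_def mult_single poly_mapping_sum_single)

lemma mpoly_induct [case_names const var add mult]:
  fixes P :: "('v, 'a::comm_ring_1) mpoly \<Rightarrow> bool"
  assumes const: "\<And>c. P (pconst c)" and var: "\<And>v. P (pvar v)"
    and add: "\<And>p q. P p \<Longrightarrow> P q \<Longrightarrow> P (p + q)" and mult: "\<And>p q. P p \<Longrightarrow> P q \<Longrightarrow> P (p * q)"
  shows "P p"
proof -
  have zero: "P 0" and one: "P 1"
    using const[of 0] const[of 1] by (simp_all add: hom_simps)
  have power: "P (q ^ k)" if "P q" for q k
    by (induction k) (auto intro: mult one that)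
  have prod: "P (\<Prod>v\<in>A. f v)" if "\<And>v. P (f v)" for A and f :: "'v \<Rightarrow> _"
    by (induction A rule: infinite_finite_induct) (auto intro: mult one that)
  have sum: "P (\<Sum>m\<in>A. f m)" if "\<And>m. P (f m)" for A and f :: "('v \<Rightarrow>\<^sub>0 nat) \<Rightarrow> _"
    by (induction A rule: infinite_finite_induct) (auto intro: add zero that)
  show ?thesis
    by (subst mpoly_eq_sum_mval, unfold mval_def) (intro sum mult const prod power var)
qed

lemma comm_ring_hom_mpoly_eqI:
  assumes "comm_ring_hom g" "comm_ring_hom h"
    and "\<And>c. g (pconst c) = h (pconst c)" "\<And>v. g (pvar v) = h (pvar v)"
  shows "g p = h p"
proof -
  interpret g: comm_ring_hom g by fact
  interpret h: comm_ring_hom h by fact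
  show ?thesis by (induction p rule: mpoly_induct) (auto simp: assms(3,4) hom_simps)
qed

subsection \<open>Occurring variables, degrees and zero divisors\<close>

definition vars_in :: "'v set \<Rightarrow> ('v, 'a::comm_ring_1) mpoly set" where
  "vars_in A = {f. \<forall>m\<in>Poly_Mapping.keys f. Poly_Mapping.keys m \<subseteq> A}"

lemma vars_in_pconst [simp]: "pconst c \<in> vars_in A"
  by (auto simp: vars_in_def pconst_def)

lemma vars_in_0 [simp]: "0 \<in> vars_in A"
  by (auto simp: vars_in_def)

lemma vars_in_1 [simp]: "1 \<in> vars_in A"
  using vars_in_pconst[of 1] by (simp add: hom_simps)

lemma vars_in_pvar: "v \<in> A \<Longrightarrow> pvar v \<in> vars_in A"
  by (auto simp: vars_in_def pvar_def)

lemma vars_in_add: "f \<in> vars_in A \<Longrightarrow> g \<in> vars_in A \<Longrightarrow> f + g \<in> vars_in A"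
  unfolding vars_in_def using keys_add[of f g] by blast

lemma vars_in_diff: "f \<in> vars_in A \<Longrightarrow> g \<in> vars_in A \<Longrightarrow> f - g \<in> vars_in A"
  unfolding vars_in_def using keys_diff[of f g] by blast

lemma vars_in_mult:
  assumes "f \<in> vars_in A" "g \<in> vars_in A"
  shows "f * g \<in> vars_in A"
  unfolding vars_in_def
proof safe
  fix m v assume "m \<in> Poly_Mapping.keys (f * g)" "v \<in> Poly_Mapping.keys m"
  then obtain a b where "m = a + b" "a \<in> Poly_Mapping.keys f" "b \<in> Poly_Mapping.keys g"
    using keys_mult[of f g] by blast
  thus "v \<in> A"
    using assms keys_add[of a b] \<open>v \<in> Poly_Mapping.keys m\<close> unfolding vars_in_def by blast
qed

lemma vars_in_sum: "(\<And>x. x \<in> X \<Longrightarrow> f x \<in> vars_in A) \<Longrightarrow> sum f X \<in> vars_in A"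
  by (induction X rule: infinite_finite_induct) (auto intro: vars_in_add)

lemma vars_in_prod: "(\<And>x. x \<in> X \<Longrightarrow> f x \<in> vars_in A) \<Longrightarrow> prod f X \<in> vars_in A"
  by (induction X rule: infinite_finite_induct) (auto intro: vars_in_mult)

lemma vars_in_power: "f \<in> vars_in A \<Longrightarrow> f ^ j \<in> vars_in A"
  by (induction j) (auto intro: vars_in_mult)

lemma vars_in_mono: "f \<in> vars_in A \<Longrightarrow> A \<subseteq> B \<Longrightarrow> f \<in> vars_in B"
  by (auto simp: vars_in_def)

lemma ex_finite_vars_in:
  obtains A where "finite A" "f \<in> vars_in A"
  by (rule that[of "\<Union>m\<in>Poly_Mapping.keys f. Poly_Mapping.keys m"]) (auto simp: vars_in_def)

lemma vars_in_empty_iff: "f \<in> vars_in {} \<longleftrightarrow> (\<exists>c. f = pconst c)"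
proof
  assume "f \<in> vars_in {}"
  hence "Poly_Mapping.keys f \<subseteq> {0}" by (auto simp: vars_in_def)
  hence "f = pconst (Poly_Mapping.lookup f 0)"
    by (intro poly_mapping_eqI) (auto simp: pconst_def lookup_single when_def in_keys_iff)
  thus "\<exists>c. f = pconst c" ..
qed auto

lemma cpeval_pvar_pconst [simp]: "cpeval pvar f pconst = f"
  by (rule comm_ring_hom_mpoly_eqI[OF pconst.cpeval_hom comm_ring_hom.intro]) auto

lemma cpeval_in_vars_in:
  assumes "\<And>v. v \<in> V \<Longrightarrow> s v \<in> vars_in A" "f \<in> vars_in V"
  shows "cpeval s f pconst \<in> vars_in A"
  unfolding cpeval_def using assms
  by (intro vars_in_sum vars_in_mult vars_in_prod vars_in_power vars_in_pconst) (auto simp: vars_in_def[of V])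

lemma cpeval_eq_hom_on_vars_in:
  assumes "f \<in> vars_in A" "comm_ring_hom h" "comm_ring_hom emb"
    and "\<And>c. h (pconst c) = emb c" "\<And>v. v \<in> A \<Longrightarrow> h (pvar v) = s v"
  shows "cpeval s f emb = h f"
proof -
  interpret emb: comm_ring_hom emb by fact
  have "cpeval s f emb = cpeval (\<lambda>v. h (pvar v)) f emb"
    unfolding cpeval_def using assms(1,5)
    by (intro sum.cong prod.cong arg_cong2[of _ _ _ _ "(*)"] arg_cong2[of _ _ _ _ "(^)"] refl)
      (force simp: vars_in_def)
  also have "\<dots> = h f"
    by (rule comm_ring_hom_mpoly_eqI[OF emb.cpeval_hom assms(2)]) (auto simp: assms(4))
  finally show ?thesis .
qed

text \<open>Renaming the finitely many occurring variables to natural numbers gives access to the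
  monomial order of the library, hence to its absence of zero divisors.\<close>
lemma mpoly_no_zero_divisors:
  fixes f g :: "('v, 'a::field) mpoly"
  assumes "f * g = 0"
  shows "f = 0 \<or> g = 0"
proof -
  obtain A B where AB: "finite A" "f \<in> vars_in A" "finite B" "g \<in> vars_in B"
    using ex_finite_vars_in by metis
  define V where "V = A \<union> B"
  obtain r :: "'v \<Rightarrow> nat" where r: "inj_on r V"
    using AB finite_imp_inj_to_nat_seg[of V] by (auto simp: V_def)
  define rename :: "('v, 'a) mpoly \<Rightarrow> (nat, 'a) mpoly"
    where "rename = (\<lambda>p. cpeval (\<lambda>v. pvar (r v)) p pconst)"
  define unrename :: "(nat, 'a) mpoly \<Rightarrow> ('v, 'a) mpoly"
    where "unrename = (\<lambda>p. cpeval (\<lambda>i. pvar (inv_into V r i)) p pconst)"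
  interpret rename: comm_ring_hom rename unfolding rename_def by (rule pconst.cpeval_hom)
  interpret unrename: comm_ring_hom unrename unfolding unrename_def by (rule pconst.cpeval_hom)
  have unrename: "unrename (rename p) = p" if "p \<in> vars_in V" for p
  proof -
    have "cpeval pvar p pconst = unrename (rename p)"
      by (rule cpeval_eq_hom_on_vars_in[OF that comm_ring_hom_comp[OF unrename.comm_ring_hom_axioms
              rename.comm_ring_hom_axioms] pconst.comm_ring_hom_axioms])
        (auto simp: rename_def unrename_def r)
    thus ?thesis by simp
  qed
  have "rename f * rename g = 0" using assms by (simp flip: rename.mult add: rename.zero)
  hence "rename f = 0 \<or> rename g = 0" by simp
  moreover have "f \<in> vars_in V" "g \<in> vars_in V" using AB by (auto simp: V_def intro: vars_in_mono)
  ultimately show ?thesis using unrename unrename.zero by metis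
qed

lemma mpoly_mult_eq_0_iff [simp]: "f * g = 0 \<longleftrightarrow> f = 0 \<or> g = 0" for f g :: "('v, 'a::field) mpoly"
  using mpoly_no_zero_divisors by auto

lemma mpoly_mult_left_cancel: "f * g = f * h \<longleftrightarrow> f = 0 \<or> g = h" for f g h :: "('v, 'a::field) mpoly"
  using mpoly_no_zero_divisors[of f "g - h"] by (auto simp: algebra_simps)

definition scale_vars :: "'v set \<Rightarrow> ('v, 'a::comm_ring_1) mpoly \<Rightarrow> ('v, 'a) mpoly poly" where
  "scale_vars S f = cpeval (\<lambda>v. if v \<in> S then [:0, pvar v:] else [:pvar v:]) f (\<lambda>c. [:pconst c:])"

abbreviation degree_in :: "'v set \<Rightarrow> ('v, 'a::comm_ring_1) mpoly \<Rightarrow> nat" where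
  "degree_in S f \<equiv> degree (scale_vars S f)"

abbreviation total_degree :: "('v, 'a::comm_ring_1) mpoly \<Rightarrow> nat" where
  "total_degree \<equiv> degree_in UNIV"

interpretation scale_vars: comm_ring_hom "scale_vars S" for S
  unfolding scale_vars_def by (rule const_const_poly.cpeval_hom)

lemma scale_vars_pconst [simp]: "scale_vars S (pconst c) = [:pconst c:]"
  by (simp add: scale_vars_def)

lemma scale_vars_pvar [simp]: "scale_vars S (pvar v) = (if v \<in> S then [:0, pvar v:] else [:pvar v:])"
  by (simp add: scale_vars_def)

lemma poly_scale_vars:
  "poly (scale_vars S f) x = cpeval (\<lambda>v. if v \<in> S then x * pvar v else pvar v) f pconst"
  by (rule comm_ring_hom_mpoly_eqI[OF comm_ring_hom_comp[OF poly_hom.comm_ring_hom_axioms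
          scale_vars.comm_ring_hom_axioms] pconst.cpeval_hom]) auto

lemma poly_scale_vars_1 [simp]: "poly (scale_vars S f) 1 = f"
  by (simp add: poly_scale_vars cong: if_cong)

lemma scale_vars_eq_0_iff [simp]: "scale_vars S f = 0 \<longleftrightarrow> f = 0"
  by (metis poly_0 poly_scale_vars_1 scale_vars.zero)

lemma degree_in_mult:
  fixes f g :: "('v, 'a::field) mpoly"
  assumes "f \<noteq> 0" "g \<noteq> 0"
  shows "degree_in S (f * g) = degree_in S f + degree_in S g"
proof (rule antisym)
  show "degree_in S (f * g) \<le> degree_in S f + degree_in S g"
    by (simp add: hom_simps degree_mult_le)
  have "coeff (scale_vars S f * scale_vars S g) (degree_in S f + degree_in S g) \<noteq> 0"
    unfolding coeff_mult_degree_sum using assms by simp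
  thus "degree_in S f + degree_in S g \<le> degree_in S (f * g)"
    unfolding scale_vars.mult by (rule le_degree)
qed

lemma scale_vars_disjoint:
  assumes "f \<in> vars_in A" "A \<inter> S = {}"
  shows "scale_vars S f = [:f:]"
  unfolding scale_vars_def using assms(2)
  by (intro cpeval_eq_hom_on_vars_in[OF assms(1) const_poly.comm_ring_hom_axioms
        const_const_poly.comm_ring_hom_axioms]) auto

lemma degree_in_eq_0_iff: "degree_in S f = 0 \<longleftrightarrow> f \<in> vars_in (- S)"
proof
  assume "degree_in S f = 0"
  then obtain c where c: "scale_vars S f = [:c:]" by (elim degree_eq_zeroE)
  have "f = poly (scale_vars S f) 0" using poly_scale_vars_1[of S f] by (simp add: c)
  also have "\<dots> \<in> vars_in (- S)"
    unfolding poly_scale_vars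
    by (rule cpeval_in_vars_in[where V = UNIV]) (auto intro: vars_in_pvar simp: vars_in_def[of UNIV])
  finally show "f \<in> vars_in (- S)" .
next
  assume "f \<in> vars_in (- S)"
  thus "degree_in S f = 0" by (simp add: scale_vars_disjoint)
qed

lemma vars_in_factor:
  fixes f g :: "('v, 'a::field) mpoly"
  assumes "f * g \<in> vars_in A" "f * g \<noteq> 0"
  shows "f \<in> vars_in A" "g \<in> vars_in A"
proof -
  have "degree_in (- A) (f * g) = 0" using assms(1) by (simp add: degree_in_eq_0_iff)
  moreover have "degree_in (- A) (f * g) = degree_in (- A) f + degree_in (- A) g"
    using assms(2) by (intro degree_in_mult) auto
  ultimately show "f \<in> vars_in A" "g \<in> vars_in A"
    using degree_in_eq_0_iff[of "- A" f] degree_in_eq_0_iff[of "- A" g] by simp_all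
qed

lemma total_degree_eq_0_iff: "total_degree f = 0 \<longleftrightarrow> (\<exists>c. f = pconst c)"
  by (simp add: degree_in_eq_0_iff vars_in_empty_iff)

lemma mpoly_is_unit_iff: "f dvd 1 \<longleftrightarrow> (\<exists>c. c \<noteq> 0 \<and> f = pconst c)" for f :: "('v, 'a::field) mpoly"
proof
  assume "f dvd 1"
  then obtain g where fg: "f * g = 1" by (metis dvdE)
  hence nz: "f \<noteq> 0" "g \<noteq> 0" by auto
  have "total_degree f + total_degree g = 0"
    using degree_in_mult[OF nz, of UNIV] fg by (simp add: hom_simps)
  thus "\<exists>c. c \<noteq> 0 \<and> f = pconst c" using nz by (auto simp: total_degree_eq_0_iff)
next
  assume "\<exists>c. c \<noteq> 0 \<and> f = pconst c"
  then obtain c where c: "c \<noteq> 0" "f = pconst c" by blast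
  hence "f * pconst (inverse c) = 1" by (simp flip: pconst.mult add: pconst.one)
  thus "f dvd 1" by (metis dvd_triv_left)
qed

section \<open>Factoriality of polynomial rings\<close>

lemma total_degree_less_mult_nonunit:
  fixes p f :: "('v, 'a::field) mpoly"
  assumes "\<not> p dvd 1" "p \<noteq> 0" "f \<noteq> 0"
  shows "total_degree f < total_degree (p * f)"
proof -
  have "total_degree p \<noteq> 0" using assms(1,2) by (auto simp: total_degree_eq_0_iff mpoly_is_unit_iff)
  thus ?thesis using assms(2,3) by (simp add: degree_in_mult)
qed

lemma mpoly_ex_irreducible_dvd:
  "f \<noteq> 0 \<Longrightarrow> \<not> f dvd 1 \<Longrightarrow> \<exists>p. irreducible p \<and> p dvd f" for f :: "('v, 'a::field) mpoly"
proof (induction "total_degree f" arbitrary: f rule: less_induct)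
  case less
  show ?case
  proof (cases "irreducible f")
    case False
    then obtain g h where gh: "f = h * g" "\<not> g dvd 1" "\<not> h dvd 1"
      using less.prems by (auto simp: irreducible_def)
    moreover have "total_degree g < total_degree f"
      using gh less.prems total_degree_less_mult_nonunit[of h g] by auto
    ultimately show ?thesis using less.hyps[of g] less.prems by auto
  qed auto
qed

definition poly_in_var :: "'v \<Rightarrow> ('v, 'a::comm_ring_1) mpoly \<Rightarrow> ('v, 'a) mpoly poly" where
  "poly_in_var x f = cpeval (\<lambda>v. if v = x then [:0, 1:] else [:pvar v:]) f (\<lambda>c. [:pconst c:])"

interpretation poly_in_var: comm_ring_hom "poly_in_var x" for x
  unfolding poly_in_var_def by (rule const_const_poly.cpeval_hom)

lemma poly_in_var_pvar [simp]: "poly_in_var x (pvar x) = [:0, 1:]"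
  by (simp add: poly_in_var_def)

lemma poly_poly_in_var [simp]: "poly (poly_in_var x f) (pvar x) = f"
  by (rule comm_ring_hom_mpoly_eqI[OF comm_ring_hom_comp[OF poly_hom.comm_ring_hom_axioms
          poly_in_var.comm_ring_hom_axioms] comm_ring_hom.intro])
    (auto simp: poly_in_var_def)

lemma poly_in_var_eq_0_iff [simp]: "poly_in_var x f = 0 \<longleftrightarrow> f = 0"
  by (metis poly_0 poly_poly_in_var poly_in_var.zero)

lemma poly_in_var_const:
  assumes "f \<in> vars_in A" "x \<notin> A"
  shows "poly_in_var x f = [:f:]"
  unfolding poly_in_var_def using assms(2)
  by (intro cpeval_eq_hom_on_vars_in[OF assms(1) const_poly.comm_ring_hom_axioms
        const_const_poly.comm_ring_hom_axioms]) auto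

lemma coeff_poly_in_var:
  assumes "f \<in> vars_in (insert x A)"
  shows "coeff (poly_in_var x f) i \<in> vars_in A"
proof -
  define C :: "('a, 'b) mpoly poly set" where "C = {p. \<forall>i. coeff p i \<in> vars_in A}"
  have const: "[:c:] \<in> C" if "c \<in> vars_in A" for c
    using that by (auto simp: C_def coeff_pCons split: nat.splits)
  have sum: "(\<And>y. y \<in> Y \<Longrightarrow> F y \<in> C) \<Longrightarrow> sum F Y \<in> C" for Y :: "('a \<Rightarrow>\<^sub>0 nat) set" and F
    by (auto simp: C_def coeff_sum intro: vars_in_sum)
  have mult: "p * q \<in> C" if "p \<in> C" "q \<in> C" for p q
    using that by (auto simp: C_def coeff_mult intro!: vars_in_sum vars_in_mult)
  have one: "1 \<in> C" using const[of 1] by (simp add: one_pCons)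
  have power: "p ^ k \<in> C" if "p \<in> C" for p k
    by (induction k) (auto intro: mult one that)
  have prod: "(\<And>y. y \<in> Y \<Longrightarrow> F y \<in> C) \<Longrightarrow> prod F Y \<in> C" for Y :: "'a set" and F
    by (induction Y rule: infinite_finite_induct) (auto intro: mult one)
  have "(if v = x then [:0, 1:] else [:pvar v:]) \<in> C"
    if "m \<in> Poly_Mapping.keys f" "v \<in> Poly_Mapping.keys m" for m v
  proof -
    have "[:0, 1:] \<in> C" by (auto simp: C_def coeff_pCons split: nat.splits)
    moreover have "v \<in> insert x A" using that assms by (force simp: vars_in_def)
    ultimately show ?thesis by (auto intro!: const vars_in_pvar)
  qed
  hence "poly_in_var x f \<in> C"
    unfolding poly_in_var_def cpeval_def by (intro sum mult prod power) (auto intro: const)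
  thus ?thesis by (simp add: C_def)
qed

lemma dvd_iff_dvd_coeff_poly_in_var:
  assumes "p \<in> vars_in A" "x \<notin> A"
  shows "p dvd f \<longleftrightarrow> (\<forall>i. p dvd coeff (poly_in_var x f) i)"
proof
  assume "p dvd f"
  then obtain g where "f = p * g" by (elim dvdE)
  hence "poly_in_var x f = smult p (poly_in_var x g)"
    using poly_in_var_const[OF assms] by (simp add: hom_simps)
  thus "\<forall>i. p dvd coeff (poly_in_var x f) i" by simp
next
  assume "\<forall>i. p dvd coeff (poly_in_var x f) i"
  hence "p dvd poly (poly_in_var x f) (pvar x)"
    unfolding poly_altdef by (intro dvd_sum) auto
  thus "p dvd f" by simp
qed

definition irreducible_imp_prime_in :: "'a::field itself \<Rightarrow> 'v set \<Rightarrow> bool" where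
  "irreducible_imp_prime_in _ A \<longleftrightarrow> (\<forall>p\<in>vars_in A :: ('v, 'a) mpoly set. irreducible p \<longrightarrow>
     (\<forall>f\<in>vars_in A. \<forall>g\<in>vars_in A. p dvd f * g \<longrightarrow> p dvd f \<or> p dvd g))"

text \<open>If \<open>p\<close> divides neither factor, consider the first coefficients of the factors that it does not divide.\<close>
lemma irreducible_imp_prime_in_dvd_mult:
  fixes p :: "('v, 'a::field) mpoly"
  assumes prime: "irreducible_imp_prime_in TYPE('a) A" and x: "x \<notin> A"
    and p: "p \<in> vars_in A" "irreducible p"
    and f: "f \<in> vars_in (insert x A)" and g: "g \<in> vars_in (insert x A)" and dvd: "p dvd f * g"
  shows "p dvd f \<or> p dvd g"
proof (rule ccontr)
  assume neg: "\<not> (p dvd f \<or> p dvd g)"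
  note dvd_iff = dvd_iff_dvd_coeff_poly_in_var[OF p(1) x]
  let ?f = "coeff (poly_in_var x f)" and ?g = "coeff (poly_in_var x g)"
  obtain i where i: "\<not> p dvd ?f i" "\<And>l. l < i \<Longrightarrow> p dvd ?f l"
    using neg dvd_iff[of f] exists_least_iff[of "\<lambda>i. \<not> p dvd ?f i"] by blast
  obtain j where j: "\<not> p dvd ?g j" "\<And>l. l < j \<Longrightarrow> p dvd ?g l"
    using neg dvd_iff[of g] exists_least_iff[of "\<lambda>j. \<not> p dvd ?g j"] by blast
  have "p dvd (\<Sum>l\<le>i+j. ?f l * ?g (i + j - l))"
    using dvd dvd_iff[of "f * g"] by (simp add: hom_simps coeff_mult)
  also have "(\<Sum>l\<le>i+j. ?f l * ?g (i + j - l)) = ?f i * ?g j + (\<Sum>l\<in>{..i+j} - {i}. ?f l * ?g (i + j - l))"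
    by (subst sum.remove[of _ i]) auto
  finally have "p dvd ?f i * ?g j + (\<Sum>l\<in>{..i+j} - {i}. ?f l * ?g (i + j - l))" .
  moreover have "p dvd (\<Sum>l\<in>{..i+j} - {i}. ?f l * ?g (i + j - l))"
  proof (rule dvd_sum)
    fix l assume "l \<in> {..i+j} - {i}"
    hence "l < i \<or> i + j - l < j" by auto
    thus "p dvd ?f l * ?g (i + j - l)" using i(2) j(2) by auto
  qed
  ultimately have "p dvd ?f i * ?g j" by (simp add: dvd_add_left_iff)
  thus False
    using prime p i(1) j(1) coeff_poly_in_var[OF f] coeff_poly_in_var[OF g]
    unfolding irreducible_imp_prime_in_def by blast
qed

definition primitive_over :: "'v set \<Rightarrow> ('v, 'a::field) mpoly \<Rightarrow> bool" where
  "primitive_over A m \<longleftrightarrow> (\<forall>p\<in>vars_in A. irreducible p \<longrightarrow> \<not> p dvd m)"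

lemma primitive_dvd_cancel:
  fixes c f q m :: "('v, 'a::field) mpoly"
  assumes prime: "irreducible_imp_prime_in TYPE('a) A" and x: "x \<notin> A"
    and m: "m \<in> vars_in (insert x A)" "primitive_over A m"
  shows "c \<in> vars_in A \<Longrightarrow> c \<noteq> 0 \<Longrightarrow> q \<in> vars_in (insert x A) \<Longrightarrow> c * f = q * m \<Longrightarrow> m dvd f"
proof (induction "total_degree c" arbitrary: c q rule: less_induct)
  case less
  show ?case
  proof (cases "c dvd 1")
    case True
    then obtain d where "1 = c * d" by (elim dvdE)
    hence "f = d * q * m" using less.prems(4) by (metis mult.assoc mult.commute mult_1)
    thus ?thesis by simp
  next
    case False
    then obtain p c' where p: "irreducible p" and c: "c = p * c'"
      using mpoly_ex_irreducible_dvd less.prems(2) by (metis dvdE)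
    have nz: "p \<noteq> 0" "c' \<noteq> 0" using less.prems c by auto
    have pA: "p \<in> vars_in A" "c' \<in> vars_in A" using vars_in_factor[of p c' A] less.prems c by auto
    have "p dvd q * m" using less.prems(4) c by (metis dvd_triv_left mult.assoc)
    hence "p dvd q"
      using irreducible_imp_prime_in_dvd_mult[OF prime x pA(1) p less.prems(3) m(1)] m(2) p pA(1)
      by (auto simp: primitive_over_def)
    then obtain q' where q: "q = p * q'" by (elim dvdE)
    have "q' \<in> vars_in (insert x A)"
      by (cases "q' = 0") (use vars_in_factor[of p q' "insert x A"] less.prems(3) q nz in auto)
    moreover have "c' * f = q' * m"
      using less.prems(4) nz by (simp add: c q mult.assoc mpoly_mult_left_cancel)
    moreover have "total_degree c' < total_degree c"
      using p nz c by (simp add: total_degree_less_mult_nonunit irreducible_not_unit)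
    ultimately show ?thesis using less.hyps[of c' q'] pA nz by auto
  qed
qed

lemma pseudo_division_step:
  fixes f m :: "('v, 'a::field) mpoly" and x :: 'v
  defines "lf \<equiv> lead_coeff (poly_in_var x f)" and "lm \<equiv> lead_coeff (poly_in_var x m)"
  defines "e \<equiv> degree (poly_in_var x f) - degree (poly_in_var x m)"
  defines "g \<equiv> lm * f - lf * pvar x ^ e * m"
  assumes lc: "lf \<in> vars_in A" "lm \<in> vars_in A" "x \<notin> A"
    and le: "degree (poly_in_var x m) \<le> degree (poly_in_var x f)" and nz: "g \<noteq> 0"
  shows "degree (poly_in_var x g) < degree (poly_in_var x f)"
proof -
  let ?P = "poly_in_var x"
  have g: "?P g = smult lm (?P f) - smult lf (monom 1 e * ?P m)"
    using poly_in_var_const[OF lc(1,3)] poly_in_var_const[OF lc(2,3)]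
    by (simp add: g_def hom_simps monom_altdef)
  have "degree (monom 1 e * ?P m) \<le> degree (?P f)"
    using le by (intro order.trans[OF degree_mult_le]) (simp add: degree_monom_eq e_def)
  hence "degree (?P g) \<le> degree (?P f)"
    unfolding g by (intro degree_diff_le order.trans[OF degree_smult_le]) auto
  moreover have "coeff (?P g) (degree (?P f)) = 0"
    using le by (simp add: g coeff_monom_mult e_def mult.commute[of lm lf] flip: lf_def lm_def)
  moreover have "?P g \<noteq> 0" using nz by simp
  ultimately show ?thesis by (metis leading_coeff_0_iff order_le_less)
qed

lemma pseudo_division:
  fixes m :: "('v, 'a::field) mpoly"
  assumes m: "m \<in> vars_in (insert x A)" "m \<noteq> 0" and x: "x \<notin> A"
  shows "f \<in> vars_in (insert x A) \<Longrightarrow>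
    \<exists>c\<in>vars_in A. \<exists>q\<in>vars_in (insert x A). \<exists>r\<in>vars_in (insert x A).
      c \<noteq> 0 \<and> c * f = q * m + r \<and> (r = 0 \<or> degree (poly_in_var x r) < degree (poly_in_var x m))"
proof (induction "degree (poly_in_var x f)" arbitrary: f rule: less_induct)
  case less
  let ?A' = "vars_in (insert x A) :: ('v, 'a) mpoly set" and ?deg = "\<lambda>f. degree (poly_in_var x f)"
  have A': "c \<in> ?A'" if "c \<in> vars_in A" for c using that by (rule vars_in_mono) auto
  show ?case
  proof (cases "f = 0 \<or> ?deg f < ?deg m")
    case True
    thus ?thesis using less.prems by (intro bexI[of _ 1] bexI[of _ 0] bexI[of _ f]) auto
  next
    case False
    define lf where "lf = lead_coeff (poly_in_var x f)"
    define lm where "lm = lead_coeff (poly_in_var x m)"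
    define s where "s = lf * pvar x ^ (?deg f - ?deg m)"
    define g where "g = lm * f - s * m"
    have lc: "lf \<in> vars_in A" "lm \<in> vars_in A"
      using less.prems m(1) by (auto simp: lf_def lm_def intro: coeff_poly_in_var)
    have sA: "s \<in> ?A'"
      unfolding s_def by (intro vars_in_mult vars_in_power vars_in_pvar A' lc) simp
    have gA: "g \<in> ?A'"
      unfolding g_def by (intro vars_in_diff vars_in_mult sA A' lc less.prems m)
    have nz: "lm \<noteq> 0" using m(2) by (simp add: lm_def)
    have "?deg g < ?deg f" if "g \<noteq> 0"
      using pseudo_division_step[of x f A m] lc x False that by (simp add: g_def s_def lf_def lm_def)
    then obtain c q r where IH: "c \<in> vars_in A" "q \<in> ?A'" "r \<in> ?A'" "c \<noteq> 0"
      "c * g = q * m + r" "r = 0 \<or> ?deg r < ?deg m"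
      using less.hyps[OF _ gA] by (cases "g = 0") (force intro: that[of 1 0 0], blast)
    have "c * lm * f = (q + c * s) * m + r" using IH(5) by (simp add: g_def algebra_simps)
    thus ?thesis using IH nz lc sA
      by (intro bexI[of _ "c * lm"] bexI[of _ "q + c * s"] bexI[of _ r])
        (auto intro: vars_in_add vars_in_mult A')
  qed
qed

lemma least_imp_primitive_over:
  fixes m :: "('v, 'a::field) mpoly"
  assumes x: "x \<notin> A" and m: "m \<in> J" "m \<noteq> 0"
    and least: "\<And>y. y \<in> J - {0} \<Longrightarrow> degree (poly_in_var x y) = degree (poly_in_var x m) \<Longrightarrow>
      total_degree m \<le> total_degree y"
    and saturated: "\<And>p y. p \<in> vars_in A \<Longrightarrow> irreducible p \<Longrightarrow> p * y \<in> J \<Longrightarrow> y \<in> J"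
  shows "primitive_over A m"
  unfolding primitive_over_def
proof (intro ballI impI notI)
  fix p assume p: "p \<in> vars_in A" "irreducible p" "p dvd m"
  then obtain m' where m': "m = p * m'" by (elim dvdE)
  hence nz: "p \<noteq> 0" "m' \<noteq> 0" using m by auto
  have "poly_in_var x m = smult p (poly_in_var x m')"
    using poly_in_var_const[OF p(1) x] by (simp add: m' hom_simps)
  moreover have "degree (poly_in_var x m') \<le> degree (smult p (poly_in_var x m'))"
    using nz by (intro le_degree) simp
  ultimately have "degree (poly_in_var x m') = degree (poly_in_var x m)"
    using degree_smult_le[of p "poly_in_var x m'"] by simp
  moreover have "m' \<in> J - {0}" using saturated p m m' nz by blast
  moreover have "total_degree m' < total_degree m"
    using p nz m' by (simp add: total_degree_less_mult_nonunit irreducible_not_unit)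
  ultimately show False using least by fastforce
qed

text \<open>A nonzero element of least degree in \<open>x\<close> and, among these, of least total degree is primitive
  and divides every element by pseudo-division.\<close>
lemma saturated_ideal_principal:
  fixes J :: "('v, 'a::field) mpoly set"
  assumes prime: "irreducible_imp_prime_in TYPE('a) A" and x: "x \<notin> A"
    and J: "J \<subseteq> vars_in (insert x A)" "y\<^sub>0 \<in> J" "y\<^sub>0 \<noteq> 0"
    and ideal: "\<And>c y q z. y \<in> J \<Longrightarrow> z \<in> J \<Longrightarrow> c \<in> vars_in (insert x A) \<Longrightarrow> q \<in> vars_in (insert x A) \<Longrightarrow>
      c * y - q * z \<in> J"
    and saturated: "\<And>p y. p \<in> vars_in A \<Longrightarrow> irreducible p \<Longrightarrow> p * y \<in> J \<Longrightarrow> y \<in> J"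
  obtains m where "m \<in> J" "\<And>y. y \<in> J \<Longrightarrow> m dvd y"
proof -
  let ?deg = "\<lambda>f. degree (poly_in_var x f)"
  obtain m\<^sub>0 where m\<^sub>0: "m\<^sub>0 \<in> J - {0}" "\<And>y. y \<in> J - {0} \<Longrightarrow> ?deg m\<^sub>0 \<le> ?deg y"
    using ex_has_least_nat[of "\<lambda>y. y \<in> J - {0}" y\<^sub>0 ?deg] J by auto
  obtain m where m: "m \<in> J" "m \<noteq> 0" "?deg m = ?deg m\<^sub>0"
    and least: "\<And>y. y \<in> J - {0} \<Longrightarrow> ?deg y = ?deg m\<^sub>0 \<Longrightarrow> total_degree m \<le> total_degree y"
    using ex_has_least_nat[of "\<lambda>y. y \<in> J - {0} \<and> ?deg y = ?deg m\<^sub>0" m\<^sub>0 total_degree] m\<^sub>0 by auto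
  have mA: "m \<in> vars_in (insert x A)" using m J by blast
  have "primitive_over A m"
    using least saturated m(3) by (intro least_imp_primitive_over[OF x m(1,2)]) auto
  moreover have "\<exists>c\<in>vars_in A. \<exists>q\<in>vars_in (insert x A). c \<noteq> 0 \<and> c * y = q * m" if y: "y \<in> J" for y
  proof -
    have "y \<in> vars_in (insert x A)" using y J(1) by blast
    from pseudo_division[OF mA m(2) x this]
    obtain c q r where c: "c \<in> vars_in A" "q \<in> vars_in (insert x A)" "c \<noteq> 0" "c * y = q * m + r"
      and r: "r = 0 \<or> ?deg r < ?deg m"
      by (elim bexE conjE)
    have "c * y - q * m \<in> J" using c y m vars_in_mono[of c A "insert x A"] by (intro ideal) auto
    hence "r \<in> J" using c(4) by simp
    hence "r = 0" using r m\<^sub>0(2) m(3) by fastforce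
    thus ?thesis using c by auto
  qed
  ultimately have "m dvd y" if "y \<in> J" for y
    using primitive_dvd_cancel[OF prime x mA] that by meson
  thus ?thesis by (rule that[OF m(1)])
qed

lemma irreducible_dvd_cancel_lower:
  fixes p q f :: "('v, 'a::field) mpoly"
  assumes prime: "irreducible_imp_prime_in TYPE('a) A" and x: "x \<notin> A"
    and p: "p \<in> vars_in (insert x A)" "irreducible p" "p \<notin> vars_in A"
    and q: "q \<in> vars_in A" "irreducible q"
    and f: "f \<in> vars_in (insert x A)" and dvd: "p dvd q * f"
  shows "p dvd f"
proof (cases "f = 0")
  case False
  obtain z where z: "q * f = p * z" using dvd by (elim dvdE)
  have q0: "q \<noteq> 0" using q by auto
  have "p * z \<in> vars_in (insert x A)"
    unfolding z[symmetric] by (intro vars_in_mult f vars_in_mono[OF q(1)]) auto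
  hence "z \<in> vars_in (insert x A)" using vars_in_factor(2)[of p z] z False q0 by force
  moreover have "q dvd p * z" unfolding z[symmetric] by simp
  moreover have "\<not> q dvd p"
  proof
    assume "q dvd p"
    then obtain u where u: "p = q * u" by (elim dvdE)
    hence "u dvd 1" using p(2) q(2) by (metis irreducibleD irreducible_not_unit)
    hence "u \<in> vars_in A" by (auto simp: mpoly_is_unit_iff)
    thus False using p(3) u vars_in_mult[OF q(1)] by blast
  qed
  ultimately have "q dvd z"
    using irreducible_imp_prime_in_dvd_mult[OF prime x q p(1)] by blast
  then obtain z' where "z = q * z'" by (elim dvdE)
  hence "q * f = q * (p * z')" using z by (simp add: mult_ac)
  hence "f = p * z'" using q0 by (simp only: mpoly_mult_left_cancel) simp
  thus ?thesis by simp
qed simp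

lemma irreducible_imp_prime_in_insert:
  assumes prime: "irreducible_imp_prime_in TYPE('a::field) A" and x: "x \<notin> A"
  shows "irreducible_imp_prime_in TYPE('a) (insert x A)"
  unfolding irreducible_imp_prime_in_def
proof (intro ballI impI)
  fix p a b :: "('b, 'a) mpoly"
  let ?A' = "vars_in (insert x A) :: ('b, 'a) mpoly set"
  assume p: "p \<in> ?A'" "irreducible p" and a: "a \<in> ?A'" and b: "b \<in> ?A'" and dvd: "p dvd a * b"
  note prime_over_A = irreducible_imp_prime_in_dvd_mult[OF prime x]
  consider "p \<in> vars_in A" | "a = 0" | "p \<notin> vars_in A" "a \<noteq> 0" by blast
  thus "p dvd a \<or> p dvd b"
  proof cases
    case 3
    define J where "J = {y \<in> ?A'. p dvd a * y}"
    obtain m where m: "m \<in> J" "\<And>y. y \<in> J \<Longrightarrow> m dvd y"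
    proof (rule saturated_ideal_principal[OF prime x, of J p])
      fix q y assume q: "q \<in> vars_in A" "irreducible q" and qy: "q * y \<in> J"
      show "y \<in> J"
      proof (cases "y = 0")
        case False
        have "q \<noteq> 0" using q(2) by auto
        hence y: "y \<in> ?A'" using qy vars_in_factor(2)[of q y] False by (simp add: J_def)
        have "p dvd q * (a * y)" using qy by (simp add: J_def mult.left_commute)
        hence "p dvd a * y"
          by (rule irreducible_dvd_cancel_lower[OF prime x p 3(1) q vars_in_mult[OF a y]])
        thus ?thesis using y by (simp add: J_def)
      qed (simp add: J_def)
    next
      fix c y q z assume yz: "y \<in> J" "z \<in> J" and cq: "c \<in> ?A'" "q \<in> ?A'"
      have "a * (c * y - q * z) = c * (a * y) - q * (a * z)" by (simp add: algebra_simps)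
      thus "c * y - q * z \<in> J" using yz cq by (auto simp: J_def intro!: vars_in_diff vars_in_mult dvd_diff)
    qed (use p in \<open>auto simp: J_def\<close>)
    obtain u where u: "p = m * u" using m(2)[of p] p(1) by (auto simp: J_def elim: dvdE)
    hence "m dvd 1 \<or> u dvd 1" using p(2) by (auto simp: irreducible_def)
    moreover have "p dvd a" if "m dvd 1"
      using mult_dvd_mono[OF dvd_refl that, of a] m(1) dvd_trans[of p "a * m" a] by (simp add: J_def)
    moreover have "p dvd b" if "u dvd 1"
      using mult_dvd_mono[OF dvd_refl that, of m] m(2)[of b] b dvd u dvd_trans[of p m b] by (simp add: J_def)
    ultimately show ?thesis by blast
  qed (use prime_over_A p a b dvd in auto)
qed

lemma irreducible_imp_prime_in_finite: "finite A \<Longrightarrow> irreducible_imp_prime_in TYPE('a::field) A"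
proof (induction A rule: finite_induct)
  case empty
  have "\<not> irreducible p" if "p \<in> vars_in {}" for p :: "('b, 'a) mpoly"
    using that mpoly_is_unit_iff[of p] by (auto simp: vars_in_empty_iff irreducible_def)
  thus ?case by (simp add: irreducible_imp_prime_in_def)
qed (rule irreducible_imp_prime_in_insert)

lemma mpoly_irreducible_imp_prime_elem:
  fixes p :: "('v, 'a::field) mpoly"
  assumes "irreducible p"
  shows "prime_elem p"
proof (rule prime_elemI)
  fix f g assume dvd: "p dvd f * g"
  obtain A B C where "finite A" "p \<in> vars_in A" "finite B" "f \<in> vars_in B" "finite C" "g \<in> vars_in C"
    using ex_finite_vars_in by metis
  hence "irreducible_imp_prime_in TYPE('a) (A \<union> B \<union> C)"
    and "p \<in> vars_in (A \<union> B \<union> C)" "f \<in> vars_in (A \<union> B \<union> C)" "g \<in> vars_in (A \<union> B \<union> C)"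
    by (auto intro: vars_in_mono irreducible_imp_prime_in_finite)
  thus "p dvd f \<or> p dvd g"
    using assms dvd by (simp add: irreducible_imp_prime_in_def)
qed (use assms in \<open>auto simp: irreducible_def\<close>)

lemma mpoly_coprime_dvd_mult:
  fixes f g h :: "('v, 'a::field) mpoly"
  shows "g \<noteq> 0 \<Longrightarrow> (\<And>p. irreducible p \<Longrightarrow> p dvd f \<Longrightarrow> \<not> p dvd g) \<Longrightarrow> g dvd f * h \<Longrightarrow> g dvd h"
proof (induction "total_degree g" arbitrary: g h rule: less_induct)
  case less
  show ?case
  proof (cases "g dvd 1")
    case False
    then obtain p g' where p: "irreducible p" and g: "g = p * g'"
      using mpoly_ex_irreducible_dvd less.prems(1) by (metis dvdE)
    have nz: "p \<noteq> 0" "g' \<noteq> 0" using less.prems g by auto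
    have "p dvd f * h" using less.prems(3) g by auto
    hence "p dvd h"
      using mpoly_irreducible_imp_prime_elem[OF p] less.prems(2)[OF p] g by (auto simp: prime_elem_dvd_mult_iff)
    then obtain h' where h: "h = p * h'" by (elim dvdE)
    obtain k where "f * h = g * k" using less.prems(3) by (elim dvdE)
    hence "p * (f * h') = p * (g' * k)" by (simp add: g h mult_ac)
    hence "g' dvd f * h'" using nz by (simp only: mpoly_mult_left_cancel) simp
    moreover have "total_degree g' < total_degree g"
      using p nz g by (simp add: total_degree_less_mult_nonunit irreducible_not_unit)
    ultimately have "g' dvd h'" using less.hyps[of g' h'] nz less.prems(2) unfolding g by (metis dvd_mult)
    thus ?thesis unfolding g h by (rule mult_dvd_mono[OF dvd_refl])
  qed (auto intro: dvd_trans[of _ 1])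
qed

lemma mpoly_colon_ideal_principal:
  fixes f g :: "('v, 'a::field) mpoly"
  shows "g \<noteq> 0 \<Longrightarrow> \<exists>m. \<forall>h. g dvd f * h \<longleftrightarrow> m dvd h"
proof (induction "total_degree g" arbitrary: f g rule: less_induct)
  case less
  show ?case
  proof (cases "\<exists>p. irreducible p \<and> p dvd f \<and> p dvd g")
    case False
    hence "g dvd f * h \<longleftrightarrow> g dvd h" for h
      using mpoly_coprime_dvd_mult[of g f h] less.prems by auto
    thus ?thesis by blast
  next
    case True
    then obtain p f' g' where p: "irreducible p" and fg: "f = p * f'" "g = p * g'" by (auto elim!: dvdE)
    have nz: "p \<noteq> 0" "g' \<noteq> 0" using less.prems fg by auto
    have "total_degree g' < total_degree g"
      using p nz fg by (simp add: total_degree_less_mult_nonunit irreducible_not_unit)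
    then obtain m where "\<forall>h. g' dvd f' * h \<longleftrightarrow> m dvd h" using less.hyps[of g' f'] nz by auto
    moreover have "p * g' dvd p * k \<longleftrightarrow> g' dvd k" for k
      using nz by (auto simp: dvd_def mult.assoc mpoly_mult_left_cancel)
    ultimately show ?thesis unfolding fg by (auto simp: mult.assoc)
  qed
qed

section \<open>Vanishing, homogeneity and derivations\<close>

lemma cpeval_fun_upd_poly_in_var:
  fixes f :: "('v, 'a::field) mpoly"
  assumes "f \<in> vars_in (insert x A)" "x \<notin> A"
  shows "cpeval (s(x := y)) f id = poly (map_poly (\<lambda>c. cpeval s c id) (poly_in_var x f)) y"
proof -
  let ?p = "poly_in_var x f"
  have const: "cpeval (s(x := y)) (coeff ?p i) id = cpeval s (coeff ?p i) id" for i
    using assms(2)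
    by (intro cpeval_eq_hom_on_vars_in[OF coeff_poly_in_var[OF assms(1)] cpeval_id.comm_ring_hom_axioms
          id_hom.comm_ring_hom_axioms]) auto
  have "cpeval (s(x := y)) f id = cpeval (s(x := y)) (poly ?p (pvar x)) id" by simp
  also have "\<dots> = (\<Sum>i\<le>degree ?p. coeff (map_poly (\<lambda>c. cpeval s c id) ?p) i * y ^ i)"
    by (simp add: poly_altdef hom_simps const coeff_map_poly)
  also have "\<dots> = poly (map_poly (\<lambda>c. cpeval s c id) ?p) y"
    unfolding poly_altdef
    by (intro sum.mono_neutral_right) (auto simp: coeff_eq_0 map_poly_degree_leq)
  finally show ?thesis .
qed

lemma mpoly_eq_0_on_vars_in:
  fixes f :: "('v, 'a::field_char_0) mpoly"
  shows "finite A \<Longrightarrow> f \<in> vars_in A \<Longrightarrow> (\<And>s. cpeval s f id = 0) \<Longrightarrow> f = 0"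
proof (induction A arbitrary: f rule: finite_induct)
  case empty
  then obtain c where "f = pconst c" by (auto simp: vars_in_empty_iff)
  moreover have "cpeval (\<lambda>_. 0) f id = 0" by (rule empty.prems)
  ultimately show ?case by (simp add: hom_simps)
next
  case (insert x A)
  have "coeff (poly_in_var x f) i = 0" for i
  proof (rule insert.IH[OF coeff_poly_in_var[OF insert.prems(1)]])
    fix s :: "'v \<Rightarrow> 'a"
    have "poly (map_poly (\<lambda>c. cpeval s c id) (poly_in_var x f)) y = 0" for y
      using cpeval_fun_upd_poly_in_var[OF insert.prems(1) insert.hyps(2)] insert.prems(2) by metis
    hence "map_poly (\<lambda>c. cpeval s c id) (poly_in_var x f) = 0"
      using poly_all_0_iff_0 by blast
    hence "coeff (map_poly (\<lambda>c. cpeval s c id) (poly_in_var x f)) i = 0" by simp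
    thus "cpeval s (coeff (poly_in_var x f) i) id = 0"
      by (simp add: coeff_map_poly hom_simps)
  qed
  hence "poly_in_var x f = 0" by (intro poly_eqI) simp
  thus ?case by simp
qed

lemma mpoly_eq_0I:
  fixes f :: "('v, 'a::field_char_0) mpoly"
  assumes "\<And>s. cpeval s f id = 0"
  shows "f = 0"
  using mpoly_eq_0_on_vars_in assms ex_finite_vars_in by metis

definition homogeneous :: "nat \<Rightarrow> ('v, 'a::comm_ring_1) mpoly \<Rightarrow> bool" where
  "homogeneous d f \<longleftrightarrow> scale_vars UNIV f = monom f d"

definition homogeneous_component :: "nat \<Rightarrow> ('v, 'a::comm_ring_1) mpoly \<Rightarrow> ('v, 'a) mpoly" where
  "homogeneous_component d f = coeff (scale_vars UNIV f) d"

lemma homogeneous_pvar: "homogeneous 1 (pvar v)"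
  by (simp add: homogeneous_def monom_Suc monom_0)

lemma homogeneous_diff: "homogeneous d f \<Longrightarrow> homogeneous d g \<Longrightarrow> homogeneous d (f - g)"
  by (simp add: homogeneous_def hom_simps diff_monom)

lemma homogeneous_pconst_mult: "homogeneous d f \<Longrightarrow> homogeneous d (pconst c * f)"
  by (simp add: homogeneous_def hom_simps smult_monom)

lemma homogeneous_sum: "(\<And>x. x \<in> X \<Longrightarrow> homogeneous d (f x)) \<Longrightarrow> homogeneous d (\<Sum>x\<in>X. f x)"
  by (simp add: homogeneous_def hom_simps monom_sum)

lemma homogeneous_component_0 [simp]: "homogeneous_component d 0 = 0"
  by (simp add: homogeneous_component_def hom_simps)

lemma homogeneous_component_add:
  "homogeneous_component d (f + g) = homogeneous_component d f + homogeneous_component d g"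
  by (simp add: homogeneous_component_def hom_simps)

lemma homogeneous_component_sum:
  "homogeneous_component d (\<Sum>x\<in>X. f x) = (\<Sum>x\<in>X. homogeneous_component d (f x))"
  by (simp add: homogeneous_component_def hom_simps coeff_sum)

lemma homogeneous_component_mult:
  "homogeneous_component d (f * g)
    = (\<Sum>i\<le>d. homogeneous_component i f * homogeneous_component (d - i) g)"
  by (simp add: homogeneous_component_def hom_simps coeff_mult)

lemma homogeneous_component_homogeneous:
  "homogeneous d f \<Longrightarrow> homogeneous_component e f = (if e = d then f else 0)"
  by (simp add: homogeneous_def homogeneous_component_def)

lemma homogeneous_homogeneous_component: "homogeneous d (homogeneous_component d f)"
proof (induction f arbitrary: d rule: mpoly_induct)
  case (const c)
  show ?case
    by (cases d) (auto simp: homogeneous_def homogeneous_component_def hom_simps monom_0)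
next
  case (var v)
  show ?case
    by (auto simp: homogeneous_def homogeneous_component_def hom_simps monom_Suc monom_0 coeff_pCons
        split: nat.splits)
next
  case (add f g)
  thus ?case by (simp add: homogeneous_component_add homogeneous_def hom_simps add_monom)
next
  case (mult f g)
  have "scale_vars UNIV (homogeneous_component i f * homogeneous_component (d - i) g)
    = monom (homogeneous_component i f * homogeneous_component (d - i) g) d" if "i \<le> d" for i
    using mult[of i] mult[of "d - i"] that by (simp add: homogeneous_def hom_simps mult_monom)
  thus ?case
    by (auto simp: homogeneous_component_mult homogeneous_def hom_simps monom_sum)
qed

lemma sum_homogeneous_components: "(\<Sum>d\<le>total_degree f. homogeneous_component d f) = f"
  using poly_scale_vars_1[of UNIV f] by (simp add: poly_altdef homogeneous_component_def)

lemma sum_homogeneous_eq_0: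
  assumes "finite D" "\<And>d. d \<in> D \<Longrightarrow> homogeneous d (f d)" "(\<Sum>d\<in>D. f d) = 0" "d \<in> D"
  shows "f d = 0"
proof -
  have "0 = (\<Sum>e\<in>D. homogeneous_component d (f e))"
    using assms(3) by (simp flip: homogeneous_component_sum)
  also have "\<dots> = (\<Sum>e\<in>D. if d = e then f d else 0)"
    using homogeneous_component_homogeneous[OF assms(2)] assms(4) by (intro sum.cong) auto
  also have "\<dots> = f d" using assms(1,4) by simp
  finally show ?thesis by simp
qed

text \<open>The derivation with \<open>pvar v \<mapsto> d v\<close> is the first-order part of a homomorphism to the dual numbers.\<close>
definition deriv_by :: "('v \<Rightarrow> ('v, 'a::comm_ring_1) mpoly) \<Rightarrow> ('v, 'a) mpoly \<Rightarrow> ('v, 'a) mpoly" where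
  "deriv_by d f = coeff (cpeval (\<lambda>v. [:pvar v, d v:]) f (\<lambda>c. [:pconst c:])) 1"

lemma deriv_by_pvar [simp]: "deriv_by d (pvar v) = d v"
  by (simp add: deriv_by_def)

lemma deriv_by_pconst [simp]: "deriv_by d (pconst c) = 0"
  by (simp add: deriv_by_def)

lemma deriv_by_0 [simp]: "deriv_by d 0 = 0" and deriv_by_1 [simp]: "deriv_by d 1 = 0"
  using deriv_by_pconst[of d 0] deriv_by_pconst[of d 1] by (simp_all add: hom_simps)

lemma deriv_by_add: "deriv_by d (f + g) = deriv_by d f + deriv_by d g"
  by (simp add: deriv_by_def hom_simps)

lemma deriv_by_diff: "deriv_by d (f - g) = deriv_by d f - deriv_by d g"
  by (simp add: deriv_by_def hom_simps)

lemma deriv_by_sum: "deriv_by d (\<Sum>x\<in>A. f x) = (\<Sum>x\<in>A. deriv_by d (f x))"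
  by (simp add: deriv_by_def hom_simps coeff_sum)

lemma deriv_by_mult: "deriv_by d (f * g) = deriv_by d f * g + f * deriv_by d g"
proof -
  let ?h = "\<lambda>f. cpeval (\<lambda>v. [:pvar v, d v:]) f (\<lambda>c. [:pconst c:])"
  have "poly (?h f) 0 = f" for f
    by (rule comm_ring_hom_mpoly_eqI[OF comm_ring_hom_comp[OF poly_hom.comm_ring_hom_axioms
            const_const_poly.cpeval_hom] comm_ring_hom.intro]) auto
  hence "coeff (?h f) 0 = f" for f by (simp add: poly_0_coeff_0)
  thus ?thesis by (simp add: deriv_by_def hom_simps coeff_mult)
qed

lemma deriv_by_prod:
  "finite A \<Longrightarrow> deriv_by d (\<Prod>x\<in>A. f x) = (\<Sum>x\<in>A. deriv_by d (f x) * (\<Prod>y\<in>A - {x}. f y))"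
proof (induction A rule: finite_induct)
  case (insert x A)
  have "f x * (deriv_by d (f y) * (\<Prod>z\<in>A - {y}. f z)) = deriv_by d (f y) * (\<Prod>z\<in>insert x A - {y}. f z)"
    if "y \<in> A" for y
  proof -
    have "insert x A - {y} = insert x (A - {y})" using insert that by auto
    thus ?thesis using insert by (simp add: mult_ac)
  qed
  moreover have "insert x A - {x} = A" using insert by auto
  ultimately show ?case using insert
    by (simp add: deriv_by_mult sum_distrib_left)
qed auto

lemma deriv_by_generators_0: "deriv_by (\<lambda>_. 0) f = 0"
  by (induction f rule: mpoly_induct) (auto simp: deriv_by_add deriv_by_mult)

lemma deriv_by_generators_sum: "deriv_by (\<lambda>v. \<Sum>x\<in>X. d x v) f = (\<Sum>x\<in>X. deriv_by (d x) f)"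
  by (induction f rule: mpoly_induct)
    (auto simp: deriv_by_add deriv_by_mult sum.distrib sum_distrib_left sum_distrib_right)

lemma deriv_by_generators_add: "deriv_by (\<lambda>v. d v + d' v) f = deriv_by d f + deriv_by d' f"
  by (induction f rule: mpoly_induct)
    (simp_all add: deriv_by_add deriv_by_mult distrib_left distrib_right)

lemma deriv_by_generators_diff: "deriv_by (\<lambda>v. d v - d' v) f = deriv_by d f - deriv_by d' f"
  by (induction f rule: mpoly_induct)
    (simp_all add: deriv_by_add deriv_by_mult left_diff_distrib right_diff_distrib)

lemma deriv_by_bracket:
  assumes "\<And>v. deriv_by d\<^sub>1 (d\<^sub>2 v) - deriv_by d\<^sub>2 (d\<^sub>1 v) = d v"
  shows "deriv_by d\<^sub>1 (deriv_by d\<^sub>2 f) - deriv_by d\<^sub>2 (deriv_by d\<^sub>1 f) = deriv_by d f"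
proof (induction f rule: mpoly_induct)
  case (mult f g)
  have "deriv_by d\<^sub>1 (deriv_by d\<^sub>2 (f * g)) - deriv_by d\<^sub>2 (deriv_by d\<^sub>1 (f * g))
     = (deriv_by d\<^sub>1 (deriv_by d\<^sub>2 f) - deriv_by d\<^sub>2 (deriv_by d\<^sub>1 f)) * g
     + f * (deriv_by d\<^sub>1 (deriv_by d\<^sub>2 g) - deriv_by d\<^sub>2 (deriv_by d\<^sub>1 g))"
    by (simp add: deriv_by_mult deriv_by_add algebra_simps)
  thus ?case using mult by (simp add: deriv_by_mult)
next
  case (add f g)
  have "deriv_by d\<^sub>1 (deriv_by d\<^sub>2 (f + g)) - deriv_by d\<^sub>2 (deriv_by d\<^sub>1 (f + g))
     = (deriv_by d\<^sub>1 (deriv_by d\<^sub>2 f) - deriv_by d\<^sub>2 (deriv_by d\<^sub>1 f))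
     + (deriv_by d\<^sub>1 (deriv_by d\<^sub>2 g) - deriv_by d\<^sub>2 (deriv_by d\<^sub>1 g))"
    by (simp add: deriv_by_add)
  thus ?case using add by (simp add: deriv_by_add)
qed (auto simp: assms)

lemma scale_vars_deriv_by:
  assumes d: "\<And>v. homogeneous (Suc e) (d v)"
  shows "scale_vars UNIV (deriv_by d f) = monom 1 e * map_poly (deriv_by d) (scale_vars UNIV f)"
proof -
  have map_add: "map_poly (deriv_by d) (p + q) = map_poly (deriv_by d) p + map_poly (deriv_by d) q" for p q
    by (intro poly_eqI) (simp add: coeff_map_poly deriv_by_add)
  have map_mult: "map_poly (deriv_by d) (p * q) = map_poly (deriv_by d) p * q + p * map_poly (deriv_by d) q"
    for p q
    by (intro poly_eqI) (simp add: coeff_map_poly coeff_mult deriv_by_sum deriv_by_mult sum.distrib)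
  show ?thesis
  proof (induction f rule: mpoly_induct)
    case (var v)
    show ?case using d[of v] by (simp add: homogeneous_def map_poly_pCons monom_Suc monom_0 smult_monom mult_monom)
  next
    case (add f g)
    thus ?case by (simp add: deriv_by_add hom_simps map_add distrib_left)
  next
    case (mult f g)
    thus ?case by (simp add: deriv_by_mult hom_simps map_mult distrib_left mult_ac)
  qed (simp add: hom_simps map_poly_pCons)
qed

lemma homogeneous_component_deriv_by:
  assumes "\<And>v. homogeneous (Suc e) (d v)"
  shows "homogeneous_component (e + k) (deriv_by d f) = deriv_by d (homogeneous_component k f)"
  unfolding homogeneous_component_def scale_vars_deriv_by[OF assms]
  by (simp add: coeff_monom_mult coeff_map_poly)

lemma total_degree_deriv_by_le:
  assumes "\<And>v. homogeneous 1 (d v)"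
  shows "total_degree (deriv_by d f) \<le> total_degree f"
  using scale_vars_deriv_by[of 0 d f] assms by (simp add: map_poly_degree_leq flip: One_nat_def)

lemma homogeneous_component_euler_deriv:
  "homogeneous_component k (deriv_by pvar f) = of_nat k * homogeneous_component k f"
proof (induction f arbitrary: k rule: mpoly_induct)
  case (const c)
  show ?case by (cases k) (simp_all add: homogeneous_component_def hom_simps)
next
  case (var v)
  show ?case by (auto simp: homogeneous_component_def hom_simps coeff_pCons split: nat.splits)
next
  case (add f g)
  thus ?case by (simp add: deriv_by_add homogeneous_component_add distrib_left)
next
  case (mult f g)
  let ?hc = homogeneous_component
  have "?hc k (deriv_by pvar (f * g))
    = (\<Sum>i\<le>k. of_nat i * ?hc i f * ?hc (k - i) g + ?hc i f * (of_nat (k - i) * ?hc (k - i) g))"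
    by (simp add: deriv_by_mult homogeneous_component_add homogeneous_component_mult mult sum.distrib)
  also have "\<dots> = (\<Sum>i\<le>k. of_nat k * (?hc i f * ?hc (k - i) g))"
    by (intro sum.cong refl) (simp add: of_nat_diff algebra_simps)
  finally show ?case by (simp add: homogeneous_component_mult sum_distrib_left)
qed

section \<open>Relations between words in generic matrices\<close>

lemma cvar_eq_pvar: "cvar = pvar"
  by (auto simp: cvar_def pvar_def)

lemma cconst_eq_pconst: "cconst = pconst"
  by (auto simp: cconst_def pconst_def)

lemma generic_entry [simp]: "generic k $ i $ j = pvar (k, i, j)"
  by (simp add: generic_def cvar_eq_pvar)

lemma wordmat_Nil [simp]: "wordmat A [] = mat 1"
  by (simp add: wordmat_def)

lemma wordmat_Cons [simp]: "wordmat A (k # w) = A k ** wordmat A w"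
  by (simp add: wordmat_def)

lemma (in comm_ring_hom) map_matrix_mult: "map_matrix h (A ** B) = map_matrix h A ** map_matrix h B"
  by (simp add: vec_eq_iff matrix_matrix_mult_def sum mult)

lemma (in comm_ring_hom) map_matrix_wordmat: "map_matrix h (wordmat A w) = wordmat (\<lambda>k. map_matrix h (A k)) w"
proof (induction w)
  case Nil
  show ?case by (simp add: vec_eq_iff mat_def zero one)
qed (simp add: map_matrix_mult)

definition point :: "(nat \<Rightarrow> 'a^'n^'n) \<Rightarrow> nat \<times> 'n \<times> 'n \<Rightarrow> 'a" where
  "point A = (\<lambda>(k, i, j). A k $ i $ j)"

lemma ex_point: "\<exists>A. s = point A"
  by (rule exI[of _ "\<lambda>k. \<chi> i j. s (k, i, j)"]) (auto simp: point_def)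

lemma (in comm_ring_hom) cpeval_wordmat_generic:
  "cpeval (point A) (wordmat generic w $ i $ j) h = wordmat A w $ i $ j"
proof -
  interpret eval: comm_ring_hom "\<lambda>p. cpeval (point A) p h" by (rule cpeval_hom)
  have "map_matrix (\<lambda>p. cpeval (point A) p h) (generic k) = A k" for k
    by (simp add: vec_eq_iff point_def)
  thus ?thesis using arg_cong[OF eval.map_matrix_wordmat[of generic w], of "\<lambda>B. B $ i $ j"] by simp
qed

lemma Phi_entry:
  "Phi P $ i $ j = (\<Sum>w\<in>Poly_Mapping.keys P. Poly_Mapping.lookup P w * wordmat generic w $ i $ j)"
  by (simp add: Phi_def msmult_def)

lemma Phi_entry_superset:
  assumes "finite K" "Poly_Mapping.keys P \<subseteq> K"
  shows "Phi P $ i $ j = (\<Sum>w\<in>K. Poly_Mapping.lookup P w * wordmat generic w $ i $ j)"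
  unfolding Phi_entry using assms by (intro sum.mono_neutral_left) (auto simp: in_keys_iff)

lemma Phi_single: "Phi (Poly_Mapping.single w c) $ i $ j = c * wordmat generic w $ i $ j"
  by (subst Phi_entry_superset[of "{w}"]) auto

lemma Phi_add: "Phi (P + Q) = Phi P + Phi Q"
proof -
  let ?K = "Poly_Mapping.keys P \<union> Poly_Mapping.keys Q"
  have "Poly_Mapping.keys (P + Q) \<subseteq> ?K" by (rule keys_add)
  hence "Phi (P + Q) $ i $ j = Phi P $ i $ j + Phi Q $ i $ j" for i j
    by (subst (1 2 3) Phi_entry_superset[of ?K]) (auto simp: lookup_add distrib_right sum.distrib)
  thus ?thesis by (simp add: vec_eq_iff)
qed

lemma Phi_0 [simp]: "Phi 0 = 0"
  by (simp add: Phi_def)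

lemma Phi_sum: "Phi (\<Sum>x\<in>X. f x) = (\<Sum>x\<in>X. Phi (f x))"
  by (induction X rule: infinite_finite_induct) (auto simp: Phi_add)

lemma quasi_identity_iff_Phi_eq_0:
  fixes P :: "('a::field_char_0, 'n::finite) qpoly"
  shows "quasi_identity P \<longleftrightarrow> Phi P = 0"
proof -
  have eval: "qeval A P $ i $ j = cpeval (point A) (Phi P $ i $ j) id" for A i j
    by (simp add: qeval_def msmult_def Phi_entry cpeval_id.sum cpeval_id.mult id_hom.cpeval_wordmat_generic
        flip: point_def)
  show ?thesis
  proof
    assume "quasi_identity P"
    hence "cpeval s (Phi P $ i $ j) id = 0" for s i j
      using eval ex_point[of s] by (metis quasi_identity_def zero_index)
    thus "Phi P = 0" by (simp add: vec_eq_iff mpoly_eq_0I)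
  next
    assume "Phi P = 0"
    thus "quasi_identity P" by (simp add: quasi_identity_def vec_eq_iff eval cpeval_id.zero)
  qed
qed

text \<open>A relation among polynomial multiples of curves that are independent at \<open>0\<close> can be divided
  by the parameter indefinitely.\<close>
lemma poly_relation_trivial:
  fixes p :: "'s \<Rightarrow> 'a::field poly" and W :: "'s \<Rightarrow> 'i \<Rightarrow> 'a poly"
  assumes indep: "\<And>c. (\<And>i. (\<Sum>s\<in>S. c s * poly (W s i) 0) = 0) \<Longrightarrow> \<forall>s\<in>S. c s = 0"
    and rel: "\<And>i. (\<Sum>s\<in>S. p s * W s i) = 0" and s\<^sub>0: "s\<^sub>0 \<in> S"
  shows "p s\<^sub>0 = 0"
  using rel
proof (induction "degree (p s\<^sub>0)" arbitrary: p rule: less_induct)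
  case less
  have "(\<Sum>s\<in>S. poly (p s) 0 * poly (W s i) 0) = 0" for i
    using arg_cong[OF less.prems[of i], of "\<lambda>p. poly p 0"] by (simp add: poly_sum)
  hence "\<forall>s\<in>S. poly (p s) 0 = 0" by (rule indep)
  hence "\<forall>s\<in>S. \<exists>q. p s = [:0, 1:] * q"
    by (auto simp: poly_eq_0_iff_dvd dvd_def)
  then obtain q where q: "\<And>s. s \<in> S \<Longrightarrow> p s = [:0, 1:] * q s" by metis
  have "[:0, 1:] * (\<Sum>s\<in>S. q s * W s i) = 0" for i
    using less.prems[of i] q by (simp add: sum_distrib_left mult.assoc del: mult_pCons_left)
  hence rel: "(\<Sum>s\<in>S. q s * W s i) = 0" for i by simp
  show ?case
  proof (rule ccontr)
    assume nz: "p s\<^sub>0 \<noteq> 0"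
    hence "q s\<^sub>0 \<noteq> 0" using q[OF s\<^sub>0] by auto
    moreover from this have "degree (q s\<^sub>0) < degree (p s\<^sub>0)"
      using q[OF s\<^sub>0] by (simp add: degree_pCons_eq)
    ultimately show False using less.hyps[of q] rel by simp
  qed
qed

text \<open>Restrict to the line from the point of independence \<open>x\<close> to an arbitrary point.\<close>
lemma mpoly_relation_trivial:
  fixes p :: "'s \<Rightarrow> ('v, 'a::field_char_0) mpoly" and W :: "'s \<Rightarrow> 'i \<Rightarrow> ('v, 'a) mpoly"
  assumes indep: "\<And>c. (\<And>i. (\<Sum>s\<in>S. c s * cpeval x (W s i) id) = 0) \<Longrightarrow> \<forall>s\<in>S. c s = 0"
    and rel: "\<And>i. (\<Sum>s\<in>S. p s * W s i) = 0" and s\<^sub>0: "s\<^sub>0 \<in> S"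
  shows "p s\<^sub>0 = 0"
proof (rule mpoly_eq_0I)
  fix y :: "'v \<Rightarrow> 'a"
  define line where "line = (\<lambda>f. cpeval (\<lambda>v. [:x v, y v - x v:]) f (\<lambda>c. [:c:]))"
  interpret line: comm_ring_hom line unfolding line_def by (rule const_poly.cpeval_hom)
  have line: "poly (line f) r = cpeval (\<lambda>v. x v + r * (y v - x v)) f id" for f r
    by (rule comm_ring_hom_mpoly_eqI[OF comm_ring_hom_comp[OF poly_hom.comm_ring_hom_axioms
            line.comm_ring_hom_axioms] cpeval_id.comm_ring_hom_axioms])
      (auto simp: line_def)
  have "line (p s\<^sub>0) = 0"
  proof (rule poly_relation_trivial[OF _ _ s\<^sub>0])
    show "\<forall>s\<in>S. c s = 0" if "\<And>i. (\<Sum>s\<in>S. c s * poly (line (W s i)) 0) = 0" for c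
      using that by (intro indep) (simp add: line)
    show "(\<Sum>s\<in>S. line (p s) * line (W s i)) = 0" for i
      using arg_cong[OF rel[of i], of line] by (simp add: line.sum line.mult line.zero)
  qed
  thus "cpeval y (p s\<^sub>0) id = 0" using line[of "p s\<^sub>0" 1] by simp
qed

definition word_relation :: "nat \<Rightarrow> (nat \<Rightarrow> nat list) \<Rightarrow> (nat \<Rightarrow> ('a::comm_ring_1, 'n::finite) cpoly) \<Rightarrow> bool" where
  "word_relation t M \<mu> \<longleftrightarrow> Phi (\<Sum>s\<in>{0..t}. Poly_Mapping.single (M s) (\<mu> s)) = 0"

lemma word_relation_iff:
  "word_relation t M \<mu> \<longleftrightarrow> (\<forall>i j. (\<Sum>s\<in>{0..t}. \<mu> s * wordmat generic (M s) $ i $ j) = 0)"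
  by (simp add: word_relation_def vec_eq_iff Phi_sum Phi_single)

lemma word_relation_trivial:
  fixes \<mu> :: "nat \<Rightarrow> ('a::field_char_0, 'n::finite) cpoly"
  assumes rel: "word_relation t M \<mu>" and indep: "loc_lin_indep TYPE('n) t M TYPE('a)"
    and "\<mu> 0 = 0" "s \<in> {0..t}"
  shows "\<mu> s = 0"
proof (cases "s = 0")
  case False
  obtain A :: "nat \<Rightarrow> 'a^'n^'n" where A: "\<And>c :: nat \<Rightarrow> 'a.
     (\<Sum>i\<in>{1..t}. msmult (c i) (wordmat A (M i))) = 0 \<Longrightarrow> (\<forall>i\<in>{1..t}. c i = 0)"
    using indep unfolding loc_lin_indep_def by blast
  have "\<forall>s\<in>{1..t}. c s = 0"
    if "\<And>ij. (\<Sum>s\<in>{1..t}. c s * cpeval (point A) (wordmat generic (M s) $ fst ij $ snd ij) id) = 0" for c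
    using that[of "(_, _)"]
    by (intro A) (simp add: vec_eq_iff msmult_def id_hom.cpeval_wordmat_generic)
  moreover have "(\<Sum>s\<in>{1..t}. \<mu> s * wordmat generic (M s) $ fst ij $ snd ij) = 0" for ij
  proof -
    have "(\<Sum>s\<in>{0..t}. \<mu> s * wordmat generic (M s) $ fst ij $ snd ij) = 0"
      using rel by (simp add: word_relation_iff)
    thus ?thesis using \<open>\<mu> 0 = 0\<close> by (simp add: sum.atLeast_Suc_atMost)
  qed
  ultimately show ?thesis
    using False assms(4)
    by (intro mpoly_relation_trivial[where S = "{1..t}" and x = "point A" and p = \<mu>
          and W = "\<lambda>s ij. wordmat generic (M s) $ fst ij $ snd ij"]) auto
qed (use assms in auto)

lemma word_relation_proportional:
  fixes \<mu> \<nu> :: "nat \<Rightarrow> ('a::field_char_0, 'n::finite) cpoly"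
  assumes "word_relation t M \<mu>" "word_relation t M \<nu>" "loc_lin_indep TYPE('n) t M TYPE('a)" "s \<in> {0..t}"
  shows "\<nu> 0 * \<mu> s = \<mu> 0 * \<nu> s"
proof -
  have "(\<Sum>s\<in>{0..t}. (\<nu> 0 * \<mu> s - \<mu> 0 * \<nu> s) * wordmat generic (M s) $ i $ j)
    = \<nu> 0 * (\<Sum>s\<in>{0..t}. \<mu> s * wordmat generic (M s) $ i $ j)
      - \<mu> 0 * (\<Sum>s\<in>{0..t}. \<nu> s * wordmat generic (M s) $ i $ j)" for i j
    by (simp add: sum_distrib_left sum_subtractf left_diff_distrib mult.assoc)
  hence "word_relation t M (\<lambda>s. \<nu> 0 * \<mu> s - \<mu> 0 * \<nu> s)"
    using assms(1,2) by (simp add: word_relation_iff)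
  from word_relation_trivial[OF this assms(3) _ assms(4)] show ?thesis by simp
qed

text \<open>A relation with \<open>\<mu> 0 \<noteq> 0\<close> of least degree has no common factor, since the colon ideals of
  \<open>\<mu> 0\<close> are principal.\<close>
lemma word_relation_generator:
  fixes lam :: "nat \<Rightarrow> ('a::field_char_0, 'n::finite) cpoly"
  assumes lam: "word_relation t M lam" "lam 0 \<noteq> 0" and indep: "loc_lin_indep TYPE('n) t M TYPE('a)"
  obtains \<mu> :: "nat \<Rightarrow> ('a, 'n) cpoly" where "word_relation t M \<mu>" "\<mu> 0 \<noteq> 0"
    "\<And>\<nu>. word_relation t M \<nu> \<Longrightarrow> \<exists>h. \<forall>s\<in>{0..t}. \<nu> s = h * \<mu> s"
proof -
  obtain \<mu> :: "nat \<Rightarrow> ('a, 'n) cpoly" where \<mu>: "word_relation t M \<mu>" "\<mu> 0 \<noteq> 0"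
    and least: "\<And>\<nu> :: nat \<Rightarrow> ('a, 'n) cpoly. word_relation t M \<nu> \<Longrightarrow> \<nu> 0 \<noteq> 0 \<Longrightarrow> total_degree (\<mu> 0) \<le> total_degree (\<nu> 0)"
    using ex_has_least_nat[of "\<lambda>\<nu> :: nat \<Rightarrow> ('a, 'n) cpoly. word_relation t M \<nu> \<and> \<nu> 0 \<noteq> 0"
      lam "\<lambda>\<nu>. total_degree (\<nu> 0)"] lam by auto
  have "\<exists>h. \<forall>s\<in>{0..t}. \<nu> s = h * \<mu> s" if \<nu>: "word_relation t M \<nu>" for \<nu> :: "nat \<Rightarrow> ('a, 'n) cpoly"
  proof -
    have proportional: "\<nu> 0 * \<mu> s = \<mu> 0 * \<nu> s" if "s \<in> {0..t}" for s
      using word_relation_proportional[OF \<mu>(1) \<nu> indep that] .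
    obtain m where m: "\<And>h. \<mu> 0 dvd \<nu> 0 * h \<longleftrightarrow> m dvd h"
      using mpoly_colon_ideal_principal[of "\<mu> 0" "\<nu> 0"] \<mu>(2) by blast
    have "\<forall>s\<in>{0..t}. \<exists>k. \<mu> s = m * k"
      using m proportional by (metis dvdE dvd_triv_left)
    then obtain \<kappa> where \<kappa>: "\<And>s. s \<in> {0..t} \<Longrightarrow> \<mu> s = m * \<kappa> s" by metis
    have nz: "m \<noteq> 0" "\<kappa> 0 \<noteq> 0" using \<kappa>[of 0] \<mu>(2) by auto
    have "m * (\<Sum>s\<in>{0..t}. \<kappa> s * wordmat generic (M s) $ i $ j) = 0" for i j
      using \<mu>(1) \<kappa> by (simp add: word_relation_iff sum_distrib_left flip: mult.assoc)
    hence "word_relation t M \<kappa>" using nz by (simp add: word_relation_iff)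
    hence "total_degree (\<mu> 0) \<le> total_degree (\<kappa> 0)" using least nz by blast
    hence "m dvd 1"
      using \<kappa>[of 0] nz total_degree_less_mult_nonunit[of m "\<kappa> 0"] by auto
    hence "\<mu> 0 dvd \<nu> 0" using m[of 1] by simp
    then obtain h where h: "\<nu> 0 = \<mu> 0 * h" by (elim dvdE)
    have "\<nu> s = h * \<mu> s" if "s \<in> {0..t}" for s
    proof -
      have "\<mu> 0 * \<nu> s = \<mu> 0 * (h * \<mu> s)" using proportional[OF that] h by (simp add: mult_ac)
      thus ?thesis using \<mu>(2) by (simp add: mpoly_mult_left_cancel)
    qed
    thus ?thesis by blast
  qed
  thus ?thesis using that \<mu> by blast
qed

subsection \<open>Infinitesimal conjugation\<close>

lemma matrix_diff_ldistrib: "A ** (B - C) = A ** B - A ** C" for A :: "'a::ring_1^'n^'m"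
  by (simp add: vec_eq_iff matrix_matrix_mult_def right_diff_distrib sum_subtractf)

lemma matrix_diff_rdistrib: "(A - B) ** C = A ** C - B ** C" for A :: "'a::ring_1^'n^'m"
  by (simp add: vec_eq_iff matrix_matrix_mult_def left_diff_distrib sum_subtractf)

lemma map_matrix_deriv_by_mult:
  "map_matrix (deriv_by d) (A ** B) = map_matrix (deriv_by d) A ** B + A ** map_matrix (deriv_by d) B"
  by (simp add: vec_eq_iff matrix_matrix_mult_def deriv_by_sum deriv_by_mult sum.distrib)

definition ad_gen :: "'a::comm_ring_1^'n^'n \<Rightarrow> nat \<times> 'n \<times> 'n \<Rightarrow> ('a, 'n::finite) cpoly" where
  "ad_gen Y = (\<lambda>(k, i, j). (map_matrix pconst Y ** generic k - generic k ** map_matrix pconst Y) $ i $ j)"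

abbreviation ad :: "'a::comm_ring_1^'n^'n \<Rightarrow> ('a, 'n::finite) cpoly \<Rightarrow> ('a, 'n) cpoly" where
  "ad Y \<equiv> deriv_by (ad_gen Y)"

lemma ad_wordmat_generic:
  "map_matrix (ad Y) (wordmat generic w)
    = map_matrix pconst Y ** wordmat generic w - wordmat generic w ** map_matrix pconst Y"
proof (induction w)
  case Nil
  have "map_matrix (ad Y) (mat 1) = 0" by (simp add: vec_eq_iff mat_def)
  thus ?case by simp
next
  case (Cons k w)
  have "map_matrix (ad Y) (generic k) = map_matrix pconst Y ** generic k - generic k ** map_matrix pconst Y"
    by (simp add: vec_eq_iff ad_gen_def)
  thus ?case
    by (simp add: map_matrix_deriv_by_mult Cons.IH matrix_diff_ldistrib matrix_diff_rdistrib matrix_mul_assoc)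
qed

lemma word_relation_ad:
  assumes "word_relation t M \<mu>"
  shows "word_relation t M (\<lambda>s. ad Y (\<mu> s))"
  unfolding word_relation_iff
proof (intro allI)
  fix i j
  let ?w = "\<lambda>s. wordmat generic (M s)"
  have rel: "(\<Sum>s\<in>{0..t}. \<mu> s * ?w s $ i $ j) = 0" for i j using assms by (simp add: word_relation_iff)
  have ad_w: "ad Y (?w s $ i $ j)
      = (\<Sum>l\<in>UNIV. pconst (Y $ i $ l) * ?w s $ l $ j) - (\<Sum>l\<in>UNIV. ?w s $ i $ l * pconst (Y $ l $ j))" for s
    using arg_cong[OF ad_wordmat_generic[of Y "M s"], of "\<lambda>A. A $ i $ j"]
    by (simp add: matrix_matrix_mult_def)
  have "0 = ad Y (\<Sum>s\<in>{0..t}. \<mu> s * ?w s $ i $ j)" by (simp add: rel)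
  also have "\<dots> = (\<Sum>s\<in>{0..t}. ad Y (\<mu> s) * ?w s $ i $ j)
      + (\<Sum>s\<in>{0..t}. \<Sum>l\<in>UNIV. pconst (Y $ i $ l) * (\<mu> s * ?w s $ l $ j))
      - (\<Sum>s\<in>{0..t}. \<Sum>l\<in>UNIV. \<mu> s * ?w s $ i $ l * pconst (Y $ l $ j))"
    by (simp add: deriv_by_sum deriv_by_mult sum.distrib ad_w right_diff_distrib sum_subtractf
        sum_distrib_left mult_ac)
  also have "(\<Sum>s\<in>{0..t}. \<Sum>l\<in>UNIV. pconst (Y $ i $ l) * (\<mu> s * ?w s $ l $ j)) = 0"
    by (subst sum.swap) (simp flip: sum_distrib_left add: rel)
  also have "(\<Sum>s\<in>{0..t}. \<Sum>l\<in>UNIV. \<mu> s * ?w s $ i $ l * pconst (Y $ l $ j)) = 0"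
    by (subst sum.swap) (simp flip: sum_distrib_right add: rel)
  finally show "(\<Sum>s\<in>{0..t}. ad Y (\<mu> s) * ?w s $ i $ j) = 0" by simp
qed

lemma homogeneous_ad_gen: "homogeneous 1 (ad_gen Y v)"
proof (cases v)
  case (fields k i j)
  have ad_gen: "ad_gen Y v = (\<Sum>l\<in>UNIV. pconst (Y $ i $ l) * pvar (k, l, j)) - (\<Sum>l\<in>UNIV. pconst (Y $ l $ j) * pvar (k, i, l))"
    by (simp add: fields ad_gen_def matrix_matrix_mult_def mult.commute)
  show ?thesis unfolding ad_gen
    by (intro homogeneous_diff homogeneous_sum homogeneous_pconst_mult homogeneous_pvar)
qed

definition unit_mat :: "'n \<Rightarrow> 'n \<Rightarrow> 'a::comm_ring_1^'n^'n" where
  "unit_mat a b = (\<chi> i j. if i = a \<and> j = b then 1 else 0)"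

lemma ad_gen_unit_mat:
  "ad_gen (unit_mat a b) (k, i, j) = (if i = a then pvar (k, b, j) else 0) - (if j = b then pvar (k, i, a) else 0)"
proof -
  have row: "(\<Sum>l\<in>UNIV. pconst (unit_mat a b $ i $ l) * pvar (k, l, j))
      = (\<Sum>l\<in>UNIV. if l = b then (if i = a then pvar (k, b, j) else 0) else 0)"
    by (intro sum.cong) (auto simp: unit_mat_def hom_simps)
  have column: "(\<Sum>l\<in>UNIV. pvar (k, i, l) * pconst (unit_mat a b $ l $ j))
      = (\<Sum>l\<in>UNIV. if l = a then (if j = b then pvar (k, i, a) else 0) else 0)"
    by (intro sum.cong) (auto simp: unit_mat_def hom_simps)
  have "ad_gen (unit_mat a b) (k, i, j) = (\<Sum>l\<in>UNIV. pconst (unit_mat a b $ i $ l) * pvar (k, l, j))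
      - (\<Sum>l\<in>UNIV. pvar (k, i, l) * pconst (unit_mat a b $ l $ j))"
    by (simp add: ad_gen_def matrix_matrix_mult_def)
  thus ?thesis unfolding row column by simp
qed

text \<open>An eigenvector of the adjoint action has weight zero, since \<open>gl\<^sub>n\<close> is spanned by commutators
  and the identity matrix, which acts by zero.\<close>
lemma ad_eigenvector_invariant:
  fixes f :: "('a::field_char_0, 'n::finite) cpoly"
  assumes eig: "\<And>a b. ad (unit_mat a b) f = pconst (c a b) * f"
  shows "ad (unit_mat a b) f = 0"
proof -
  have comm: "ad (unit_mat a b) (ad (unit_mat a' b') f) = ad (unit_mat a' b') (ad (unit_mat a b) f)" for a b a' b'
    by (simp add: eig deriv_by_mult mult.left_commute)
  have off_diagonal: "ad (unit_mat a b) f = 0" if "a \<noteq> b" for a b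
  proof -
    have "ad (unit_mat a b) (ad_gen (unit_mat a a) v) - ad (unit_mat a a) (ad_gen (unit_mat a b) v)
         = ad_gen (unit_mat a b) v" for v :: "nat \<times> 'n \<times> 'n"
      using that by (cases v) (auto simp: ad_gen_unit_mat deriv_by_diff)
    from deriv_by_bracket[OF this, of f] show ?thesis using comm by simp
  qed
  have diagonal: "ad (unit_mat a a) f = ad (unit_mat b b) f" for a b
  proof (cases "a = b")
    case False
    have "ad (unit_mat b a) (ad_gen (unit_mat a b) v) - ad (unit_mat a b) (ad_gen (unit_mat b a) v)
         = ad_gen (unit_mat a a) v - ad_gen (unit_mat b b) v" for v :: "nat \<times> 'n \<times> 'n"
      using False by (cases v) (auto simp: ad_gen_unit_mat deriv_by_diff)
    from deriv_by_bracket[OF this, of f] show ?thesis using comm by (simp add: deriv_by_generators_diff)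
  qed auto
  have "(\<lambda>v :: nat \<times> 'n \<times> 'n. \<Sum>a\<in>UNIV. ad_gen (unit_mat a a) v :: ('a, 'n) cpoly) = (\<lambda>_. 0)"
    by (auto simp: fun_eq_iff ad_gen_unit_mat sum_subtractf)
  hence trace: "(\<Sum>a\<in>UNIV. ad (unit_mat a a) f) = 0"
    by (simp add: deriv_by_generators_0 flip: deriv_by_generators_sum)
  have "ad (unit_mat a a) f = 0" for a
  proof -
    have "(\<Sum>b\<in>UNIV. ad (unit_mat b b) f) = (\<Sum>b\<in>(UNIV :: 'n set). ad (unit_mat a a) f)"
      by (intro sum.cong refl diagonal)
    thus ?thesis using trace by simp
  qed
  thus ?thesis using off_diagonal by (cases "a = b") auto
qed

lemma invariant_word_relation_generator:
  fixes lam :: "nat \<Rightarrow> ('a::field_char_0, 'n::finite) cpoly"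
  assumes lam: "word_relation t M lam" "lam 0 \<noteq> 0" and indep: "loc_lin_indep TYPE('n) t M TYPE('a)"
  obtains \<mu> :: "nat \<Rightarrow> ('a, 'n) cpoly" and h where "word_relation t M \<mu>"
    "\<And>s. s \<in> {0..t} \<Longrightarrow> lam s = h * \<mu> s"
    "\<And>a b s. s \<in> {0..t} \<Longrightarrow> ad (unit_mat a b) (\<mu> s) = 0"
proof -
  obtain \<mu> :: "nat \<Rightarrow> ('a, 'n) cpoly" where \<mu>: "word_relation t M \<mu>" "\<mu> 0 \<noteq> 0"
    and generates: "\<And>\<nu>. word_relation t M \<nu> \<Longrightarrow> \<exists>h. \<forall>s\<in>{0..t}. \<nu> s = h * \<mu> s"
    by (rule word_relation_generator[OF lam indep]) blast
  have "\<exists>c. \<forall>s\<in>{0..t}. ad Y (\<mu> s) = pconst c * \<mu> s" for Y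
  proof -
    obtain h where h: "\<And>s. s \<in> {0..t} \<Longrightarrow> ad Y (\<mu> s) = h * \<mu> s"
      using generates[OF word_relation_ad[OF \<mu>(1)]] by blast
    have "total_degree (h * \<mu> 0) \<le> total_degree (\<mu> 0)"
      using h[of 0] total_degree_deriv_by_le[of "ad_gen Y" "\<mu> 0", OF homogeneous_ad_gen] by simp
    hence "total_degree h = 0"
      using degree_in_mult[of h "\<mu> 0" UNIV] \<mu>(2) by (cases "h = 0") (auto simp: scale_vars.zero)
    thus ?thesis using h by (auto simp: total_degree_eq_0_iff)
  qed
  then obtain c where "\<And>Y s. s \<in> {0..t} \<Longrightarrow> ad Y (\<mu> s) = pconst (c Y) * \<mu> s" by metis
  hence "ad (unit_mat a b) (\<mu> s) = 0" if "s \<in> {0..t}" for a b s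
    using that by (intro ad_eigenvector_invariant[where c = "\<lambda>a b. c (unit_mat a b)"])
  moreover obtain h where "\<forall>s\<in>{0..t}. lam s = h * \<mu> s" using generates[OF lam(1)] by blast
  ultimately show ?thesis using that[OF \<mu>(1), of h] by blast
qed

section \<open>Symmetric tensors and their restitution\<close>

abbreviation words :: "nat \<Rightarrow> 'v set \<Rightarrow> (nat \<Rightarrow> 'v) set" where
  "words r V \<equiv> PiE {..<r} (\<lambda>_. V)"

abbreviation perms :: "nat \<Rightarrow> (nat \<Rightarrow> nat) set" where
  "perms r \<equiv> {\<sigma>. \<sigma> permutes {..<r}}"

lemma finite_words [simp]: "finite V \<Longrightarrow> finite (words r V)"
  by (intro finite_PiE) auto

lemma finite_perms [simp]: "finite (perms r)"
  by (rule finite_permutations) auto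

lemma words_comp_perm:
  assumes "v \<in> words r V" "\<sigma> permutes {..<r}"
  shows "v \<circ> \<sigma> \<in> words r V"
proof (rule PiE_I)
  fix p assume "p \<in> {..<r}"
  hence "\<sigma> p \<in> {..<r}" using assms(2) by (metis permutes_in_image)
  thus "(v \<circ> \<sigma>) p \<in> V" using assms(1) by auto
next
  fix p assume "p \<notin> {..<r}"
  thus "(v \<circ> \<sigma>) p = undefined" using assms by (auto simp: permutes_def)
qed

lemma words_upd: "v \<in> words r V \<Longrightarrow> p < r \<Longrightarrow> x \<in> V \<Longrightarrow> v(p := x) \<in> words r V"
  by (auto simp: PiE_def extensional_def)

lemma sum_words_upd:
  fixes F :: "(nat \<Rightarrow> 'v) \<Rightarrow> (nat \<Rightarrow> 'v) \<Rightarrow> 'b::comm_monoid_add"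
  assumes "p < r"
  shows "(\<Sum>v\<in>words r V. \<Sum>x\<in>V. F v (v(p := x))) = (\<Sum>v\<in>words r V. \<Sum>x\<in>V. F (v(p := x)) v)"
proof -
  define swap where "swap = (\<lambda>y :: (nat \<Rightarrow> 'v) \<times> 'v. ((fst y)(p := snd y), fst y p))"
  have "swap y \<in> words r V \<times> V" if "y \<in> words r V \<times> V" for y
    using that assms words_upd[of "fst y" r V p "snd y"] PiE_mem[of "fst y" "{..<r}" "\<lambda>_. V" p]
    by (simp add: swap_def mem_Times_iff)
  hence "(\<Sum>y\<in>words r V \<times> V. F (fst y) ((fst y)(p := snd y))) = (\<Sum>y\<in>words r V \<times> V. F ((fst y)(p := snd y)) (fst y))"
    by (intro sum.reindex_bij_witness[of _ swap swap]) (auto simp: swap_def)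
  thus ?thesis by (simp add: sum.cartesian_product case_prod_unfold)
qed

lemma sum_perms_average:
  fixes g :: "'a::field_char_0 \<Rightarrow> 'x \<Rightarrow> 'b::comm_monoid_add"
  assumes g: "\<And>x. g 0 x = 0" "\<And>a b x. g (a + b) x = g a x + g b x"
    and act: "\<And>\<rho>. \<rho> \<in> perms r \<Longrightarrow> bij_betw (act \<rho>) X X"
    and inv: "\<And>\<rho> a x. \<rho> \<in> perms r \<Longrightarrow> x \<in> X \<Longrightarrow> g a (act \<rho> x) = g a x"
  shows "(\<Sum>x\<in>X. g ((\<Sum>\<rho>\<in>perms r. c (act \<rho> x)) / fact r) x) = (\<Sum>x\<in>X. g (c x) x)"
proof -
  have g_sum: "g (\<Sum>\<rho>\<in>R. f \<rho>) x = (\<Sum>\<rho>\<in>R. g (f \<rho>) x)" for R :: "(nat \<Rightarrow> nat) set" and f x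
    by (induction R rule: infinite_finite_induct) (auto simp: g)
  have "(\<Sum>x\<in>X. g ((\<Sum>\<rho>\<in>perms r. c (act \<rho> x)) / fact r) x)
    = (\<Sum>\<rho>\<in>perms r. \<Sum>x\<in>X. g (c (act \<rho> x) / fact r) x)"
    unfolding sum_divide_distrib g_sum by (rule sum.swap)
  also have "\<dots> = (\<Sum>\<rho>\<in>perms r. \<Sum>x\<in>X. g (c (act \<rho> x) / fact r) (act \<rho> x))"
    by (simp add: inv)
  also have "\<dots> = (\<Sum>\<rho>\<in>perms r. \<Sum>x\<in>X. g (c x / fact r) x)"
    by (intro sum.cong refl sum.reindex_bij_betw[OF act, of _ "\<lambda>x. g (c x / fact r) x"])
  also have "\<dots> = (\<Sum>x\<in>X. g (\<Sum>\<rho>\<in>perms r. c x / fact r) x)"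
    unfolding g_sum by (rule sum.swap)
  finally show ?thesis by (simp add: card_permutations[OF card_lessThan finite_lessThan])
qed

definition mon :: "nat \<Rightarrow> (nat \<Rightarrow> 'v) \<Rightarrow> ('v, 'a::comm_ring_1) mpoly" where
  "mon r v = (\<Prod>p<r. pvar (v p))"

lemma mon_eq_single: "mon r v = Poly_Mapping.single (\<Sum>p<r. Poly_Mapping.single (v p) 1) 1"
  by (induction r) (auto simp: mon_def pvar_def mult_single)

lemma mon_comp_perm: "\<rho> permutes {..<r} \<Longrightarrow> mon r (v \<circ> \<rho>) = (mon r v :: ('v, 'a::comm_ring_1) mpoly)"
  using prod.permute[of \<rho> "{..<r}" "\<lambda>p. pvar (v p) :: ('v, 'a) mpoly"] by (simp add: mon_def o_def)

lemma homogeneous_mon: "homogeneous r (mon r v)"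
proof -
  have "(\<Prod>p<r. [:0, pvar (v p):]) = monom (mon r v) r"
    by (induction r) (auto simp: mon_def monom_Suc mult.commute smult_monom monom_0)
  thus ?thesis by (simp add: homogeneous_def mon_def hom_simps)
qed

lemma lookup_sum_single_word:
  fixes r :: nat
  shows "Poly_Mapping.lookup (\<Sum>p<r. Poly_Mapping.single (v p) (1::nat)) x = count (image_mset v (mset_set {..<r})) x"
  by (induction r) (auto simp: lookup_add lookup_single when_def lessThan_Suc)

lemma sum_single_word_eq_imp_perm:
  assumes "(\<Sum>p<r. Poly_Mapping.single (v p) (1::nat)) = (\<Sum>p<r. Poly_Mapping.single (w p) 1)"
    and "v \<in> words r V" "w \<in> words r V"
  obtains \<rho> where "\<rho> permutes {..<r}" "v = w \<circ> \<rho>"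
proof -
  have eq: "image_mset v (mset_set {..<r}) = image_mset w (mset_set {..<r})"
    using assms(1) by (intro multiset_eqI) (metis lookup_sum_single_word)
  obtain \<rho> where \<rho>: "\<rho> permutes {..<r}" "\<forall>p\<in>{..<r}. v p = w (\<rho> p)"
    by (rule image_mset_eq_implies_permutes[OF finite_lessThan eq]) blast
  have "v = w \<circ> \<rho>"
    by (rule PiE_ext[OF assms(2) words_comp_perm[OF assms(3) \<rho>(1)]]) (use \<rho>(2) in auto)
  thus ?thesis using that \<rho>(1) by blast
qed

lemma ex_word_of_monomial:
  fixes m :: "'v \<Rightarrow>\<^sub>0 nat"
  assumes "Poly_Mapping.keys m \<subseteq> V"
  obtains r v where "v \<in> words r V" "Poly_Mapping.single m (1::'a::comm_ring_1) = mon r v"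
proof -
  define M where "M = (\<Sum>x\<in>Poly_Mapping.keys m. replicate_mset (Poly_Mapping.lookup m x) x)"
  have count: "count M x = Poly_Mapping.lookup m x" for x
    by (cases "x \<in> Poly_Mapping.keys m") (auto simp: M_def count_sum in_keys_iff)
  obtain xs where xs: "mset xs = M" by (metis ex_mset)
  define v where "v = restrict ((!) xs) {..<length xs}"
  have "set xs \<subseteq> V"
  proof
    fix x assume "x \<in> set xs"
    hence "x \<in># M" by (simp flip: xs)
    hence "Poly_Mapping.lookup m x \<noteq> 0" by (simp flip: count)
    thus "x \<in> V" using assms by (auto simp: in_keys_iff)
  qed
  hence "v \<in> words (length xs) V" by (auto simp: v_def)
  moreover have "image_mset v (mset_set {..<length xs}) = mset xs"
  proof -
    have "image_mset v (mset_set {..<length xs}) = image_mset ((!) xs) (mset_set {..<length xs})"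
      by (intro image_mset_cong) (auto simp: v_def)
    also have "\<dots> = mset (map ((!) xs) [0..<length xs])"
      by (simp add: lessThan_atLeast0)
    finally show ?thesis by (simp only: map_nth)
  qed
  hence "(\<Sum>p<length xs. Poly_Mapping.single (v p) 1) = m"
    by (intro poly_mapping_eqI) (simp only: lookup_sum_single_word xs count)
  ultimately show ?thesis using that by (metis mon_eq_single)
qed

text \<open>Following the classical terminology, the restitution of a tensor, that is, of a noncommutative
  form of degree \<open>r\<close> with coefficients \<open>b\<close>, is the corresponding commutative form.\<close>
definition restitution :: "'v set \<Rightarrow> nat \<Rightarrow> ((nat \<Rightarrow> 'v) \<Rightarrow> 'a::comm_ring_1) \<Rightarrow> ('v, 'a) mpoly" where
  "restitution V r b = (\<Sum>v\<in>words r V. pconst (b v) * mon r v)"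

definition symmetric_tensor :: "nat \<Rightarrow> ((nat \<Rightarrow> 'v) \<Rightarrow> 'a) \<Rightarrow> bool" where
  "symmetric_tensor r b \<longleftrightarrow> (\<forall>\<rho> v. \<rho> permutes {..<r} \<longrightarrow> b (v \<circ> \<rho>) = b v)"

definition symmetrise :: "nat \<Rightarrow> ((nat \<Rightarrow> 'v) \<Rightarrow> 'a) \<Rightarrow> (nat \<Rightarrow> 'v) \<Rightarrow> 'a::field_char_0" where
  "symmetrise r b v = (\<Sum>\<rho>\<in>perms r. b (v \<circ> \<rho>)) / fact r"

lemma homogeneous_restitution: "homogeneous r (restitution V r b)"
  unfolding restitution_def by (intro homogeneous_sum homogeneous_pconst_mult homogeneous_mon)

lemma symmetric_symmetrise: "symmetric_tensor r (symmetrise r b)"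
  unfolding symmetric_tensor_def symmetrise_def
proof (intro allI impI arg_cong2[where f = "(/)"] refl)
  fix \<rho> v assume "\<rho> permutes {..<r}"
  thus "(\<Sum>\<tau>\<in>perms r. b (v \<circ> \<rho> \<circ> \<tau>)) = (\<Sum>\<tau>\<in>perms r. b (v \<circ> \<tau>))"
    using setum_permutations_compose_left[of \<rho> "{..<r}" "\<lambda>\<tau>. b (v \<circ> \<tau>)"] by (simp add: comp_assoc)
qed

lemma bij_betw_words_comp_perm:
  assumes "\<rho> permutes {..<r}"
  shows "bij_betw (\<lambda>v. v \<circ> \<rho>) (words r V) (words r V)"
proof (rule bij_betw_byWitness[where f' = "\<lambda>v. v \<circ> inv \<rho>"])
  show "(\<lambda>v. v \<circ> \<rho>) ` words r V \<subseteq> words r V"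
    using words_comp_perm[OF _ assms] by blast
  show "(\<lambda>v. v \<circ> inv \<rho>) ` words r V \<subseteq> words r V"
    using words_comp_perm[OF _ permutes_inv[OF assms]] by blast
qed (use permutes_inv_o[OF assms] in \<open>simp_all add: comp_assoc\<close>)

lemma sum_symmetrise_mult:
  fixes g :: "(nat \<Rightarrow> 'v) \<Rightarrow> 'b::comm_ring_1" and h :: "'a::field_char_0 \<Rightarrow> 'b"
  assumes "comm_ring_hom h" and sym: "symmetric_tensor r g"
  shows "(\<Sum>v\<in>words r V. h (symmetrise r b v) * g v) = (\<Sum>v\<in>words r V. h (b v) * g v)"
proof -
  interpret comm_ring_hom h by fact
  show ?thesis
    unfolding symmetrise_def
    by (rule sum_perms_average[where act = "\<lambda>\<rho> v. v \<circ> \<rho>" and g = "\<lambda>a v. h a * g v"])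
      (use sym in \<open>simp_all add: zero add distrib_right bij_betw_words_comp_perm symmetric_tensor_def\<close>)
qed

lemma restitution_symmetrise:
  "restitution V r (symmetrise r b) = restitution V r (b :: _ \<Rightarrow> 'a::field_char_0)"
  unfolding restitution_def
  by (rule sum_symmetrise_mult[OF pconst.comm_ring_hom_axioms]) (simp add: symmetric_tensor_def mon_comp_perm)

lemma restitution_symmetric_eq_0:
  fixes b :: "(nat \<Rightarrow> 'v) \<Rightarrow> 'a::field_char_0"
  assumes "restitution V r b = 0" and sym: "symmetric_tensor r b" and V: "finite V" and v: "v \<in> words r V"
  shows "b v = 0"
proof -
  let ?m = "\<lambda>v. \<Sum>p<r. Poly_Mapping.single (v p) (1::nat)"
  let ?C = "{w\<in>words r V. ?m w = ?m v}"
  have "0 = Poly_Mapping.lookup (restitution V r b) (?m v)" using assms(1) by simp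
  also have "\<dots> = (\<Sum>w\<in>words r V. if ?m w = ?m v then b w else 0)"
    by (simp add: restitution_def lookup_sum mon_eq_single pconst_def mult_single lookup_single when_def)
  also have "\<dots> = (\<Sum>w\<in>?C. b w)"
    using V by (intro sum.mono_neutral_cong_right) (auto)
  also have "\<dots> = (\<Sum>w\<in>?C. b v)"
  proof (rule sum.cong[OF refl])
    fix w assume "w \<in> ?C"
    then obtain \<rho> where "\<rho> permutes {..<r}" "w = v \<circ> \<rho>"
      using sum_single_word_eq_imp_perm[of w r v V] v by blast
    thus "b w = b v" using sym by (simp add: symmetric_tensor_def)
  qed
  finally have "of_nat (card ?C) * b v = 0" by simp
  moreover have "card ?C \<noteq> 0"
  proof -
    have "finite ?C" by (rule finite_subset[OF _ finite_words[OF V]]) blast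
    from card_0_eq[OF this] show ?thesis using v by blast
  qed
  ultimately show ?thesis by simp
qed

lemma restitution_eq_0_imp_orthogonal:
  fixes b c :: "(nat \<Rightarrow> 'v) \<Rightarrow> 'a::field_char_0"
  assumes "restitution V r b = 0" "symmetric_tensor r c" "finite V"
  shows "(\<Sum>v\<in>words r V. b v * c v) = 0"
proof -
  have "symmetrise r b v = 0" if "v \<in> words r V" for v
    using restitution_symmetric_eq_0[of V r "symmetrise r b" v] assms that
    by (simp add: restitution_symmetrise symmetric_symmetrise)
  thus ?thesis using sum_symmetrise_mult[OF id_hom.comm_ring_hom_axioms assms(2), of b V] by simp
qed

lemma restitution_sum: "restitution V r (\<lambda>v. \<Sum>x\<in>X. b x v) = (\<Sum>x\<in>X. restitution V r (b x))"
  unfolding restitution_def pconst.sum sum_distrib_right by (rule sum.swap)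

lemma restitution_delta:
  assumes "finite V" "w \<in> words r V"
  shows "restitution V r (\<lambda>v. if v = w then c else 0) = pconst c * mon r w"
proof -
  have "restitution V r (\<lambda>v. if v = w then c else 0) = (\<Sum>v\<in>words r V. if v = w then pconst c * mon r w else 0)"
    unfolding restitution_def by (intro sum.cong refl) (simp add: hom_simps)
  thus ?thesis by (simp only: sum.delta[OF finite_words[OF assms(1)]] assms(2) if_True)
qed

lemma ex_symmetric_restitution:
  fixes f :: "('v, 'a::field_char_0) mpoly"
  assumes V: "finite V" "f \<in> vars_in V" and hom: "homogeneous r f"
  obtains b where "symmetric_tensor r b" "f = restitution V r b"
proof -
  have "\<forall>m\<in>Poly_Mapping.keys f. \<exists>n v. v \<in> words n V \<and> (Poly_Mapping.single m 1 :: ('v, 'a) mpoly) = mon n v"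
  proof
    fix m assume "m \<in> Poly_Mapping.keys f"
    hence "Poly_Mapping.keys m \<subseteq> V" using V(2) by (auto simp: vars_in_def)
    from ex_word_of_monomial[OF this]
    show "\<exists>n v. v \<in> words n V \<and> (Poly_Mapping.single m 1 :: ('v, 'a) mpoly) = mon n v" by metis
  qed
  then obtain n w where w: "\<And>m. m \<in> Poly_Mapping.keys f \<Longrightarrow> w m \<in> words (n m) V"
    and mon_w: "\<And>m. m \<in> Poly_Mapping.keys f \<Longrightarrow> (Poly_Mapping.single m 1 :: ('v, 'a) mpoly) = mon (n m) (w m)"
    by metis
  let ?c = "Poly_Mapping.lookup f" and ?R = "{m \<in> Poly_Mapping.keys f. n m = r}"
  define b where "b = (\<lambda>v. \<Sum>m\<in>?R. if v = w m then ?c m else 0)"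
  have f: "f = (\<Sum>m\<in>Poly_Mapping.keys f. pconst (?c m) * mon (n m) (w m))"
    using mpoly_eq_sum_mval[of f] by (simp add: mval_pvar mon_w)
  have "f = homogeneous_component r f" using hom by (simp add: homogeneous_component_homogeneous)
  also have "\<dots> = (\<Sum>m\<in>Poly_Mapping.keys f. if n m = r then pconst (?c m) * mon r (w m) else 0)"
    by (subst (1) f) (auto simp: homogeneous_component_sum homogeneous_component_homogeneous[OF
          homogeneous_pconst_mult[OF homogeneous_mon]] intro!: sum.cong)
  also have "\<dots> = (\<Sum>m\<in>?R. pconst (?c m) * mon r (w m))"
    by (intro sum.mono_neutral_cong_right) auto
  also have "\<dots> = restitution V r b"
    unfolding b_def restitution_sum using w by (intro sum.cong refl restitution_delta[OF V(1), symmetric]) auto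
  finally have "f = restitution V r (symmetrise r b)" by (simp add: restitution_symmetrise)
  thus ?thesis using that symmetric_symmetrise by blast
qed

lemma deriv_by_mon:
  assumes d: "\<And>v. v \<in> V \<Longrightarrow> d v = (\<Sum>x\<in>V. pconst (D v x) * pvar x)" and v: "v \<in> words r V"
  shows "deriv_by d (mon r v) = (\<Sum>p<r. \<Sum>x\<in>V. pconst (D (v p) x) * mon r (v(p := x)))"
proof -
  have mon_upd: "mon r (v(p := x)) = pvar x * (\<Prod>q\<in>{..<r} - {p}. pvar (v q))" if "p < r" for p x
    unfolding mon_def using that by (subst prod.remove[of _ p]) (auto intro!: arg_cong2[where f = "(*)"] prod.cong)
  have "deriv_by d (mon r v) = (\<Sum>p<r. d (v p) * (\<Prod>q\<in>{..<r} - {p}. pvar (v q)))"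
    unfolding mon_def by (subst deriv_by_prod) auto
  also have "\<dots> = (\<Sum>p<r. \<Sum>x\<in>V. pconst (D (v p) x) * mon r (v(p := x)))"
  proof (rule sum.cong[OF refl])
    fix p assume "p \<in> {..<r}"
    moreover from this have "v p \<in> V" using v by auto
    ultimately show "d (v p) * (\<Prod>q\<in>{..<r} - {p}. pvar (v q))
      = (\<Sum>x\<in>V. pconst (D (v p) x) * mon r (v(p := x)))"
      by (simp add: d mon_upd sum_distrib_right mult.assoc)
  qed
  finally show ?thesis .
qed

lemma deriv_by_restitution:
  assumes "\<And>v. v \<in> V \<Longrightarrow> d v = (\<Sum>x\<in>V. pconst (D v x) * pvar x)"
  shows "deriv_by d (restitution V r b) = restitution V r (\<lambda>v. \<Sum>p<r. \<Sum>x\<in>V. D x (v p) * b (v(p := x)))"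
proof -
  have "deriv_by d (restitution V r b)
    = (\<Sum>p<r. \<Sum>v\<in>words r V. \<Sum>x\<in>V. pconst (b v) * (pconst (D (v p) ((v(p := x)) p)) * mon r (v(p := x))))"
    by (simp add: restitution_def deriv_by_sum deriv_by_mult deriv_by_mon[OF assms] sum_distrib_left)
      (rule sum.swap)
  also have "\<dots> = (\<Sum>p<r. \<Sum>v\<in>words r V. \<Sum>x\<in>V.
      pconst (b (v(p := x))) * (pconst (D ((v(p := x)) p) (v p)) * mon r v))"
    by (intro sum.cong refl sum_words_upd) simp
  also have "\<dots> = restitution V r (\<lambda>v. \<Sum>p<r. \<Sum>x\<in>V. D x (v p) * b (v(p := x)))"
    unfolding restitution_def pconst.sum pconst.mult sum_distrib_right by (subst sum.swap) (simp add: mult_ac)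
  finally show ?thesis .
qed

lemma symmetric_tensor_deriv:
  assumes "symmetric_tensor r b"
  shows "symmetric_tensor r (\<lambda>v. \<Sum>p<r. \<Sum>x\<in>V. D x (v p) * b (v(p := x)))"
  unfolding symmetric_tensor_def
proof (intro allI impI)
  fix \<rho> and v :: "nat \<Rightarrow> 'a" assume \<rho>: "\<rho> permutes {..<r}"
  have "(v \<circ> \<rho>)(p := x) = v(\<rho> p := x) \<circ> \<rho>" for p x
    using permutes_inj[OF \<rho>] by (auto simp: fun_eq_iff inj_eq)
  hence "b ((v \<circ> \<rho>)(p := x)) = b (v(\<rho> p := x))" for p x
    using assms \<rho> by (simp add: symmetric_tensor_def)
  thus "(\<Sum>p<r. \<Sum>x\<in>V. D x ((v \<circ> \<rho>) p) * b ((v \<circ> \<rho>)(p := x))) = (\<Sum>p<r. \<Sum>x\<in>V. D x (v p) * b (v(p := x)))"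
    using sum.permute[OF \<rho>, of "\<lambda>p. \<Sum>x\<in>V. D x (v p) * b (v(p := x))"] by (simp add: o_def)
qed

section \<open>The double centraliser of a permutation group\<close>

lemma sum_apply: "(\<Sum>x\<in>X. F x) y = (\<Sum>x\<in>X. F x y :: 'a::comm_monoid_add)"
  by (induction X rule: infinite_finite_induct) auto

lemma fun_eq_sum_delta:
  fixes h :: "'x \<Rightarrow> 'a::comm_semiring_1"
  assumes "finite X" "\<And>y. y \<notin> X \<Longrightarrow> h y = 0"
  shows "h = (\<Sum>x\<in>X. (\<lambda>y. h x * (if y = x then 1 else 0)))"
proof
  fix y
  have "(\<Sum>x\<in>X. (\<lambda>y. h x * (if y = x then 1 else 0))) y = (\<Sum>x\<in>X. if x = y then h y else 0)"
    unfolding sum_apply by (intro sum.cong) auto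
  thus "h y = (\<Sum>x\<in>X. (\<lambda>y. h x * (if y = x then 1 else 0))) y" using assms by simp
qed

lemma ex_generalised_inverse:
  fixes v :: "'k \<Rightarrow> 'x \<Rightarrow> 'a::field"
  assumes "finite K" "finite X"
  shows "\<exists>d. \<forall>k'\<in>K. \<forall>y\<in>X. v k' y = (\<Sum>k\<in>K. (\<Sum>x\<in>X. d k x * v k' x) * v k y)"
proof -
  let ?s1 = "\<lambda>(c::'a) (f::'k \<Rightarrow> 'a) k. c * f k" and ?s2 = "\<lambda>(c::'a) (f::'x \<Rightarrow> 'a) x. c * f x"
  interpret vector_space_pair ?s1 ?s2
    by unfold_locales (auto simp: fun_eq_iff algebra_simps)
  define L where "L = (\<lambda>f y. if y \<in> X then \<Sum>k\<in>K. f k * v k y else 0)"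
  have L: "L f y = (\<Sum>k\<in>K. f k * v k y)" if "y \<in> X" for f y using that by (simp add: L_def)
  have L_outside: "L f y = 0" if "y \<notin> X" for f y using that by (simp add: L_def)
  have "Vector_Spaces.linear ?s1 ?s2 L"
    by unfold_locales (auto simp: L_def fun_eq_iff distrib_right sum.distrib sum_distrib_left mult.assoc)
  from linear_exists_right_inverse_on[OF this vs1.subspace_UNIV]
  obtain g where g: "Vector_Spaces.linear ?s2 ?s1 g" and Lg: "\<And>f. L (g (L f)) = L f" by auto
  interpret g: Vector_Spaces.linear ?s2 ?s1 g by (rule g)
  define d where "d = (\<lambda>k x. g (\<lambda>y. if y = x then 1 else 0) k)"
  have g_eq: "g h k = (\<Sum>x\<in>X. h x * d k x)" if "\<And>y. y \<notin> X \<Longrightarrow> h y = 0" for h k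
  proof -
    have "g h = g (\<Sum>x\<in>X. ?s2 (h x) (\<lambda>y. if y = x then 1 else 0))"
      using fun_eq_sum_delta[OF assms(2), of h] that by (intro arg_cong[where f = g]) simp
    also have "\<dots> = (\<Sum>x\<in>X. ?s1 (h x) (g (\<lambda>y. if y = x then 1 else 0)))"
      by (simp only: g.sum g.scale)
    finally have "g h = (\<Sum>x\<in>X. ?s1 (h x) (g (\<lambda>y. if y = x then 1 else 0)))" .
    thus ?thesis by (simp add: d_def sum_apply)
  qed
  have "v k' y = (\<Sum>k\<in>K. (\<Sum>x\<in>X. d k x * v k' x) * v k y)" if "k' \<in> K" "y \<in> X" for k' y
  proof -
    define e :: "'k \<Rightarrow> 'a" where "e = (\<lambda>k. if k = k' then 1 else 0)"
    have Le: "L e x = v k' x" if "x \<in> X" for x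
      using that \<open>k' \<in> K\<close> assms(1) by (simp add: L e_def if_distrib[of "\<lambda>c. c * _"] cong: if_cong)
    have "v k' y = L (g (L e)) y" using Le that by (simp only: Lg)
    also have "\<dots> = (\<Sum>k\<in>K. g (L e) k * v k y)" by (rule L[OF \<open>y \<in> X\<close>])
    also have "\<dots> = (\<Sum>k\<in>K. (\<Sum>x\<in>X. L e x * d k x) * v k y)"
      by (subst g_eq) (simp_all add: L_outside)
    also have "\<dots> = (\<Sum>k\<in>K. (\<Sum>x\<in>X. d k x * v k' x) * v k y)"
      by (simp add: Le mult.commute)
    finally show ?thesis .
  qed
  thus ?thesis by blast
qed

definition perm_entry :: "('i \<Rightarrow> 'i) \<Rightarrow> 'i \<times> 'i \<Rightarrow> 'a::comm_ring_1" where
  "perm_entry g = (\<lambda>(i, j). if j = g i then 1 else 0)"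

locale finite_permutation_group =
  fixes G :: "('i \<Rightarrow> 'i) set" and I :: "'i set"
  assumes finite_group: "finite G" and finite_points: "finite I"
    and id_mem: "id \<in> G"
    and comp_mem: "g \<in> G \<Longrightarrow> h \<in> G \<Longrightarrow> g \<circ> h \<in> G"
    and inv_mem: "g \<in> G \<Longrightarrow> inv g \<in> G"
    and bij: "g \<in> G \<Longrightarrow> bij g"
    and maps: "g \<in> G \<Longrightarrow> i \<in> I \<Longrightarrow> g i \<in> I"
begin

lemma inv_cancel [simp]: "g \<in> G \<Longrightarrow> inv g (g i) = i" "g \<in> G \<Longrightarrow> g (inv g i) = i"
  using bij by (simp_all add: bij_is_inj bij_is_surj surj_f_inv_f)

lemma sum_group_comp_right: "h \<in> G \<Longrightarrow> (\<Sum>g\<in>G. F (g \<circ> h)) = (\<Sum>g\<in>G. F g)"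
  by (rule sum.reindex_bij_witness[of _ "\<lambda>g. g \<circ> inv h" "\<lambda>g. g \<circ> h"])
    (auto simp: comp_mem inv_mem fun_eq_iff)

lemma sum_points: "g \<in> G \<Longrightarrow> (\<Sum>i\<in>I. F (g i) i) = (\<Sum>i\<in>I. F i (inv g i))"
  by (rule sum.reindex_bij_witness[of _ "inv g" g]) (auto simp: maps inv_mem)

text \<open>If \<open>d\<close> is a generalised inverse of the permutation matrices of \<open>G\<close>, these are the entries of a
  projection onto their span, averaged so as to commute with left multiplication by \<open>G\<close>.\<close>
definition averaged_projection :: "(('i \<Rightarrow> 'i) \<Rightarrow> 'i \<times> 'i \<Rightarrow> 'a) \<Rightarrow> 'i \<Rightarrow> 'i \<Rightarrow> 'i \<Rightarrow> 'i \<Rightarrow> 'a::comm_ring_1" where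
  "averaged_projection d j l i k = (\<Sum>h\<in>G. \<Sum>g\<in>G. d g (h k, l) * perm_entry g (h i, j))"

lemma averaged_projection_invariant:
  "g \<in> G \<Longrightarrow> averaged_projection d j l (g i) (g k) = averaged_projection d j l i k"
  using sum_group_comp_right[of g "\<lambda>h. \<Sum>g\<in>G. d g (h k, l) * perm_entry g (h i, j)"]
  by (simp add: averaged_projection_def)

lemma sum_averaged_projection_diagonal:
  assumes d: "\<And>h y. h \<in> G \<Longrightarrow> y \<in> I \<times> I \<Longrightarrow>
      perm_entry h y = (\<Sum>g\<in>G. (\<Sum>x\<in>I \<times> I. d g x * perm_entry h x) * perm_entry g y)"
    and ij: "i \<in> I" "j \<in> I"
  shows "(\<Sum>l\<in>I. averaged_projection d j l i l) = (if i = j then of_nat (card G) else 0)"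
proof -
  have "(\<Sum>l\<in>I. averaged_projection d j l i l) = (\<Sum>h\<in>G. \<Sum>g\<in>G. (\<Sum>l\<in>I. d g (h l, l)) * perm_entry g (h i, j))"
    unfolding averaged_projection_def sum_distrib_right by (subst sum.swap, intro sum.cong refl, rule sum.swap)
  also have "\<dots> = (\<Sum>h\<in>G. if i = j then 1 else 0)"
  proof (rule sum.cong[OF refl])
    fix h assume h: "h \<in> G"
    have "(\<Sum>x\<in>I \<times> I. d g x * perm_entry (inv h) x) = (\<Sum>l\<in>I. d g (h l, l))" for g
    proof -
      have "(\<Sum>x\<in>I \<times> I. d g x * perm_entry (inv h) x) = (\<Sum>l\<in>I. \<Sum>k\<in>I. if k = inv h l then d g (l, k) else 0)"
        by (auto simp: sum.cartesian_product perm_entry_def intro!: sum.cong)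
      also have "\<dots> = (\<Sum>l\<in>I. d g (l, inv h l))"
        using h finite_points by (intro sum.cong refl) (simp add: maps inv_mem)
      finally show ?thesis using sum_points[OF h, of "\<lambda>i j. d g (i, j)"] by simp
    qed
    hence "(\<Sum>g\<in>G. (\<Sum>l\<in>I. d g (h l, l)) * perm_entry g (h i, j)) = perm_entry (inv h) (h i, j)"
      using d[OF inv_mem[OF h], of "(h i, j)"] ij h by (simp add: maps)
    thus "(\<Sum>g\<in>G. (\<Sum>l\<in>I. d g (h l, l)) * perm_entry g (h i, j)) = (if i = j then 1 else 0)"
      using h by (auto simp: perm_entry_def)
  qed
  finally show ?thesis by simp
qed

lemma sum_averaged_projection_mult:
  "\<exists>c. \<forall>i j. (\<Sum>l\<in>I. \<Sum>k\<in>I. averaged_projection d j l i k * x k l) = (\<Sum>g\<in>G. c g * perm_entry g (i, j))"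
proof -
  define e where "e = (\<lambda>h g. \<Sum>l\<in>I. \<Sum>k\<in>I. d g (h k, l) * x k l)"
  have "(\<Sum>l\<in>I. \<Sum>k\<in>I. averaged_projection d j l i k * x k l)
      = (\<Sum>g\<in>G. (\<Sum>h\<in>G. e h (g \<circ> inv h)) * perm_entry g (i, j))" for i j
  proof -
    have "(\<Sum>l\<in>I. \<Sum>k\<in>I. averaged_projection d j l i k * x k l)
      = (\<Sum>l\<in>I. \<Sum>k\<in>I. \<Sum>h\<in>G. \<Sum>g\<in>G. d g (h k, l) * x k l * perm_entry g (h i, j))"
      unfolding averaged_projection_def sum_distrib_right by (intro sum.cong refl) (simp only: mult_ac)
    also have "\<dots> = (\<Sum>h\<in>G. \<Sum>g\<in>G. \<Sum>l\<in>I. \<Sum>k\<in>I. d g (h k, l) * x k l * perm_entry g (h i, j))"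
      by (simp only: sum.swap[where A = I and B = G])
    also have "\<dots> = (\<Sum>h\<in>G. \<Sum>g\<in>G. e h g * perm_entry (g \<circ> h) (i, j))"
      by (simp add: e_def sum_distrib_right perm_entry_def)
    also have "\<dots> = (\<Sum>h\<in>G. \<Sum>g\<in>G. e h (g \<circ> inv h) * perm_entry g (i, j))"
    proof (rule sum.cong[OF refl])
      fix h assume h: "h \<in> G"
      have "e h g = e h (g \<circ> h \<circ> inv h)" for g
        using h by (intro arg_cong[where f = "e h"]) (auto simp: fun_eq_iff)
      thus "(\<Sum>g\<in>G. e h g * perm_entry (g \<circ> h) (i, j)) = (\<Sum>g\<in>G. e h (g \<circ> inv h) * perm_entry g (i, j))"
        using sum_group_comp_right[OF h, of "\<lambda>g. e h (g \<circ> inv h) * perm_entry g (i, j)"] by simp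
    qed
    also have "\<dots> = (\<Sum>g\<in>G. \<Sum>h\<in>G. e h (g \<circ> inv h) * perm_entry g (i, j))" by (rule sum.swap)
    finally show ?thesis by (simp only: sum_distrib_right)
  qed
  thus ?thesis by (intro exI[of _ "\<lambda>g. \<Sum>h\<in>G. e h (g \<circ> inv h)"]) simp
qed

theorem double_centraliser:
  fixes a :: "'i \<Rightarrow> 'i \<Rightarrow> 'a::field_char_0"
  assumes comm: "\<And>b i j. (\<And>g i j. g \<in> G \<Longrightarrow> b (g i) (g j) = b i j) \<Longrightarrow> i \<in> I \<Longrightarrow> j \<in> I \<Longrightarrow>
      (\<Sum>k\<in>I. a i k * b k j) = (\<Sum>k\<in>I. b i k * a k j)"
  shows "\<exists>c. \<forall>i\<in>I. \<forall>j\<in>I. a i j = (\<Sum>g\<in>G. c g * perm_entry g (i, j))"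
proof -
  obtain d :: "('i \<Rightarrow> 'i) \<Rightarrow> 'i \<times> 'i \<Rightarrow> 'a" where d: "\<forall>h\<in>G. \<forall>y\<in>I \<times> I.
      perm_entry h y = (\<Sum>g\<in>G. (\<Sum>x\<in>I \<times> I. d g x * perm_entry h x) * perm_entry g y)"
    using ex_generalised_inverse[OF finite_group finite_cartesian_product[OF finite_points finite_points]] ..
  note diagonal = sum_averaged_projection_diagonal[OF d[rule_format]]
  define b where "b = averaged_projection d"
  obtain c where c: "\<And>i j. (\<Sum>l\<in>I. \<Sum>k\<in>I. b j l i k * a k l) = (\<Sum>g\<in>G. c g * perm_entry g (i, j))"
    using sum_averaged_projection_mult[of d a] unfolding b_def by blast
  have nz: "of_nat (card G) \<noteq> (0::'a)" using finite_group id_mem by auto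
  have "a i j = (\<Sum>g\<in>G. c g / of_nat (card G) * perm_entry g (i, j))" if ij: "i \<in> I" "j \<in> I" for i j
  proof -
    have "(\<Sum>g\<in>G. c g * perm_entry g (i, j)) = (\<Sum>l\<in>I. \<Sum>k\<in>I. a i k * b j l k l)"
      unfolding c[symmetric]
      by (intro sum.cong refl comm[symmetric] ij) (simp add: b_def averaged_projection_invariant)
    also have "\<dots> = (\<Sum>k\<in>I. a i k * (\<Sum>l\<in>I. b j l k l))"
      unfolding sum_distrib_left by (rule sum.swap)
    also have "\<dots> = (\<Sum>k\<in>I. if k = j then a i j * of_nat (card G) else 0)"
      using ij by (intro sum.cong refl) (simp add: b_def diagonal)
    also have "\<dots> = a i j * of_nat (card G)" using ij finite_points by simp
    finally show ?thesis
      using nz by (simp add: field_simps flip: sum_divide_distrib)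
  qed
  thus ?thesis by (intro exI[of _ "\<lambda>g. c g / of_nat (card G)"] ballI)
qed

end

section \<open>Invariants of infinitesimal conjugation\<close>

abbreviation tuples :: "nat \<Rightarrow> (nat \<Rightarrow> 'n::finite) set" where
  "tuples r \<equiv> words r UNIV"

definition place_perm :: "(nat \<Rightarrow> nat) \<Rightarrow> (nat \<Rightarrow> 'n) \<Rightarrow> (nat \<Rightarrow> 'n) \<Rightarrow> 'a::comm_ring_1" where
  "place_perm \<sigma> i j = (if j = i \<circ> \<sigma> then 1 else 0)"

lemma finite_permutation_group_place_perms:
  "finite_permutation_group ((\<lambda>\<sigma> i. i \<circ> \<sigma>) ` perms r) (tuples r :: (nat \<Rightarrow> 'n::finite) set)"
proof
  fix g :: "(nat \<Rightarrow> 'n) \<Rightarrow> nat \<Rightarrow> 'n"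
  assume "g \<in> (\<lambda>\<sigma> i. i \<circ> \<sigma>) ` perms r"
  then obtain \<sigma> where g: "g = (\<lambda>i. i \<circ> \<sigma>)" and \<sigma>: "\<sigma> permutes {..<r}" by auto
  have cancel: "(\<lambda>i. i \<circ> inv \<sigma>) \<circ> g = id" "g \<circ> (\<lambda>i. i \<circ> inv \<sigma>) = id"
    using permutes_inv_o[OF \<sigma>] by (simp_all add: g fun_eq_iff)
  show "bij g" using o_bij[OF cancel] .
  have "inv g = (\<lambda>i. i \<circ> inv \<sigma>)" using inv_unique_comp[OF cancel(2,1)] .
  thus "inv g \<in> (\<lambda>\<sigma> i. i \<circ> \<sigma>) ` perms r" using permutes_inv[OF \<sigma>] by auto
  show "g i \<in> tuples r" if "i \<in> tuples r" for i
    unfolding g by (rule words_comp_perm[OF that \<sigma>])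
  fix h :: "(nat \<Rightarrow> 'n) \<Rightarrow> nat \<Rightarrow> 'n"
  assume "h \<in> (\<lambda>\<sigma> i. i \<circ> \<sigma>) ` perms r"
  then obtain \<tau> where h: "h = (\<lambda>i. i \<circ> \<tau>)" and \<tau>: "\<tau> permutes {..<r}" by auto
  have "g \<circ> h = (\<lambda>i. i \<circ> (\<tau> \<circ> \<sigma>))" by (simp add: g h fun_eq_iff)
  thus "g \<circ> h \<in> (\<lambda>\<sigma> i. i \<circ> \<sigma>) ` perms r" using permutes_compose[OF \<sigma> \<tau>] by blast
next
  show "id \<in> (\<lambda>\<sigma> i. i \<circ> \<sigma>) ` perms r"
    by (rule image_eqI[of _ _ id]) (auto simp: permutes_id)
qed simp_all

definition tensor_commutes ::
    "nat \<Rightarrow> ((nat \<Rightarrow> 'n::finite) \<Rightarrow> (nat \<Rightarrow> 'n) \<Rightarrow> 'a::comm_ring_1) \<Rightarrow> ((nat \<Rightarrow> 'n) \<Rightarrow> (nat \<Rightarrow> 'n) \<Rightarrow> 'a) \<Rightarrow> bool" where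
  "tensor_commutes r A B \<longleftrightarrow>
    (\<forall>i\<in>tuples r. \<forall>j\<in>tuples r. (\<Sum>k\<in>tuples r. A i k * B k j) = (\<Sum>k\<in>tuples r. B i k * A k j))"

lemma double_centraliser_place_perms:
  fixes a :: "(nat \<Rightarrow> 'n::finite) \<Rightarrow> (nat \<Rightarrow> 'n) \<Rightarrow> 'a::field_char_0"
  assumes comm: "\<And>b. (\<And>\<sigma> i j. \<sigma> permutes {..<r} \<Longrightarrow> b (i \<circ> \<sigma>) (j \<circ> \<sigma>) = b i j) \<Longrightarrow> tensor_commutes r a b"
  shows "\<exists>c. \<forall>i\<in>tuples r. \<forall>j\<in>tuples r. a i j = (\<Sum>\<sigma>\<in>perms r. c \<sigma> * place_perm \<sigma> i j)"
proof -
  let ?act = "\<lambda>\<sigma> (i :: nat \<Rightarrow> 'n). i \<circ> \<sigma>"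
  interpret finite_permutation_group "?act ` perms r" "tuples r :: (nat \<Rightarrow> 'n) set"
    by (rule finite_permutation_group_place_perms)
  have "(\<Sum>k\<in>tuples r. a i k * b k j) = (\<Sum>k\<in>tuples r. b i k * a k j)"
    if inv: "\<And>g i j. g \<in> ?act ` perms r \<Longrightarrow> b (g i) (g j) = b i j" and "i \<in> tuples r" "j \<in> tuples r" for b i j
  proof -
    have "tensor_commutes r a b" by (intro comm inv[OF imageI]) simp
    thus ?thesis using that(2,3) by (simp add: tensor_commutes_def)
  qed
  from double_centraliser[OF this] obtain c where
    c: "\<forall>i\<in>tuples r. \<forall>j\<in>tuples r. a i j = (\<Sum>g\<in>?act ` perms r. c g * perm_entry g (i, j))" ..
  define s where "s = inv_into (perms r) ?act"
  have s: "s g \<in> perms r" "?act (s g) = g" "i \<circ> s g = g i" if "g \<in> ?act ` perms r" for g i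
    using inv_into_into[OF that] f_inv_into_f[OF that] fun_cong[OF f_inv_into_f[OF that]]
    by (simp_all only: s_def)
  define c' where "c' = (\<lambda>\<sigma>. if \<sigma> \<in> s ` ?act ` perms r then c (?act \<sigma>) else 0)"
  have "a i j = (\<Sum>\<sigma>\<in>perms r. c' \<sigma> * place_perm \<sigma> i j)"
    if "i \<in> tuples r" "j \<in> tuples r" for i j
  proof -
    have "inj_on s (?act ` perms r)" unfolding s_def by (rule inj_on_inv_into) simp
    have "a i j = (\<Sum>\<sigma>\<in>s ` ?act ` perms r. c (?act \<sigma>) * place_perm \<sigma> i j)"
      unfolding c[rule_format, OF that] place_perm_def perm_entry_def prod.case
      by (subst sum.reindex[OF \<open>inj_on s _\<close>]) (intro sum.cong refl, simp only: o_apply s(2,3))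
    also have "\<dots> = (\<Sum>\<sigma>\<in>perms r. c' \<sigma> * place_perm \<sigma> i j)"
      using s(1) by (intro sum.mono_neutral_cong_left) (auto simp: c'_def)
    finally show ?thesis .
  qed
  thus ?thesis by (intro exI[of _ c'] ballI)
qed

lemma tensor_commutes_sum:
  assumes "\<And>x. x \<in> X \<Longrightarrow> tensor_commutes r A (B x)"
  shows "tensor_commutes r A (\<lambda>i j. \<Sum>x\<in>X. c x * B x i j)"
  unfolding tensor_commutes_def
proof (intro ballI)
  fix i j :: "nat \<Rightarrow> 'b" assume ij: "i \<in> tuples r" "j \<in> tuples r"
  have "(\<Sum>k\<in>tuples r. A i k * (\<Sum>x\<in>X. c x * B x k j)) = (\<Sum>x\<in>X. c x * (\<Sum>k\<in>tuples r. A i k * B x k j))"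
    by (simp add: sum_distrib_left mult_ac sum.swap[of _ X])
  also have "\<dots> = (\<Sum>x\<in>X. c x * (\<Sum>k\<in>tuples r. B x i k * A k j))"
    using assms ij by (intro sum.cong refl) (auto simp: tensor_commutes_def)
  also have "\<dots> = (\<Sum>k\<in>tuples r. (\<Sum>x\<in>X. c x * B x i k) * A k j)"
    by (simp add: sum_distrib_left sum_distrib_right mult_ac sum.swap[of _ X])
  finally show "(\<Sum>k\<in>tuples r. A i k * (\<Sum>x\<in>X. c x * B x k j)) = (\<Sum>k\<in>tuples r. (\<Sum>x\<in>X. c x * B x i k) * A k j)" .
qed

lemma (in comm_ring_hom) tensor_commutes_hom:
  assumes "tensor_commutes r A B"
  shows "tensor_commutes r (\<lambda>i j. h (A i j)) (\<lambda>i j. h (B i j))"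
  unfolding tensor_commutes_def mult[symmetric] sum[symmetric]
  using assms by (simp add: tensor_commutes_def)

text \<open>Invariance of a tensor under the infinitesimal conjugations by the matrix units.\<close>
definition gl_invariant :: "nat \<Rightarrow> ((nat \<Rightarrow> 'n::finite) \<Rightarrow> (nat \<Rightarrow> 'n) \<Rightarrow> 'a::comm_ring_1) \<Rightarrow> bool" where
  "gl_invariant r A \<longleftrightarrow> (\<forall>u w. \<forall>i\<in>tuples r. \<forall>j\<in>tuples r.
     (\<Sum>p<r. if i p = w then A (i(p := u)) j else 0) = (\<Sum>p<r. if j p = u then A i (j(p := w)) else 0))"

lemma (in comm_ring_hom) gl_invariant_hom:
  assumes "gl_invariant r A"
  shows "gl_invariant r (\<lambda>i j. h (A i j))"
proof -
  have if_hom: "(if b then h x else 0) = h (if b then x else 0)" for b x by (simp add: zero)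
  show ?thesis unfolding gl_invariant_def if_hom sum[symmetric] using assms by (simp add: gl_invariant_def)
qed

lemma sum_tuples_upd:
  assumes "p < r"
  shows "(\<Sum>k\<in>tuples r. if k p = w then F (k(p := u)) k else 0) = (\<Sum>k\<in>tuples r. if k p = u then F k (k(p := w)) else 0)"
proof -
  have "(\<Sum>k\<in>tuples r. if k p = w then F (k(p := u)) k else 0) = (\<Sum>k\<in>{k\<in>tuples r. k p = w}. F (k(p := u)) k)"
    by (intro sum.mono_neutral_cong_right) auto
  also have "\<dots> = (\<Sum>k\<in>{k\<in>tuples r. k p = u}. F k (k(p := w)))"
    by (rule sum.reindex_bij_witness[of _ "\<lambda>k. k(p := w)" "\<lambda>k. k(p := u)"])
      (use assms in \<open>simp_all add: words_upd fun_upd_idem\<close>)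
  also have "\<dots> = (\<Sum>k\<in>tuples r. if k p = u then F k (k(p := w)) else 0)"
    by (intro sum.mono_neutral_cong_left) auto
  finally show ?thesis .
qed

lemma tensor_commutes_replace:
  assumes inv: "gl_invariant r A" and comm: "tensor_commutes r A B"
  shows "tensor_commutes r A (\<lambda>i j. \<Sum>p<r. if i p = u then B (i(p := w)) j else 0)"
  unfolding tensor_commutes_def
proof (intro ballI)
  fix i j :: "nat \<Rightarrow> 'a" assume ij: "i \<in> tuples r" "j \<in> tuples r"
  have swap: "(\<Sum>k\<in>tuples r. (\<Sum>p<r. if i p = u then F k p else 0) * G k)
      = (\<Sum>p<r. if i p = u then \<Sum>k\<in>tuples r. F k p * G k else 0)" for F :: "_ \<Rightarrow> _ \<Rightarrow> 'b" and G
    unfolding sum_distrib_right by (subst sum.swap) (intro sum.cong refl, simp)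
  have "(\<Sum>k\<in>tuples r. (\<Sum>p<r. if i p = u then B (i(p := w)) k else 0) * A k j)
     = (\<Sum>p<r. if i p = u then (\<Sum>k\<in>tuples r. B (i(p := w)) k * A k j) else 0)"
    by (rule swap)
  also have "\<dots> = (\<Sum>p<r. if i p = u then (\<Sum>k\<in>tuples r. A (i(p := w)) k * B k j) else 0)"
    using comm ij words_upd[OF ij(1)] by (intro sum.cong refl) (auto simp: tensor_commutes_def)
  also have "\<dots> = (\<Sum>k\<in>tuples r. (\<Sum>p<r. if i p = u then A (i(p := w)) k else 0) * B k j)"
    by (rule swap[symmetric])
  also have "\<dots> = (\<Sum>k\<in>tuples r. (\<Sum>p<r. if k p = w then A i (k(p := u)) else 0) * B k j)"
    using inv ij by (intro sum.cong refl) (auto simp: gl_invariant_def)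
  also have "\<dots> = (\<Sum>p<r. \<Sum>k\<in>tuples r. if k p = w then A i (k(p := u)) * B k j else 0)"
    unfolding sum_distrib_right by (subst sum.swap) (intro sum.cong refl, simp)
  also have "\<dots> = (\<Sum>p<r. \<Sum>k\<in>tuples r. if k p = u then A i k * B (k(p := w)) j else 0)"
    by (rule sum.cong[OF refl], rule sum_tuples_upd[of _ r w "\<lambda>x y. A i x * B y j" u]) simp
  also have "\<dots> = (\<Sum>k\<in>tuples r. A i k * (\<Sum>p<r. if k p = u then B (k(p := w)) j else 0))"
    unfolding sum_distrib_left by (subst sum.swap) (intro sum.cong refl, simp)
  finally show "(\<Sum>k\<in>tuples r. A i k * (\<Sum>p<r. if k p = u then B (k(p := w)) j else 0))
    = (\<Sum>k\<in>tuples r. (\<Sum>p<r. if i p = u then B (i(p := w)) k else 0) * A k j)" by simp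
qed

text \<open>The product of \<open>B\<close> with the sum over all places \<open>p\<close> of the tensors with \<open>Z\<close> at \<open>p\<close> and the
  identity elsewhere.\<close>
definition place_sum :: "nat \<Rightarrow> ('n::finite \<Rightarrow> 'n \<Rightarrow> 'a::comm_ring_1) \<Rightarrow>
    ((nat \<Rightarrow> 'n) \<Rightarrow> (nat \<Rightarrow> 'n) \<Rightarrow> 'a) \<Rightarrow> (nat \<Rightarrow> 'n) \<Rightarrow> (nat \<Rightarrow> 'n) \<Rightarrow> 'a" where
  "place_sum r Z B i j = (\<Sum>p<r. \<Sum>l\<in>UNIV. Z (i p) l * B (i(p := l)) j)"

lemma tensor_commutes_place_sum:
  assumes "gl_invariant r A" "tensor_commutes r A B"
  shows "tensor_commutes r A (place_sum r Z B)"
proof -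
  have place_sum: "place_sum r Z B i j
    = (\<Sum>uw\<in>UNIV. Z (fst uw) (snd uw) * (\<Sum>p<r. if i p = fst uw then B (i(p := snd uw)) j else 0))" for i j
  proof -
    have "(\<Sum>uw\<in>UNIV. Z (fst uw) (snd uw) * (\<Sum>p<r. if i p = fst uw then B (i(p := snd uw)) j else 0))
      = (\<Sum>p<r. \<Sum>u\<in>UNIV. \<Sum>w\<in>UNIV. if u = i p then Z u w * B (i(p := w)) j else 0)"
      unfolding UNIV_Times_UNIV[symmetric] sum.cartesian_product[symmetric] case_prod_unfold[symmetric]
        sum_distrib_left
      by (subst sum.swap[of _ "{..<r}"]) (auto simp: sum.cartesian_product intro!: sum.cong)
    also have "\<dots> = (\<Sum>p<r. \<Sum>u\<in>UNIV. if u = i p then \<Sum>w\<in>UNIV. Z u w * B (i(p := w)) j else 0)"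
      by (intro sum.cong refl) simp
    finally show ?thesis by (simp add: place_sum_def)
  qed
  show ?thesis unfolding place_sum[abs_def] by (intro tensor_commutes_sum tensor_commutes_replace assms)
qed

lemma mpoly_eqI_homogeneous_components:
  assumes "\<And>k. homogeneous_component k f = homogeneous_component k g"
  shows "f = g"
proof -
  have "scale_vars UNIV f = scale_vars UNIV g"
    using assms by (intro poly_eqI) (simp add: homogeneous_component_def)
  thus ?thesis by (metis poly_scale_vars_1)
qed

lemma homogeneous_mult: "homogeneous d f \<Longrightarrow> homogeneous e g \<Longrightarrow> homogeneous (d + e) (f * g)"
  by (simp add: homogeneous_def hom_simps mult_monom)

lemma homogeneous_component_homogeneous_mult:
  "homogeneous d f \<Longrightarrow> homogeneous_component (d + k) (f * g) = f * homogeneous_component k g"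
  by (simp add: homogeneous_def homogeneous_component_def hom_simps coeff_monom_mult)

lemma homogeneous_component_pconst_mult:
  "homogeneous_component k (pconst c * f) = pconst c * homogeneous_component k f"
  by (simp add: homogeneous_component_def hom_simps)

lemma tensor_commutes_diff:
  "tensor_commutes r A B \<Longrightarrow> tensor_commutes r A C \<Longrightarrow> tensor_commutes r A (\<lambda>i j. B i j - C i j)"
  by (simp add: tensor_commutes_def left_diff_distrib right_diff_distrib sum_subtractf)

lemma tensor_commutes_cancel:
  fixes B :: "(nat \<Rightarrow> 'n::finite) \<Rightarrow> (nat \<Rightarrow> 'n) \<Rightarrow> ('v, 'a::field) mpoly"
  assumes "tensor_commutes r A (\<lambda>i j. c * B i j)" "c \<noteq> 0"
  shows "tensor_commutes r A B"
  using assms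
  by (simp add: tensor_commutes_def mult.left_commute[of _ c] mult.assoc mpoly_mult_left_cancel
      flip: sum_distrib_left)

lemma tensor_commutes_deriv_by:
  assumes "tensor_commutes r (\<lambda>i j. pconst (a i j)) B"
  shows "tensor_commutes r (\<lambda>i j. pconst (a i j)) (\<lambda>i j. deriv_by d (B i j))"
  unfolding tensor_commutes_def
proof (intro ballI)
  fix i j :: "nat \<Rightarrow> 'a" assume "i \<in> tuples r" "j \<in> tuples r"
  hence "deriv_by d (\<Sum>k\<in>tuples r. pconst (a i k) * B k j) = deriv_by d (\<Sum>k\<in>tuples r. B i k * pconst (a k j))"
    using assms by (simp add: tensor_commutes_def)
  thus "(\<Sum>k\<in>tuples r. pconst (a i k) * deriv_by d (B k j)) = (\<Sum>k\<in>tuples r. deriv_by d (B i k) * pconst (a k j))"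
    by (simp add: deriv_by_sum deriv_by_mult)
qed

definition one_plus_generic :: "'n \<times> 'n \<Rightarrow> ('n \<times> 'n, 'a::comm_ring_1) mpoly" where
  "one_plus_generic = (\<lambda>(a, b). (if a = b then 1 else 0) + pvar (a, b))"

definition one_plus_generic_power ::
    "nat \<Rightarrow> (nat \<Rightarrow> 'n) \<Rightarrow> (nat \<Rightarrow> 'n) \<Rightarrow> ('n \<times> 'n, 'a::comm_ring_1) mpoly" where
  "one_plus_generic_power r i j = (\<Prod>p<r. one_plus_generic (i p, j p))"

definition generic_square :: "'n::finite \<times> 'n \<Rightarrow> ('n \<times> 'n, 'a::comm_ring_1) mpoly" where
  "generic_square = (\<lambda>(a, b). \<Sum>l\<in>UNIV. pvar (a, l) * pvar (l, b))"

text \<open>The derivation \<open>Z \<mapsto> Z + Z\<^sup>2\<close> multiplies \<open>1 + Z\<close> by \<open>Z\<close>, hence its tensor power by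
  the sum of \<open>Z\<close> over all places.\<close>
lemma deriv_by_one_plus_generic_power:
  fixes i j :: "nat \<Rightarrow> 'n::finite"
  shows "deriv_by (\<lambda>v. pvar v + generic_square v) (one_plus_generic_power r i j :: ('n \<times> 'n, 'a::comm_ring_1) mpoly)
    = place_sum r (\<lambda>a b. pvar (a, b)) (one_plus_generic_power r) i j"
proof -
  have entry: "deriv_by (\<lambda>v. pvar v + generic_square v) (one_plus_generic (a, b) :: ('n \<times> 'n, 'a) mpoly)
      = (\<Sum>l\<in>UNIV. pvar (a, l) * one_plus_generic (l, b))" for a b :: 'n
    by (simp add: one_plus_generic_def generic_square_def deriv_by_add distrib_left sum.distrib
        if_distrib[of "deriv_by _"] if_distrib[of "\<lambda>x. _ * x"] cong: if_cong)
  have "deriv_by (\<lambda>v. pvar v + generic_square v) (one_plus_generic_power r i j :: ('n \<times> 'n, 'a) mpoly)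
    = (\<Sum>p<r. (\<Sum>l\<in>UNIV. pvar (i p, l) * one_plus_generic (l, j p))
        * (\<Prod>q\<in>{..<r} - {p}. one_plus_generic (i q, j q)))"
    unfolding one_plus_generic_power_def by (simp add: deriv_by_prod entry)
  also have "\<dots> = (\<Sum>p<r. \<Sum>l\<in>UNIV. pvar (i p, l) * one_plus_generic_power r (i(p := l)) j)"
  proof (rule sum.cong[OF refl])
    fix p assume p: "p \<in> {..<r}"
    have "(one_plus_generic_power r (i(p := l)) j :: ('n \<times> 'n, 'a) mpoly)
      = one_plus_generic (l, j p) * (\<Prod>q\<in>{..<r} - {p}. one_plus_generic (i q, j q))" for l
      unfolding one_plus_generic_power_def using p
      by (subst prod.remove[of _ p]) (auto intro!: arg_cong2[where f = "(*)"] prod.cong)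
    thus "(\<Sum>l\<in>UNIV. pvar (i p, l) * one_plus_generic (l, j p)) *
        (\<Prod>q\<in>{..<r} - {p}. one_plus_generic (i q, j q) :: ('n \<times> 'n, 'a) mpoly)
      = (\<Sum>l\<in>UNIV. pvar (i p, l) * one_plus_generic_power r (i(p := l)) j)"
      by (simp add: sum_distrib_right mult.assoc)
  qed
  finally show ?thesis by (simp add: place_sum_def)
qed

lemma homogeneous_component_one_plus_generic_power_0:
  fixes i j :: "nat \<Rightarrow> 'n"
  shows "homogeneous_component 0 (one_plus_generic_power r i j :: ('n \<times> 'n, 'a::comm_ring_1) mpoly)
    = (if \<forall>p<r. i p = j p then 1 else 0)"
proof -
  have "homogeneous_component 0 (one_plus_generic (a, b) :: ('n \<times> 'n, 'a) mpoly) = (if a = b then 1 else 0)" for a b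
    by (simp add: one_plus_generic_def homogeneous_component_def hom_simps)
  thus ?thesis
    by (induction r) (auto simp: one_plus_generic_power_def homogeneous_component_mult less_Suc_eq
        homogeneous_component_def[of _ 1] hom_simps)
qed

lemma homogeneous_component_one_plus_generic_power_Suc:
  fixes i j :: "nat \<Rightarrow> 'n::finite" and r :: nat and T :: "nat \<Rightarrow> (nat \<Rightarrow> 'n) \<Rightarrow> (nat \<Rightarrow> 'n) \<Rightarrow> ('n \<times> 'n, 'a::field_char_0) mpoly"
  defines "T \<equiv> \<lambda>k i j. homogeneous_component k (one_plus_generic_power r i j)"
  shows "of_nat (Suc k) * T (Suc k) i j
    = place_sum r (\<lambda>a b. pvar (a, b)) (T k) i j - deriv_by generic_square (T k i j)"
proof -
  have square: "homogeneous (Suc 1) (generic_square v :: ('n \<times> 'n, 'a) mpoly)" for v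
    using homogeneous_mult[OF homogeneous_pvar homogeneous_pvar]
    by (cases v) (auto simp: generic_square_def intro!: homogeneous_sum)
  have "homogeneous_component (1 + k)
      (deriv_by (\<lambda>v. pvar v + generic_square v) (one_plus_generic_power r i j))
    = of_nat (1 + k) * T (1 + k) i j + deriv_by generic_square (T k i j)"
    unfolding deriv_by_generators_add homogeneous_component_add homogeneous_component_euler_deriv
      homogeneous_component_deriv_by[OF square] T_def ..
  moreover have "homogeneous_component (1 + k) (place_sum r (\<lambda>a b. pvar (a, b)) (one_plus_generic_power r) i j)
    = place_sum r (\<lambda>a b. pvar (a, b)) (T k) i j"
    unfolding place_sum_def homogeneous_component_sum
      homogeneous_component_homogeneous_mult[OF homogeneous_pvar] T_def ..
  ultimately show ?thesis by (simp add: eq_diff_eq deriv_by_one_plus_generic_power)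
qed

lemma gl_invariant_commutes_one_plus_generic_power:
  fixes a :: "(nat \<Rightarrow> 'n::finite) \<Rightarrow> (nat \<Rightarrow> 'n) \<Rightarrow> 'a::field_char_0"
  assumes inv: "gl_invariant r a"
  shows "tensor_commutes r (\<lambda>i j. pconst (a i j)) (one_plus_generic_power r)"
proof -
  let ?A = "\<lambda>i j. pconst (a i j) :: ('n \<times> 'n, 'a) mpoly"
  let ?T = "\<lambda>k i j. homogeneous_component k (one_plus_generic_power r i j)"
  have comm: "tensor_commutes r ?A (?T k)" for k
  proof (induction k)
    case 0
    have "(\<forall>p<r. i p = j p) \<longleftrightarrow> i = j" if "i \<in> tuples r" "j \<in> tuples r" for i j :: "nat \<Rightarrow> 'n"
      using PiE_ext[OF that] by auto
    thus ?case
      by (simp add: tensor_commutes_def homogeneous_component_one_plus_generic_power_0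
          if_distrib[of "\<lambda>x. _ * x"] if_distrib[of "\<lambda>x. x * _"] cong: if_cong)
  next
    case (Suc k)
    have "tensor_commutes r ?A (\<lambda>i j. of_nat (Suc k) * ?T (Suc k) i j)"
      unfolding homogeneous_component_one_plus_generic_power_Suc
      by (intro tensor_commutes_diff tensor_commutes_place_sum tensor_commutes_deriv_by Suc
          pconst.gl_invariant_hom inv)
    thus ?case by (rule tensor_commutes_cancel) (simp del: of_nat_Suc)
  qed
  show ?thesis
    unfolding tensor_commutes_def
  proof (intro ballI, rule mpoly_eqI_homogeneous_components)
    fix i j :: "nat \<Rightarrow> 'n" and k assume "i \<in> tuples r" "j \<in> tuples r"
    thus "homogeneous_component k (\<Sum>l\<in>tuples r. ?A i l * one_plus_generic_power r l j)
        = homogeneous_component k (\<Sum>l\<in>tuples r. one_plus_generic_power r i l * ?A l j)"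
      unfolding homogeneous_component_sum homogeneous_component_pconst_mult
        mult.commute[of _ "pconst _"]
      using comm[of k] unfolding tensor_commutes_def mult.commute[of _ "pconst _"] by blast
  qed
qed

definition zip_word :: "nat \<Rightarrow> (nat \<Rightarrow> 'x) \<Rightarrow> (nat \<Rightarrow> 'y) \<Rightarrow> nat \<Rightarrow> 'x \<times> 'y" where
  "zip_word r i j = restrict (\<lambda>p. (i p, j p)) {..<r}"

lemma zip_word_mem: "i \<in> words r X \<Longrightarrow> j \<in> words r Y \<Longrightarrow> zip_word r i j \<in> words r (X \<times> Y)"
  by (auto simp: zip_word_def)

lemma fst_zip_word: "i \<in> words r X \<Longrightarrow> restrict (fst \<circ> zip_word r i j) {..<r} = i"
  by (auto simp: fun_eq_iff zip_word_def PiE_def extensional_def)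

lemma snd_zip_word: "j \<in> words r Y \<Longrightarrow> restrict (snd \<circ> zip_word r i j) {..<r} = j"
  by (auto simp: fun_eq_iff zip_word_def PiE_def extensional_def)

lemma restrict_comp_perm:
  assumes "\<rho> permutes {..<r}"
  shows "restrict (v \<circ> \<rho>) {..<r} = restrict v {..<r} \<circ> \<rho>"
proof
  fix p show "restrict (v \<circ> \<rho>) {..<r} p = (restrict v {..<r} \<circ> \<rho>) p"
    using permutes_in_image[OF assms, of p] by (auto simp: restrict_def)
qed

lemma mon_zip_word: "mon r (zip_word r i j) = (\<Prod>p<r. pvar (i p, j p))"
  by (simp add: mon_def zip_word_def)

lemma gl_invariant_commutes_mon_zip_word:
  fixes a :: "(nat \<Rightarrow> 'n::finite) \<Rightarrow> (nat \<Rightarrow> 'n) \<Rightarrow> 'a::field_char_0"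
  assumes "gl_invariant r a"
  shows "tensor_commutes r (\<lambda>i j. pconst (a i j)) (\<lambda>i j. mon r (zip_word r i j) :: ('n \<times> 'n, 'a) mpoly)"
proof -
  define shift :: "('n \<times> 'n, 'a) mpoly \<Rightarrow> ('n \<times> 'n, 'a) mpoly"
    where "shift = (\<lambda>f. cpeval (\<lambda>(a, b). pvar (a, b) - (if a = b then 1 else 0)) f pconst)"
  interpret shift: comm_ring_hom shift unfolding shift_def by (rule pconst.cpeval_hom)
  have "shift (one_plus_generic (a, b)) = pvar (a, b)" for a b
    by (simp add: shift_def one_plus_generic_def hom_simps)
  hence "shift (one_plus_generic_power r i j) = mon r (zip_word r i j)" for i j
    by (simp add: one_plus_generic_power_def shift.prod mon_zip_word)
  moreover have "shift (pconst x) = pconst x" for x by (simp add: shift_def)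
  ultimately show ?thesis
    using shift.tensor_commutes_hom[OF gl_invariant_commutes_one_plus_generic_power[OF assms]] by simp
qed

definition commutator_coeff :: "nat \<Rightarrow> ((nat \<Rightarrow> 'n::finite) \<Rightarrow> (nat \<Rightarrow> 'n) \<Rightarrow> 'a::comm_ring_1) \<Rightarrow>
    (nat \<Rightarrow> 'n) \<Rightarrow> (nat \<Rightarrow> 'n) \<Rightarrow> (nat \<Rightarrow> 'n \<times> 'n) \<Rightarrow> 'a" where
  "commutator_coeff r a i h v = (\<Sum>k\<in>tuples r. if v = zip_word r k h then a i k else 0)
    - (\<Sum>k\<in>tuples r. if v = zip_word r i k then a k h else 0)"

lemma (in comm_ring_hom) sum_commutator_coeff:
  fixes i l :: "nat \<Rightarrow> 'n::finite"
  shows "(\<Sum>v\<in>tuples r. h (commutator_coeff r a i l v) * g v)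
    = (\<Sum>k\<in>tuples r. h (a i k) * g (zip_word r k l)) - (\<Sum>k\<in>tuples r. g (zip_word r i k) * h (a k l))"
proof -
  have "h (commutator_coeff r a i l v) * g v
      = (\<Sum>k\<in>tuples r. (if v = zip_word r k l then h (a i k) else 0) * g v)
        - (\<Sum>k\<in>tuples r. (if v = zip_word r i k then h (a k l) else 0) * g v)" for v
    by (simp add: commutator_coeff_def diff sum if_distrib[of h] zero left_diff_distrib sum_distrib_right
        cong: if_cong)
  hence "(\<Sum>v\<in>tuples r. h (commutator_coeff r a i l v) * g v)
    = (\<Sum>k\<in>tuples r. \<Sum>v\<in>tuples r. (if v = zip_word r k l then h (a i k) else 0) * g v)
      - (\<Sum>k\<in>tuples r. \<Sum>v\<in>tuples r. (if v = zip_word r i k then h (a k l) else 0) * g v)"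
    by (simp add: sum_subtractf sum.swap[of _ "tuples r" "tuples r :: (nat \<Rightarrow> 'n \<times> 'n) set"])
  moreover have "(\<Sum>v\<in>tuples r. (if v = zip_word r i j then x else 0) * g v) = x * g (zip_word r i j)"
    for x and i j :: "nat \<Rightarrow> 'n"
    by (simp add: zip_word_def if_distrib[of "\<lambda>c. c * _"] cong: if_cong)
  ultimately show ?thesis by (simp only: mult.commute[of "g _"])
qed

lemma gl_invariant_commutes_symmetric:
  fixes a b :: "(nat \<Rightarrow> 'n::finite) \<Rightarrow> (nat \<Rightarrow> 'n) \<Rightarrow> 'a::field_char_0"
  assumes inv: "gl_invariant r a" and sym: "\<And>\<sigma> i j. \<sigma> permutes {..<r} \<Longrightarrow> b (i \<circ> \<sigma>) (j \<circ> \<sigma>) = b i j"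
  shows "tensor_commutes r a b"
  unfolding tensor_commutes_def
proof (intro ballI)
  fix i h :: "nat \<Rightarrow> 'n" assume ih: "i \<in> tuples r" "h \<in> tuples r"
  define c where "c = (\<lambda>v. b (restrict (fst \<circ> v) {..<r}) (restrict (snd \<circ> v) {..<r}))"
  have "restitution UNIV r (commutator_coeff r a i h) = 0"
    using ih gl_invariant_commutes_mon_zip_word[OF inv]
    by (simp add: restitution_def pconst.sum_commutator_coeff tensor_commutes_def)
  moreover have "symmetric_tensor r c"
    by (simp add: symmetric_tensor_def c_def restrict_comp_perm sym flip: comp_assoc)
  ultimately have "(\<Sum>v\<in>tuples r. commutator_coeff r a i h v * c v) = 0"
    by (rule restitution_eq_0_imp_orthogonal) simp
  moreover have "c (zip_word r i j) = b i j" if "i \<in> tuples r" "j \<in> tuples r" for i j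
    using that by (simp add: c_def fst_zip_word snd_zip_word)
  ultimately show "(\<Sum>k\<in>tuples r. a i k * b k h) = (\<Sum>k\<in>tuples r. b i k * a k h)"
    using id_hom.sum_commutator_coeff[of r a i h c] ih by simp
qed

lemma gl_invariant_imp_sum_place_perms:
  fixes a :: "(nat \<Rightarrow> 'n::finite) \<Rightarrow> (nat \<Rightarrow> 'n) \<Rightarrow> 'a::field_char_0"
  assumes "gl_invariant r a"
  shows "\<exists>c. \<forall>i\<in>tuples r. \<forall>j\<in>tuples r. a i j = (\<Sum>\<sigma>\<in>perms r. c \<sigma> * place_perm \<sigma> i j)"
  by (intro double_centraliser_place_perms gl_invariant_commutes_symmetric assms)

section \<open>Invariants are trace polynomials\<close>

lemma sum_zip_word:
  fixes F :: "(nat \<Rightarrow> 'x \<times> 'y) \<Rightarrow> 'b::comm_monoid_add"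
  shows "(\<Sum>v\<in>words r (X \<times> Y). F v) = (\<Sum>i\<in>words r X. \<Sum>j\<in>words r Y. F (zip_word r i j))"
proof -
  have "(\<Sum>v\<in>words r (X \<times> Y). F v) = (\<Sum>ij\<in>words r X \<times> words r Y. F (zip_word r (fst ij) (snd ij)))"
  proof (rule sum.reindex_bij_witness[of _ "\<lambda>ij. zip_word r (fst ij) (snd ij)"
        "\<lambda>v. (restrict (fst \<circ> v) {..<r}, restrict (snd \<circ> v) {..<r})"])
    show zip: "zip_word r (fst (restrict (fst \<circ> v) {..<r}, restrict (snd \<circ> v) {..<r}))
        (snd (restrict (fst \<circ> v) {..<r}, restrict (snd \<circ> v) {..<r})) = v" if "v \<in> words r (X \<times> Y)" for v
      using that by (auto simp: zip_word_def fun_eq_iff PiE_def extensional_def)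
    show "F (zip_word r (fst (restrict (fst \<circ> v) {..<r}, restrict (snd \<circ> v) {..<r}))
        (snd (restrict (fst \<circ> v) {..<r}, restrict (snd \<circ> v) {..<r}))) = F v" if "v \<in> words r (X \<times> Y)" for v
      using zip[OF that] by simp
    show "(restrict (fst \<circ> v) {..<r}, restrict (snd \<circ> v) {..<r}) \<in> words r X \<times> words r Y"
      if "v \<in> words r (X \<times> Y)" for v
      using that by (auto simp: PiE_def Pi_def mem_Times_iff)
    fix ij :: "(nat \<Rightarrow> 'x) \<times> (nat \<Rightarrow> 'y)" assume "ij \<in> words r X \<times> words r Y"
    hence ij: "fst ij \<in> words r X" "snd ij \<in> words r Y" by (simp_all only: mem_Times_iff)
    show "zip_word r (fst ij) (snd ij) \<in> words r (X \<times> Y)" by (rule zip_word_mem[OF ij])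
    show "(restrict (fst \<circ> zip_word r (fst ij) (snd ij)) {..<r},
        restrict (snd \<circ> zip_word r (fst ij) (snd ij)) {..<r}) = ij"
      by (simp only: fst_zip_word[OF ij(1)] snd_zip_word[OF ij(2)] prod.collapse)
  qed
  thus ?thesis by (simp add: sum.cartesian_product case_prod_unfold)
qed

definition trace_mon :: "nat \<Rightarrow> (nat \<Rightarrow> nat) \<Rightarrow> (nat \<Rightarrow> nat) \<Rightarrow> ('a::comm_ring_1, 'n::finite) cpoly" where
  "trace_mon r k \<sigma> = (\<Sum>i\<in>tuples r. \<Prod>p<r. pvar (k p, i p, i (\<sigma> p)))"

definition ad_coeff :: "'n \<Rightarrow> 'n \<Rightarrow> nat \<times> 'n \<times> 'n \<Rightarrow> nat \<times> 'n \<times> 'n \<Rightarrow> 'a::comm_ring_1" where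
  "ad_coeff u w = (\<lambda>(k, i, j) x.
    (if i = u \<and> x = (k, w, j) then 1 else 0) - (if j = w \<and> x = (k, i, u) then 1 else 0))"

lemma ad_gen_unit_mat_eq_sum:
  assumes K: "finite K" "v \<in> K \<times> UNIV"
  shows "ad_gen (unit_mat u w) v = (\<Sum>x\<in>K \<times> (UNIV :: ('n::finite \<times> 'n) set). pconst (ad_coeff u w v x) * pvar x)"
proof (cases v)
  case (fields k i j)
  let ?V = "K \<times> (UNIV :: ('n \<times> 'n) set)"
  have "(\<Sum>x\<in>?V. pconst (ad_coeff u w v x) * pvar x)
      = (\<Sum>x\<in>?V. if x = (k, w, j) then (if i = u then pvar x else 0) else 0)
        - (\<Sum>x\<in>?V. if x = (k, i, u) then (if j = w then pvar x else 0) else 0)"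
    unfolding sum_subtractf[symmetric] by (intro sum.cong refl) (simp add: fields ad_coeff_def hom_simps)
  also have "\<dots> = ad_gen (unit_mat u w) v" using K by (simp add: ad_gen_unit_mat fields)
  finally show ?thesis by (rule sym)
qed

lemma sum_ad_coeff_mult:
  assumes K: "finite K" "k \<in> K"
  shows "(\<Sum>x\<in>K \<times> (UNIV :: ('n::finite \<times> 'n) set). ad_coeff u w x (k, i, j) * g x)
    = (if i = w then g (k, u, j) else 0) - (if j = u then g (k, i, w) else 0)"
proof -
  have coeff: "ad_coeff u w x (k, i, j) = (if x = (k, u, j) then (if i = w then 1 else 0) else 0)
      - (if x = (k, i, w) then (if j = u then 1 else 0) else 0)" for x
    by (cases x) (simp only: ad_coeff_def prod.case, intro arg_cong2[where f = "(-)"], auto)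
  have "(\<Sum>x\<in>K \<times> UNIV. ad_coeff u w x (k, i, j) * g x)
    = (\<Sum>x\<in>K \<times> UNIV. if x = (k, u, j) then (if i = w then g x else 0) else 0)
      - (\<Sum>x\<in>K \<times> UNIV. if x = (k, i, w) then (if j = u then g x else 0) else 0)"
    unfolding sum_subtractf[symmetric] by (intro sum.cong refl) (simp add: coeff)
  thus ?thesis using K by simp
qed

lemma invariant_restitution_imp_gl_invariant:
  fixes a :: "(nat \<Rightarrow> nat \<times> 'n::finite \<times> 'n) \<Rightarrow> 'a::field_char_0"
  assumes inv: "\<And>u w. ad (unit_mat u w) (restitution (K \<times> UNIV) r a) = 0"
    and sym: "symmetric_tensor r a" and K: "finite K" and k: "k \<in> words r K"
  shows "gl_invariant r (\<lambda>i j. a (zip_word r k (zip_word r i j)))"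
  unfolding gl_invariant_def
proof (intro allI ballI)
  fix u w and i j :: "nat \<Rightarrow> 'n" assume "i \<in> tuples r" "j \<in> tuples r"
  let ?V = "K \<times> (UNIV :: ('n \<times> 'n) set)" and ?z = "\<lambda>i j. zip_word r k (zip_word r i j)"
  let ?Da = "\<lambda>v. \<Sum>p<r. \<Sum>x\<in>?V. ad_coeff u w x (v p) * a (v(p := x))"
  have V: "finite ?V" using K by simp
  have "restitution ?V r ?Da = 0"
    using deriv_by_restitution[of ?V "ad_gen (unit_mat u w)" "ad_coeff u w" r a,
        OF ad_gen_unit_mat_eq_sum[OF K]] inv[of u w] by simp
  moreover have "?z i j \<in> words r ?V" by (rule zip_word_mem[OF k]) (simp add: zip_word_def)
  ultimately have "?Da (?z i j) = 0" by (rule restitution_symmetric_eq_0[OF _ symmetric_tensor_deriv[OF sym] V])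
  moreover have "(\<Sum>x\<in>?V. ad_coeff u w x (?z i j p) * a ((?z i j)(p := x)))
      = (if i p = w then a (?z (i(p := u)) j) else 0) - (if j p = u then a (?z i (j(p := w))) else 0)"
    if p: "p \<in> {..<r}" for p
  proof -
    have "(?z i j)(p := (k p, u, j p)) = ?z (i(p := u)) j" "(?z i j)(p := (k p, i p, w)) = ?z i (j(p := w))"
      "?z i j p = (k p, i p, j p)"
      using p by (auto simp: zip_word_def)
    moreover have "k p \<in> K" using k p by auto
    ultimately show ?thesis by (simp only: sum_ad_coeff_mult[OF K])
  qed
  ultimately show "(\<Sum>p<r. if i p = w then a (?z (i(p := u)) j) else 0)
      = (\<Sum>p<r. if j p = u then a (?z i (j(p := w))) else 0)"
    by (simp add: sum_subtractf)
qed

lemma invariant_imp_sum_trace_mons: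
  fixes f :: "('a::field_char_0, 'n::finite) cpoly"
  assumes K: "finite K" "f \<in> vars_in (K \<times> UNIV)" and hom: "homogeneous r f"
    and inv: "\<And>u w. ad (unit_mat u w) f = 0"
  shows "\<exists>c. f = (\<Sum>k\<in>words r K. \<Sum>\<sigma>\<in>perms r. pconst (c k \<sigma>) * trace_mon r k \<sigma>)"
proof -
  obtain a where a: "symmetric_tensor r a" "f = restitution (K \<times> UNIV) r a"
    using ex_symmetric_restitution[OF _ K(2) hom] K(1) by auto
  have "\<forall>k\<in>words r K. \<exists>c. \<forall>i\<in>tuples r. \<forall>j\<in>tuples r. a (zip_word r k (zip_word r i j)) = (\<Sum>\<sigma>\<in>perms r. c \<sigma> * place_perm \<sigma> i j)"
    using invariant_restitution_imp_gl_invariant[OF _ a(1) K(1)] inv a(2)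
    by (intro ballI gl_invariant_imp_sum_place_perms) simp
  from bchoice[OF this] obtain c where c: "\<forall>k\<in>words r K. \<forall>i\<in>tuples r. \<forall>j\<in>tuples r.
      a (zip_word r k (zip_word r i j)) = (\<Sum>\<sigma>\<in>perms r. c k \<sigma> * place_perm \<sigma> i j)" ..
  have mon: "mon r (zip_word r k (zip_word r i j)) = (\<Prod>p<r. pvar (k p, i p, j p))" for k and i j :: "nat \<Rightarrow> 'n"
    by (simp add: mon_def zip_word_def)
  have collapse: "(\<Sum>j\<in>tuples r. (\<Sum>\<sigma>\<in>perms r. pconst (c k \<sigma> * place_perm \<sigma> i j)) * (\<Prod>p<r. pvar (k p, i p, j p)))
      = (\<Sum>\<sigma>\<in>perms r. pconst (c k \<sigma>) * (\<Prod>p<r. pvar (k p, i p, i (\<sigma> p))))"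
    if i: "i \<in> tuples r" for k and i :: "nat \<Rightarrow> 'n"
  proof -
    have "(\<Sum>j\<in>tuples r. pconst (c k \<sigma> * place_perm \<sigma> i j) * (\<Prod>p<r. pvar (k p, i p, j p)))
      = pconst (c k \<sigma>) * (\<Prod>p<r. pvar (k p, i p, i (\<sigma> p)))" if "\<sigma> \<in> perms r" for \<sigma>
    proof -
      have "i \<circ> \<sigma> \<in> tuples r" using words_comp_perm[OF i] that by simp
      moreover have "(\<Sum>j\<in>tuples r. pconst (c k \<sigma> * place_perm \<sigma> i j) * (\<Prod>p<r. pvar (k p, i p, j p)))
        = (\<Sum>j\<in>tuples r. if j = i \<circ> \<sigma> then pconst (c k \<sigma>) * (\<Prod>p<r. pvar (k p, i p, (i \<circ> \<sigma>) p)) else 0)"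
        by (intro sum.cong) (auto simp: place_perm_def hom_simps)
      ultimately show ?thesis by (simp del: PiE_UNIV_domain)
    qed
    thus ?thesis unfolding sum_distrib_right by (subst sum.swap) (intro sum.cong refl)
  qed
  have "f = (\<Sum>k\<in>words r K. \<Sum>i\<in>tuples r. \<Sum>j\<in>tuples r.
      pconst (a (zip_word r k (zip_word r i j))) * (\<Prod>p<r. pvar (k p, i p, j p)))"
    unfolding a(2) restitution_def UNIV_Times_UNIV[symmetric] sum_zip_word mon ..
  also have "\<dots> = (\<Sum>k\<in>words r K. \<Sum>\<sigma>\<in>perms r. pconst (c k \<sigma>) * trace_mon r k \<sigma>)"
    by (intro sum.cong refl) (simp add: c collapse pconst.sum trace_mon_def sum_distrib_left sum.swap[of _ "tuples r"])
  finally show ?thesis by blast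
qed

lemma ad_homogeneous_component:
  "ad Y f = 0 \<Longrightarrow> ad Y (homogeneous_component d f) = 0"
  using homogeneous_component_deriv_by[of 0 "ad_gen Y" d f, unfolded One_nat_def[symmetric],
      OF homogeneous_ad_gen] by simp

section \<open>Linear relations between place permutations\<close>

abbreviation word_of :: "nat \<Rightarrow> (nat \<Rightarrow> nat) \<Rightarrow> nat list" where
  "word_of N \<sigma> \<equiv> map \<sigma> [0..<N]"

lemma word_of_lessI:
  assumes "p < N" "\<sigma> p < \<tau> p" "\<And>q. q < p \<Longrightarrow> \<sigma> q = \<tau> q"
  shows "word_of N \<sigma> < word_of N \<tau>"
proof -
  have split: "word_of N f = map f [0..<p] @ f p # map f [Suc p..<N]" for f :: "nat \<Rightarrow> nat"
    using upt_add_eq_append[of 0 p "N - p"] upt_conv_Cons[of p N] assms(1) by simp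
  have prefix: "map \<sigma> [0..<p] = map \<tau> [0..<p]" using assms(3) by simp
  show ?thesis
    unfolding split list_less_def prefix by (intro lexord_append_leftI) (simp add: assms(2))
qed

lemma word_of_inj:
  assumes "\<sigma> permutes {..<N}" "\<tau> permutes {..<N}" "word_of N \<sigma> = word_of N \<tau>"
  shows "\<sigma> = \<tau>"
  using assms(3) permutes_not_in[OF assms(1)] permutes_not_in[OF assms(2)]
  by (auto simp: fun_eq_iff)

lemma perms_first_difference:
  fixes \<sigma> \<tau> :: "nat \<Rightarrow> nat"
  assumes \<sigma>: "\<sigma> permutes {..<N}" and \<tau>: "\<tau> permutes {..<N}" and "\<sigma> \<noteq> \<tau>"
  obtains p q where "p < q" "q < N" "\<tau> p = \<sigma> q" "\<And>r. r < p \<Longrightarrow> \<sigma> r = \<tau> r"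
proof -
  define p where "p = (LEAST p. \<sigma> p \<noteq> \<tau> p)"
  have "\<exists>p. \<sigma> p \<noteq> \<tau> p" using assms(3) by auto
  hence p: "\<sigma> p \<noteq> \<tau> p" unfolding p_def by (rule LeastI_ex)
  have below: "\<sigma> r = \<tau> r" if "r < p" for r using not_less_Least that unfolding p_def by blast
  have "p \<in> {..<N}" using p permutes_not_in[OF \<sigma>, of p] permutes_not_in[OF \<tau>, of p] by fastforce
  define q where "q = inv \<sigma> (\<tau> p)"
  have q: "\<tau> p = \<sigma> q" using permutes_inverses[OF \<sigma>] by (simp add: q_def)
  have "q < N"
    using \<open>p \<in> _\<close> permutes_in_image[OF permutes_inv[OF \<sigma>], of "\<tau> p"] permutes_in_image[OF \<tau>, of p] by (simp add: q_def)
  moreover have "\<not> q < p" using below[of q] q permutes_inj[OF \<tau>] by (metis injD less_irrefl)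
  moreover have "q \<noteq> p" using p q by auto
  ultimately show ?thesis using that[of p q] q below by simp
qed

definition decreasing_on :: "nat set \<Rightarrow> (nat \<Rightarrow> nat) \<Rightarrow> bool" where
  "decreasing_on Q \<sigma> \<longleftrightarrow> (\<forall>x\<in>Q. \<forall>y\<in>Q. x < y \<longrightarrow> \<sigma> y < \<sigma> x)"

lemma decreasing_on_insert_less_Min:
  assumes Q: "finite Q" "Q \<noteq> {}" "decreasing_on Q \<sigma>" and q: "q < Min Q" "\<sigma> (Min Q) < \<sigma> q"
  shows "decreasing_on (insert q Q) \<sigma>"
proof -
  have "q < x \<and> \<sigma> x < \<sigma> q" if "x \<in> Q" for x
  proof (cases "x = Min Q")
    case False
    hence "Min Q < x" using Q that by (simp add: le_neq_trans)
    moreover from this have "\<sigma> x < \<sigma> (Min Q)" using Q that by (auto simp: decreasing_on_def)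
    ultimately show ?thesis using q by simp
  qed (use q in simp)
  thus ?thesis using Q(3) unfolding decreasing_on_def by (metis insert_iff less_asym less_irrefl)
qed

text \<open>The left-to-right maxima form one colour class; a decreasing set avoiding them can be prolonged
  to the left.\<close>
lemma decreasing_or_colouring:
  assumes "finite A" "inj_on \<sigma> A"
  shows "(\<exists>Q\<subseteq>A. card Q = Suc n \<and> decreasing_on Q \<sigma>) \<or>
    (\<exists>f :: nat \<Rightarrow> nat. (\<forall>p\<in>A. f p < n) \<and> (\<forall>p\<in>A. \<forall>q\<in>A. p < q \<longrightarrow> f p = f q \<longrightarrow> \<sigma> p < \<sigma> q))"
  using assms
proof (induction n arbitrary: A)
  case 0
  thus ?case by (cases "A = {}") (auto simp: decreasing_on_def card_Suc_eq)
next
  case (Suc n)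
  define B where "B = {p\<in>A. \<exists>q\<in>A. q < p \<and> \<sigma> p < \<sigma> q}"
  have "B \<subseteq> A" by (auto simp: B_def)
  hence "finite B" "inj_on \<sigma> B" using Suc.prems finite_subset inj_on_subset by blast+
  from Suc.IH[OF this] show ?case
  proof (elim disjE exE conjE)
    fix Q assume Q: "Q \<subseteq> B" "card Q = Suc n" "decreasing_on Q \<sigma>"
    have fin: "finite Q" "Q \<noteq> {}" using Q(2) card_ge_0_finite by force+
    hence "Min Q \<in> B" using Q(1) Min_in by blast
    then obtain q where q: "q \<in> A" "q < Min Q" "\<sigma> (Min Q) < \<sigma> q" by (auto simp: B_def)
    have "q \<notin> Q" using q(2) Min_le[OF fin(1), of q] by (auto simp: not_le[symmetric])
    hence "insert q Q \<subseteq> A" "card (insert q Q) = Suc (Suc n)" using Q q(1) fin(1) \<open>B \<subseteq> A\<close> by auto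
    moreover have "decreasing_on (insert q Q) \<sigma>" by (rule decreasing_on_insert_less_Min[OF fin Q(3) q(2,3)])
    ultimately show ?thesis by blast
  next
    fix f :: "nat \<Rightarrow> nat"
    assume f: "\<forall>p\<in>B. f p < n" "\<forall>p\<in>B. \<forall>q\<in>B. p < q \<longrightarrow> f p = f q \<longrightarrow> \<sigma> p < \<sigma> q"
    let ?g = "\<lambda>p. if p \<in> B then f p else n"
    have maxima: "\<sigma> p < \<sigma> q" if "p \<in> A" "q \<in> A - B" "p < q" for p q
      using that Suc.prems(2) by (auto simp: B_def inj_on_eq_iff not_less le_less)
    have "\<sigma> p < \<sigma> q" if "p \<in> A" "q \<in> A" "p < q" "?g p = ?g q" for p q
    proof (cases "q \<in> B")
      case True
      hence "p \<in> B" using that(4) f(1) by (auto split: if_splits)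
      thus ?thesis using True that f(2) by simp
    qed (use that maxima in blast)
    moreover have "?g p < Suc n" for p using f(1) by (simp add: less_SucI)
    ultimately show ?thesis by (intro disjI2 exI[of _ ?g]) blast
  qed
qed

lemma word_of_comp_less:
  assumes \<sigma>: "\<sigma> permutes {..<N}" and Q: "Q \<subseteq> {..<N}" "decreasing_on Q \<sigma>"
    and \<pi>: "\<pi> permutes \<sigma> ` Q" "\<pi> \<noteq> id"
  shows "word_of N (\<pi> \<circ> \<sigma>) < word_of N \<sigma>"
proof -
  have "\<sigma> ` Q \<subseteq> {..<N}" using Q(1) permutes_image[OF \<sigma>] by blast
  hence "\<pi> \<circ> \<sigma> permutes {..<N}" using permutes_subset[OF \<pi>(1)] permutes_compose[OF \<sigma>] by blast
  moreover have "\<sigma> \<noteq> \<pi> \<circ> \<sigma>"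
    using \<pi>(2) permutes_surj[OF \<sigma>] by (metis eq_id_iff o_apply surjD)
  ultimately obtain p q where pq: "p < q" "q < N" "(\<pi> \<circ> \<sigma>) p = \<sigma> q" "\<And>r. r < p \<Longrightarrow> \<sigma> r = (\<pi> \<circ> \<sigma>) r"
    using perms_first_difference[OF \<sigma>] by metis
  have inj: "inj \<sigma>" by (rule permutes_inj[OF \<sigma>])
  have "\<pi> (\<sigma> p) \<noteq> \<sigma> p" using pq(1,3) inj by (auto dest: injD)
  hence "\<sigma> p \<in> \<sigma> ` Q" using \<pi>(1) permutes_not_in by fastforce
  moreover from this have "\<sigma> q \<in> \<sigma> ` Q" using permutes_in_image[OF \<pi>(1)] pq(3) by (metis o_apply)
  ultimately have "\<sigma> q < \<sigma> p"
    using Q(2) pq(1) inj by (auto simp: decreasing_on_def inj_image_mem_iff)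
  thus ?thesis using pq by (intro word_of_lessI[of p]) auto
qed

lemma alternating_sum_antisym:
  fixes F :: "(nat \<Rightarrow> 'x) \<Rightarrow> 'b::comm_ring_1"
  assumes "s \<in> S" "t \<in> S" "s \<noteq> t" "i s = i t" "finite S"
  shows "(\<Sum>\<pi> | \<pi> permutes S. of_int (sign \<pi>) * F (i \<circ> \<pi>)) = - (\<Sum>\<pi> | \<pi> permutes S. of_int (sign \<pi>) * F (i \<circ> \<pi>))"
proof -
  let ?t = "Transposition.transpose s t"
  have t: "?t permutes S" using assms by (intro permutes_swap_id) auto
  have it: "i \<circ> ?t = i" using assms(4) by (auto simp: fun_eq_iff Transposition.transpose_def)
  have "(\<Sum>\<pi> | \<pi> permutes S. of_int (sign \<pi>) * F (i \<circ> \<pi>))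
    = (\<Sum>\<pi> | \<pi> permutes S. of_int (sign (?t \<circ> \<pi>)) * F (i \<circ> (?t \<circ> \<pi>)))"
    by (rule setum_permutations_compose_left[OF t])
  also have "\<dots> = (\<Sum>\<pi> | \<pi> permutes S. - (of_int (sign \<pi>) * F (i \<circ> \<pi>)))"
  proof (rule sum.cong[OF refl])
    fix \<pi> assume "\<pi> \<in> {\<pi>. \<pi> permutes S}"
    hence "permutation \<pi>" using assms(5) by (auto simp: permutation_permutes)
    hence "sign (?t \<circ> \<pi>) = - sign \<pi>" using assms(3) by (simp add: sign_compose sign_swap_id permutation_swap_id)
    thus "of_int (sign (?t \<circ> \<pi>)) * F (i \<circ> (?t \<circ> \<pi>)) = - (of_int (sign \<pi>) * F (i \<circ> \<pi>))"
      using it by (simp flip: comp_assoc)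
  qed
  finally show ?thesis by (simp add: sum_negf)
qed

lemma alternating_sum_tuple_antisym:
  fixes i :: "nat \<Rightarrow> 'n::finite" and F :: "(nat \<Rightarrow> 'n) \<Rightarrow> 'b::comm_ring_1"
  assumes "card S = Suc CARD('n)"
  shows "(\<Sum>\<pi> | \<pi> permutes S. of_int (sign \<pi>) * F (i \<circ> \<pi>)) = - (\<Sum>\<pi> | \<pi> permutes S. of_int (sign \<pi>) * F (i \<circ> \<pi>))"
proof -
  have "card (i ` S) \<le> CARD('n)" by (intro card_mono) auto
  hence "\<not> inj_on i S" using assms by (auto dest: card_image)
  then obtain s t where st: "s \<in> S" "t \<in> S" "s \<noteq> t" "i s = i t" by (auto simp: inj_on_def)
  have "finite S" using assms by (intro card_ge_0_finite) simp
  thus ?thesis by (rule alternating_sum_antisym[OF st])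
qed

definition alt_coeff :: "nat set \<Rightarrow> (nat \<Rightarrow> nat) \<Rightarrow> (nat \<Rightarrow> nat) \<Rightarrow> 'a::comm_ring_1" where
  "alt_coeff S \<tau> \<sigma> = (\<Sum>\<pi> | \<pi> permutes S. if \<sigma> = \<pi> \<circ> \<tau> then of_int (sign \<pi>) else 0)"

lemma sum_alt_coeff:
  fixes \<psi> :: "'a::comm_ring_1 \<Rightarrow> (nat \<Rightarrow> nat) \<Rightarrow> 'b::comm_monoid_add"
  assumes "S \<subseteq> {..<N}" "\<tau> permutes {..<N}"
    and \<psi>: "\<And>\<sigma>. \<psi> 0 \<sigma> = 0" "\<And>a b \<sigma>. \<psi> (a + b) \<sigma> = \<psi> a \<sigma> + \<psi> b \<sigma>"
  shows "(\<Sum>\<sigma>\<in>perms N. \<psi> (alt_coeff S \<tau> \<sigma>) \<sigma>) = (\<Sum>\<pi> | \<pi> permutes S. \<psi> (of_int (sign \<pi>)) (\<pi> \<circ> \<tau>))"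
proof -
  have \<psi>_sum: "\<psi> (\<Sum>x\<in>X. f x) \<sigma> = (\<Sum>x\<in>X. \<psi> (f x) \<sigma>)" for X :: "(nat \<Rightarrow> nat) set" and f \<sigma>
    by (induction X rule: infinite_finite_induct) (auto simp: \<psi>)
  have "(\<Sum>\<sigma>\<in>perms N. \<psi> (alt_coeff S \<tau> \<sigma>) \<sigma>)
    = (\<Sum>\<pi> | \<pi> permutes S. \<Sum>\<sigma>\<in>perms N. if \<sigma> = \<pi> \<circ> \<tau> then \<psi> (of_int (sign \<pi>)) (\<pi> \<circ> \<tau>) else 0)"
    unfolding alt_coeff_def \<psi>_sum by (subst sum.swap) (intro sum.cong refl, simp add: \<psi>)
  also have "\<dots> = (\<Sum>\<pi> | \<pi> permutes S. \<psi> (of_int (sign \<pi>)) (\<pi> \<circ> \<tau>))"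
  proof (rule sum.cong[OF refl])
    fix \<pi> assume "\<pi> \<in> {\<pi>. \<pi> permutes S}"
    hence "\<pi> \<circ> \<tau> \<in> perms N" using permutes_subset[OF _ assms(1)] permutes_compose[OF assms(2)] by auto
    thus "(\<Sum>\<sigma>\<in>perms N. if \<sigma> = \<pi> \<circ> \<tau> then \<psi> (of_int (sign \<pi>)) (\<pi> \<circ> \<tau>) else 0) = \<psi> (of_int (sign \<pi>)) (\<pi> \<circ> \<tau>)"
      by simp
  qed
  finally show ?thesis .
qed

definition in_perm_kernel :: "'n::finite itself \<Rightarrow> nat \<Rightarrow> ((nat \<Rightarrow> nat) \<Rightarrow> 'a::field_char_0) \<Rightarrow> bool" where
  "in_perm_kernel _ N c \<longleftrightarrow>
    (\<forall>i\<in>tuples N. \<forall>j\<in>tuples N :: (nat \<Rightarrow> 'n) set. (\<Sum>\<sigma>\<in>perms N. c \<sigma> * place_perm \<sigma> i j) = 0)"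

lemma alt_coeff_in_perm_kernel:
  assumes "S \<subseteq> {..<N}" "card S = Suc CARD('n::finite)" "\<tau> permutes {..<N}"
  shows "in_perm_kernel TYPE('n) N (alt_coeff S \<tau> :: _ \<Rightarrow> 'a::field_char_0)"
  unfolding in_perm_kernel_def
proof (intro ballI)
  fix i j :: "nat \<Rightarrow> 'n"
  let ?F = "\<lambda>g. if j = g \<circ> \<tau> then 1 else (0::'a)"
  have "(\<Sum>\<sigma>\<in>perms N. alt_coeff S \<tau> \<sigma> * place_perm \<sigma> i j) = (\<Sum>\<pi> | \<pi> permutes S. of_int (sign \<pi>) * ?F (i \<circ> \<pi>))"
    by (subst sum_alt_coeff[OF assms(1,3)]) (simp_all add: distrib_right place_perm_def comp_assoc)
  moreover have "\<dots> = - \<dots>" by (rule alternating_sum_tuple_antisym[OF assms(2)])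
  ultimately show "(\<Sum>\<sigma>\<in>perms N. alt_coeff S \<tau> \<sigma> * place_perm \<sigma> i j) = (0::'a)" by simp
qed

lemma alt_coeff_decreasing:
  assumes \<sigma>: "\<sigma> permutes {..<N}" and Q: "Q \<subseteq> {..<N}" "decreasing_on Q \<sigma>"
  shows "alt_coeff (\<sigma> ` Q) \<sigma> \<sigma> = (1::'a::comm_ring_1)"
    and "alt_coeff (\<sigma> ` Q) \<sigma> \<tau> \<noteq> (0::'a) \<Longrightarrow> word_of N \<tau> \<le> word_of N \<sigma>"
proof -
  have fin: "finite (\<sigma> ` Q)" using finite_subset[OF Q(1)] by simp
  have "alt_coeff (\<sigma> ` Q) \<sigma> \<sigma> = (\<Sum>\<pi> | \<pi> permutes \<sigma> ` Q. if \<pi> = id then 1 else (0::'a))"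
    unfolding alt_coeff_def using word_of_comp_less[OF \<sigma> Q] by (intro sum.cong refl) (fastforce simp: sign_id)
  also have "\<dots> = 1" using finite_permutations[OF fin] by (simp add: permutes_id)
  finally show "alt_coeff (\<sigma> ` Q) \<sigma> \<sigma> = (1::'a)" .
  assume "alt_coeff (\<sigma> ` Q) \<sigma> \<tau> \<noteq> (0::'a)"
  then obtain \<pi> where "\<pi> permutes \<sigma> ` Q" "\<tau> = \<pi> \<circ> \<sigma>"
    unfolding alt_coeff_def by (auto elim!: sum.not_neutral_contains_not_neutral split: if_splits)
  thus "word_of N \<tau> \<le> word_of N \<sigma>" using word_of_comp_less[OF \<sigma> Q, of \<pi>] by (cases "\<pi> = id") auto
qed

lemma perm_kernel_coeff_eq_0:
  fixes c :: "(nat \<Rightarrow> nat) \<Rightarrow> 'a::field_char_0" and f :: "nat \<Rightarrow> nat"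
  assumes ker: "in_perm_kernel TYPE('n::finite) N c" and \<sigma>: "\<sigma> permutes {..<N}"
    and greatest: "\<And>\<tau>. \<tau> permutes {..<N} \<Longrightarrow> word_of N \<sigma> < word_of N \<tau> \<Longrightarrow> c \<tau> = 0"
    and f: "\<And>p. p < N \<Longrightarrow> f p < CARD('n)" "\<And>p q. p < q \<Longrightarrow> q < N \<Longrightarrow> f p = f q \<Longrightarrow> \<sigma> p < \<sigma> q"
  shows "c \<sigma> = 0"
proof -
  obtain e :: "nat \<Rightarrow> 'n" where e: "bij_betw e {..<CARD('n)} UNIV"
    using ex_bij_betw_nat_finite[of "UNIV :: 'n set"] by (auto simp: atLeast0LessThan)
  have e_eq: "f p = f q" if "e (f p) = e (f q)" "p < N" "q < N" for p q
    using that e f(1) by (meson bij_betw_imp_inj_on inj_onD lessThan_iff)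
  define j where "j = restrict (e \<circ> f) {..<N}"
  define i where "i = j \<circ> inv \<sigma>"
  have j: "j \<in> tuples N" by (simp add: j_def)
  have "(\<Sum>\<tau>\<in>perms N. c \<tau> * place_perm \<tau> i j) = 0"
    using ker j words_comp_perm[OF j permutes_inv[OF \<sigma>]] by (simp add: in_perm_kernel_def i_def)
  moreover have "c \<tau> * place_perm \<tau> i j = (if \<tau> = \<sigma> then c \<sigma> else 0)" if "\<tau> \<in> perms N" for \<tau>
  proof (cases "\<tau> = \<sigma>")
    case True
    thus ?thesis using permutes_inv_o(2)[OF \<sigma>] by (simp add: place_perm_def i_def comp_assoc)
  next
    case False
    have "c \<tau> = 0" if "j = i \<circ> \<tau>"
    proof -
      obtain p q where pq: "p < q" "q < N" "\<tau> p = \<sigma> q" "\<And>r. r < p \<Longrightarrow> \<sigma> r = \<tau> r"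
        using perms_first_difference[OF \<sigma>, of \<tau>] \<open>\<tau> \<in> perms N\<close> False by auto
      have "j p = j q" using fun_cong[OF that, of p] permutes_inverses[OF \<sigma>] by (simp add: i_def pq(3))
      hence "f p = f q" using pq(1,2) by (intro e_eq) (auto simp: j_def)
      hence "\<sigma> p < \<tau> p" using f(2)[OF pq(1,2)] pq(3) by simp
      hence "word_of N \<sigma> < word_of N \<tau>" using pq by (intro word_of_lessI[of p]) auto
      thus ?thesis using greatest \<open>\<tau> \<in> perms N\<close> by simp
    qed
    thus ?thesis using False by (auto simp: place_perm_def)
  qed
  ultimately have "(\<Sum>\<tau>\<in>perms N. if \<tau> = \<sigma> then c \<sigma> else 0) = 0" by simp
  thus ?thesis using \<sigma> by simp
qed

lemma perm_kernel_decreasing: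
  fixes c :: "(nat \<Rightarrow> nat) \<Rightarrow> 'a::field_char_0"
  assumes "in_perm_kernel TYPE('n::finite) N c" "\<sigma> permutes {..<N}" "c \<sigma> \<noteq> 0"
    and greatest: "\<And>\<tau>. \<tau> permutes {..<N} \<Longrightarrow> word_of N \<sigma> < word_of N \<tau> \<Longrightarrow> c \<tau> = 0"
  shows "\<exists>Q\<subseteq>{..<N}. card Q = Suc CARD('n) \<and> decreasing_on Q \<sigma>"
  using decreasing_or_colouring[OF finite_lessThan[of N] permutes_inj_on[OF assms(2)], of "CARD('n)"]
proof (elim disjE exE conjE)
  fix f :: "nat \<Rightarrow> nat"
  assume "\<forall>p\<in>{..<N}. f p < CARD('n)" "\<forall>p\<in>{..<N}. \<forall>q\<in>{..<N}. p < q \<longrightarrow> f p = f q \<longrightarrow> \<sigma> p < \<sigma> q"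
  hence "c \<sigma> = 0" by (intro perm_kernel_coeff_eq_0[OF assms(1,2) greatest, of f]) auto
  thus ?thesis using assms(3) by simp
qed blast

lemma in_perm_kernel_diff_mult:
  assumes "in_perm_kernel TYPE('n::finite) N c" "in_perm_kernel TYPE('n) N c'"
  shows "in_perm_kernel TYPE('n) N (\<lambda>\<sigma>. c \<sigma> - a * c' \<sigma>)"
  using assms unfolding in_perm_kernel_def
  by (simp add: left_diff_distrib sum_subtractf mult.assoc flip: sum_distrib_left)

text \<open>Alternating over the image of a long decreasing set replaces \<open>\<sigma>\<close> by smaller permutations.\<close>
lemma perm_kernel_straighten:
  fixes c :: "(nat \<Rightarrow> nat) \<Rightarrow> 'a::field_char_0"
  assumes ker: "in_perm_kernel TYPE('n::finite) N c" and \<sigma>: "\<sigma> permutes {..<N}" "c \<sigma> \<noteq> 0"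
    and greatest: "\<And>\<tau>. \<tau> permutes {..<N} \<Longrightarrow> c \<tau> \<noteq> 0 \<Longrightarrow> word_of N \<tau> \<le> word_of N \<sigma>"
  obtains S where "S \<subseteq> {..<N}" "card S = Suc CARD('n)"
    "in_perm_kernel TYPE('n) N (\<lambda>\<tau>. c \<tau> - c \<sigma> * alt_coeff S \<sigma> \<tau>)"
    "\<And>\<tau>. \<tau> permutes {..<N} \<Longrightarrow> c \<tau> - c \<sigma> * alt_coeff S \<sigma> \<tau> \<noteq> 0 \<Longrightarrow> word_of N \<tau> < word_of N \<sigma>"
proof -
  have "c \<tau> = 0" if "\<tau> permutes {..<N}" "word_of N \<sigma> < word_of N \<tau>" for \<tau>
    using greatest[of \<tau>] that by (auto simp: not_le[symmetric])
  from perm_kernel_decreasing[OF ker \<sigma> this]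
  obtain Q where Q: "Q \<subseteq> {..<N}" "card Q = Suc CARD('n)" "decreasing_on Q \<sigma>" by blast
  have S: "\<sigma> ` Q \<subseteq> {..<N}" "card (\<sigma> ` Q) = Suc CARD('n)"
    using Q(1,2) permutes_image[OF \<sigma>(1)] card_image[OF permutes_inj_on[OF \<sigma>(1)]] by auto
  have "word_of N \<tau> < word_of N \<sigma>"
    if \<tau>: "\<tau> permutes {..<N}" and nz: "c \<tau> - c \<sigma> * alt_coeff (\<sigma> ` Q) \<sigma> \<tau> \<noteq> 0" for \<tau>
  proof -
    have "\<tau> \<noteq> \<sigma>" using nz by (auto simp: alt_coeff_decreasing(1)[OF \<sigma>(1) Q(1,3)])
    hence "word_of N \<tau> \<noteq> word_of N \<sigma>" using word_of_inj[OF \<tau> \<sigma>(1)] by blast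
    moreover have "word_of N \<tau> \<le> word_of N \<sigma>"
      using nz greatest[OF \<tau>] alt_coeff_decreasing(2)[OF \<sigma>(1) Q(1,3), where 'a = 'a]
      by (cases "c \<tau> = 0") auto
    ultimately show ?thesis by (rule order.not_eq_order_implies_strict)
  qed
  thus ?thesis
    using that[OF S] in_perm_kernel_diff_mult[OF ker alt_coeff_in_perm_kernel[OF S \<sigma>(1)]] by blast
qed

theorem perm_kernel_induct [consumes 1, case_names zero alt]:
  fixes c :: "(nat \<Rightarrow> nat) \<Rightarrow> 'a::field_char_0"
  assumes "in_perm_kernel TYPE('n::finite) N c"
    and zero: "\<And>c. (\<And>\<sigma>. \<sigma> permutes {..<N} \<Longrightarrow> c \<sigma> = 0) \<Longrightarrow> P c"
    and alt: "\<And>c a S \<tau>. P c \<Longrightarrow> S \<subseteq> {..<N} \<Longrightarrow> card S = Suc CARD('n) \<Longrightarrow> \<tau> permutes {..<N} \<Longrightarrow>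
      P (\<lambda>\<sigma>. c \<sigma> + a * alt_coeff S \<tau> \<sigma>)"
  shows "P c"
  using assms(1)
proof (induction "card {\<tau>\<in>perms N. \<exists>\<sigma>\<in>perms N. c \<sigma> \<noteq> 0 \<and> word_of N \<tau> \<le> word_of N \<sigma>}" arbitrary: c rule: less_induct)
  case less
  let ?low = "\<lambda>c :: (nat \<Rightarrow> nat) \<Rightarrow> 'a. {\<tau>\<in>perms N. \<exists>\<sigma>\<in>perms N. c \<sigma> \<noteq> 0 \<and> word_of N \<tau> \<le> word_of N \<sigma>}"
  let ?supp = "{\<sigma>\<in>perms N. c \<sigma> \<noteq> 0}"
  show ?case
  proof (cases "?supp = {}")
    case True
    thus ?thesis by (intro zero) auto
  next
    case False
    hence "Max (word_of N ` ?supp) \<in> word_of N ` ?supp" by (intro Max_in) auto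
    then obtain \<sigma> where \<sigma>: "\<sigma> permutes {..<N}" "c \<sigma> \<noteq> 0" and Max: "Max (word_of N ` ?supp) = word_of N \<sigma>" by auto
    have greatest: "word_of N \<tau> \<le> word_of N \<sigma>" if "\<tau> permutes {..<N}" "c \<tau> \<noteq> 0" for \<tau>
      unfolding Max[symmetric] using that by (intro Max_ge) auto
    obtain S where S: "S \<subseteq> {..<N}" "card S = Suc CARD('n)"
      and ker: "in_perm_kernel TYPE('n) N (\<lambda>\<tau>. c \<tau> - c \<sigma> * alt_coeff S \<sigma> \<tau>)" (is "in_perm_kernel _ _ ?c'")
      and smaller: "\<And>\<tau>. \<tau> permutes {..<N} \<Longrightarrow> c \<tau> - c \<sigma> * alt_coeff S \<sigma> \<tau> \<noteq> 0 \<Longrightarrow> word_of N \<tau> < word_of N \<sigma>"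
      using perm_kernel_straighten[OF less.prems \<sigma> greatest] by blast
    have "?low ?c' \<subseteq> ?low c"
    proof
      fix \<tau> assume "\<tau> \<in> ?low ?c'"
      then obtain \<rho> where "\<tau> \<in> perms N" "word_of N \<tau> \<le> word_of N \<rho>" "word_of N \<rho> < word_of N \<sigma>"
        using smaller by blast
      thus "\<tau> \<in> ?low c" using \<sigma> by (auto intro: less_imp_le[OF order.strict_trans1])
    qed
    moreover have "\<sigma> \<in> ?low c" using \<sigma> by auto
    moreover have "\<sigma> \<notin> ?low ?c'" using smaller by (auto simp: not_le)
    ultimately have "card (?low ?c') < card (?low c)" by (intro psubset_card_mono) auto
    hence "P ?c'" using ker by (rule less.hyps)
    from alt[OF this S \<sigma>(1), of "c \<sigma>"] show ?thesis by simp
  qed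
qed

section \<open>Traces along the cycles of a permutation\<close>

definition is_cycle :: "(nat \<Rightarrow> nat) \<Rightarrow> nat list \<Rightarrow> bool" where
  "is_cycle \<sigma> l \<longleftrightarrow> l \<noteq> [] \<and> distinct l \<and> map \<sigma> l = rotate1 l"

lemma is_cycle_rotate: "is_cycle \<sigma> l \<Longrightarrow> is_cycle \<sigma> (rotate j l)"
  by (simp add: is_cycle_def rotate1_rotate_swap flip: rotate_map)

lemma is_cycle_append_commute: "is_cycle \<sigma> (xs @ ys) \<Longrightarrow> is_cycle \<sigma> (ys @ xs)"
  using is_cycle_rotate[of \<sigma> "xs @ ys" "length xs"] by (simp add: rotate_append)

lemma is_cycle_cong: "is_cycle \<sigma> l \<Longrightarrow> (\<And>x. x \<in> set l \<Longrightarrow> \<sigma> x = \<tau> x) \<Longrightarrow> is_cycle \<tau> l"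
  unfolding is_cycle_def using map_cong[OF refl, of l \<sigma> \<tau>] by simp

lemma is_cycle_image_set: "is_cycle \<sigma> l \<Longrightarrow> \<sigma> ` set l = set l"
  by (metis is_cycle_def set_map set_rotate1)

lemma is_cycle_funpow:
  assumes "is_cycle \<sigma> l"
  shows "(\<sigma> ^^ j) (hd l) = l ! (j mod length l)"
proof -
  have "map (\<sigma> ^^ j) l = rotate j l" for j
  proof (induction j)
    case (Suc j)
    have "map (\<sigma> ^^ Suc j) l = map \<sigma> (map (\<sigma> ^^ j) l)" by simp
    also have "\<dots> = rotate (Suc j) l"
      unfolding Suc using assms by (simp add: is_cycle_def rotate1_rotate_swap flip: rotate_map)
    finally show ?case .
  qed simp
  hence "(\<sigma> ^^ j) (hd l) = hd (rotate j l)" using assms by (metis hd_map is_cycle_def)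
  thus ?thesis using assms by (simp add: is_cycle_def hd_rotate_conv_nth)
qed

lemma orb_cycle:
  assumes "is_cycle \<sigma> l"
  shows "orb \<sigma> (hd l) = set l"
proof -
  have l: "l \<noteq> []" using assms by (simp add: is_cycle_def)
  have "x \<in> range (\<lambda>j. l ! (j mod length l))" if "x \<in> set l" for x
  proof -
    from that obtain i where "i < length l" "l ! i = x" by (auto simp: in_set_conv_nth)
    thus ?thesis by (intro range_eqI[of _ _ i]) simp
  qed
  moreover have "l ! (j mod length l) \<in> set l" for j using l by (intro nth_mem) simp
  ultimately show ?thesis unfolding orb_def is_cycle_funpow[OF assms] by blast
qed

lemma cycword_cycle:
  assumes "is_cycle \<sigma> l"
  shows "cycword \<sigma> (hd l) = l"
proof -
  have "card (set l) = length l" using assms by (simp add: is_cycle_def distinct_card)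
  thus ?thesis
    unfolding cycword_def orb_cycle[OF assms] is_cycle_funpow[OF assms] by (intro nth_equalityI) auto
qed

lemma ex_is_cycle:
  assumes "permutation \<sigma>"
  obtains l where "is_cycle \<sigma> l" "hd l = d"
proof -
  let ?n = "least_power \<sigma> d"
  have n: "(\<sigma> ^^ ?n) d = d" "0 < ?n" using least_power_of_permutation[OF assms] by auto
  have "map \<sigma> (support \<sigma> d) = map (\<lambda>i. (\<sigma> ^^ i) d) (map Suc [0..<?n])" by simp
  also have "\<dots> = map (\<lambda>i. (\<sigma> ^^ i) d) ([1..<?n] @ [?n])" using n(2) by (simp add: map_Suc_upt)
  also have "\<dots> = rotate1 (support \<sigma> d)" using n by (simp add: upt_conv_Cons)
  finally have "is_cycle \<sigma> (support \<sigma> d)"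
    using cycle_of_permutation[OF assms, of d] n(2) by (simp add: is_cycle_def)
  moreover have "hd (support \<sigma> d) = d" using n(2) by (simp add: hd_map)
  ultimately show ?thesis using that by blast
qed

lemma is_cycle_cycword:
  assumes "permutation \<sigma>"
  shows "is_cycle \<sigma> (cycword \<sigma> d)" "hd (cycword \<sigma> d) = d" "set (cycword \<sigma> d) = orb \<sigma> d"
proof -
  obtain l where l: "is_cycle \<sigma> l" "hd l = d" by (rule ex_is_cycle[OF assms])
  have "cycword \<sigma> d = l" "orb \<sigma> d = set l" using cycword_cycle[OF l(1)] orb_cycle[OF l(1)] l(2) by auto
  thus "is_cycle \<sigma> (cycword \<sigma> d)" "hd (cycword \<sigma> d) = d" "set (cycword \<sigma> d) = orb \<sigma> d" using l by auto
qed

lemma self_in_orb [simp]: "x \<in> orb \<sigma> x"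
  unfolding orb_def by (metis funpow_0 rangeI)

lemma orb_eq:
  assumes "permutation \<sigma>" "y \<in> orb \<sigma> x"
  shows "orb \<sigma> y = orb \<sigma> x"
proof -
  obtain l where l: "is_cycle \<sigma> l" "hd l = x" by (rule ex_is_cycle[OF assms(1)])
  have "y \<in> set l" using assms(2) orb_cycle[OF l(1)] l(2) by simp
  then obtain us vs where "l = us @ y # vs" by (metis split_list)
  hence "is_cycle \<sigma> (y # vs @ us)" using is_cycle_append_commute[of \<sigma> us "y # vs"] l(1) by simp
  from orb_cycle[OF this] show ?thesis using orb_cycle[OF l(1)] l(2) \<open>l = us @ y # vs\<close> by auto
qed

lemma orb_subset:
  assumes "\<sigma> permutes A" "x \<in> A"
  shows "orb \<sigma> x \<subseteq> A"
proof -
  have "(\<sigma> ^^ j) x \<in> A" for j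
    by (induction j) (use assms(2) permutes_in_image[OF assms(1)] in auto)
  thus ?thesis by (auto simp: orb_def)
qed

definition bypass :: "nat \<Rightarrow> (nat \<Rightarrow> nat) \<Rightarrow> nat \<Rightarrow> nat" where
  "bypass p \<sigma> x = (if x = p then p else if \<sigma> x = p then \<sigma> p else \<sigma> x)"

lemma bypass_permutes:
  assumes "\<sigma> permutes A" "p \<in> A"
  shows "bypass p \<sigma> permutes (A - {p})"
proof -
  have "bypass p \<sigma> = Transposition.transpose p (\<sigma> p) \<circ> \<sigma>"
    using permutes_inj[OF assms(1)] by (auto simp: fun_eq_iff bypass_def Transposition.transpose_def dest: injD)
  moreover have "Transposition.transpose p (\<sigma> p) permutes A"
    using assms permutes_in_image[OF assms(1), of p] by (intro permutes_swap_id) auto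
  ultimately have "bypass p \<sigma> permutes A" using permutes_compose[OF assms(1)] by simp
  thus ?thesis by (rule permutes_superset) (auto simp: bypass_def)
qed

lemma bypass_comp:
  assumes "inj \<pi>" "\<pi> p = p"
  shows "bypass p (\<pi> \<circ> \<tau>) = \<pi> \<circ> bypass p \<tau>"
proof -
  have "\<pi> x = p \<longleftrightarrow> x = p" for x using assms by (metis injD)
  thus ?thesis by (simp add: fun_eq_iff bypass_def assms(2))
qed

lemma is_cycle_bypass_Cons:
  assumes "is_cycle \<sigma> (q # p # zs)"
  shows "is_cycle (bypass p \<sigma>) (q # zs)"
proof -
  have p: "\<sigma> q = p" "map \<sigma> (p # zs) = zs @ [q]" "distinct (q # p # zs)"
    using assms by (auto simp: is_cycle_def)
  have "\<sigma> ` set (p # zs) = set (zs @ [q])" using arg_cong[OF p(2), of set] by (simp only: set_map)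
  hence "bypass p \<sigma> y = \<sigma> y" if "y \<in> set zs" for y using that p(3) by (force simp: bypass_def)
  hence zs: "map (bypass p \<sigma>) zs = map \<sigma> zs" by simp
  have "bypass p \<sigma> q = \<sigma> p" using p by (simp add: bypass_def)
  thus ?thesis unfolding is_cycle_def list.map zs using p by simp
qed

lemma is_cycle_bypass:
  assumes "is_cycle \<sigma> (xs @ q # p # ys)"
  shows "is_cycle (bypass p \<sigma>) (xs @ q # ys)"
proof -
  have "is_cycle \<sigma> (q # p # ys @ xs)" using is_cycle_append_commute[OF assms] by simp
  from is_cycle_append_commute[of _ "q # ys" xs] is_cycle_bypass_Cons[OF this] show ?thesis by simp
qed

lemma is_cycle_bypass_disjoint:
  assumes "is_cycle \<sigma> l" "p \<notin> set l"
  shows "is_cycle (bypass p \<sigma>) l"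
proof (rule is_cycle_cong[OF assms(1)])
  fix x assume "x \<in> set l"
  moreover from this have "\<sigma> x \<in> set l" using is_cycle_image_set[OF assms(1)] by blast
  ultimately show "\<sigma> x = bypass p \<sigma> x" using assms(2) by (auto simp: bypass_def)
qed

text \<open>For a permutation \<open>\<sigma>\<close> of \<open>B\<close> this is the product over the cycles of \<open>\<sigma>\<close> of the traces of
  the products of the matrices along the cycles.\<close>
definition index_trace :: "(nat \<Rightarrow> 'b::comm_ring_1^'n::finite^'n) \<Rightarrow> (nat \<Rightarrow> nat) \<Rightarrow> nat set \<Rightarrow> 'b" where
  "index_trace Y \<sigma> B = (\<Sum>i\<in>PiE B (\<lambda>_. UNIV). \<Prod>p\<in>B. Y p $ i p $ i (\<sigma> p))"

lemma sum_PiE_insert: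
  assumes "p \<notin> B"
  shows "(\<Sum>i\<in>PiE (insert p B) (\<lambda>_. X). F i) = (\<Sum>i\<in>PiE B (\<lambda>_. X). \<Sum>x\<in>X. F (i(p := x)))"
proof -
  have "(\<Sum>i\<in>PiE (insert p B) (\<lambda>_. X). F i) = (\<Sum>y\<in>X \<times> PiE B (\<lambda>_. X). F ((snd y)(p := fst y)))"
    unfolding PiE_insert_eq
    by (subst sum.reindex[OF inj_combinator[OF assms]]) (simp add: split_def)
  also have "\<dots> = (\<Sum>x\<in>X. \<Sum>i\<in>PiE B (\<lambda>_. X). F (i(p := x)))" by (simp add: sum.cartesian_product split_def)
  also have "\<dots> = (\<Sum>i\<in>PiE B (\<lambda>_. X). \<Sum>x\<in>X. F (i(p := x)))" by (rule sum.swap)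
  finally show ?thesis .
qed

lemma index_trace_cong:
  assumes "\<And>p. p \<in> B \<Longrightarrow> Y p = Y' p" "\<And>p. p \<in> B \<Longrightarrow> \<sigma> p = \<sigma>' p"
  shows "index_trace Y \<sigma> B = index_trace Y' \<sigma>' B"
  unfolding index_trace_def using assms by simp

lemma index_trace_bypass:
  assumes fin: "finite B" and pq: "p \<in> B" "q \<in> B" "\<sigma> q = p" "\<sigma> p \<noteq> p" and inj: "inj \<sigma>"
  shows "index_trace Y \<sigma> B = index_trace (Y(q := Y q ** Y p)) (bypass p \<sigma>) (B - {p})"
proof -
  define C where "C = B - {p, q}"
  have qp: "q \<noteq> p" using pq by auto
  have B: "B = insert p (insert q C)" "B - {p} = insert q C" "p \<notin> insert q C" "q \<notin> C" "finite C"
    using pq qp fin by (auto simp: C_def)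
  have C: "y \<noteq> p" "y \<noteq> q" "\<sigma> y \<noteq> p" if "y \<in> C" for y
    using that pq(3) injD[OF inj, of y q] by (auto simp: C_def)
  let ?rest = "\<lambda>i. \<Prod>y\<in>C. Y y $ i y $ i (\<sigma> y)"
  have "index_trace Y \<sigma> B = (\<Sum>i\<in>PiE (insert q C) (\<lambda>_. UNIV). \<Sum>x\<in>UNIV.
      \<Prod>y\<in>insert p (insert q C). Y y $ (i(p := x)) y $ (i(p := x)) (\<sigma> y))"
    unfolding index_trace_def B(1) by (rule sum_PiE_insert[OF B(3)])
  also have "\<dots> = (\<Sum>i\<in>PiE (insert q C) (\<lambda>_. UNIV). (Y q ** Y p) $ i q $ i (\<sigma> p) * ?rest i)"
  proof (rule sum.cong[OF refl])
    fix i
    have "(\<Prod>y\<in>C. Y y $ (i(p := x)) y $ (i(p := x)) (\<sigma> y)) = ?rest i" for x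
      using C by (intro prod.cong) auto
    thus "(\<Sum>x\<in>UNIV. \<Prod>y\<in>insert p (insert q C). Y y $ (i(p := x)) y $ (i(p := x)) (\<sigma> y))
      = (Y q ** Y p) $ i q $ i (\<sigma> p) * ?rest i"
      using B(3-5) pq(3,4) qp by (simp add: matrix_matrix_mult_def sum_distrib_left mult_ac)
  qed
  also have "\<dots> = index_trace (Y(q := Y q ** Y p)) (bypass p \<sigma>) (B - {p})"
    unfolding index_trace_def B(2)
  proof (rule sum.cong[OF refl])
    fix i
    have "(\<Prod>y\<in>C. (Y(q := Y q ** Y p)) y $ i y $ i (bypass p \<sigma> y)) = ?rest i"
      using C by (intro prod.cong) (auto simp: bypass_def)
    thus "(Y q ** Y p) $ i q $ i (\<sigma> p) * ?rest i
      = (\<Prod>y\<in>insert q C. (Y(q := Y q ** Y p)) y $ i y $ i (bypass p \<sigma> y))"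
      using B(4,5) qp by (simp add: bypass_def pq(3))
  qed
  finally show ?thesis .
qed

lemma index_trace_bypass_outside:
  assumes inj: "inj \<sigma>" and "\<sigma> q = p" "p \<notin> B" "q \<notin> B" and Y: "\<And>y. y \<in> B \<Longrightarrow> Y' y = Y y"
  shows "index_trace Y' (bypass p \<sigma>) B = index_trace Y \<sigma> B"
proof (rule index_trace_cong[OF Y])
  fix y assume y: "y \<in> B"
  hence "\<sigma> y \<noteq> \<sigma> q" using assms(4) by (auto simp: inj_eq[OF inj])
  thus "bypass p \<sigma> y = \<sigma> y" using y assms(2,3) by (auto simp: bypass_def)
qed

lemma index_trace_fixed:
  assumes "finite B" "p \<in> B" "\<sigma> p = p" "inj \<sigma>"
  shows "index_trace Y \<sigma> B = trace (Y p) * index_trace Y \<sigma> (B - {p})"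
proof -
  define C where "C = B - {p}"
  have B: "B = insert p C" "p \<notin> C" "finite C" using assms by (auto simp: C_def)
  have "(\<Prod>y\<in>C. Y y $ (i(p := x)) y $ (i(p := x)) (\<sigma> y)) = (\<Prod>y\<in>C. Y y $ i y $ i (\<sigma> y))" for i x
    using B(2) injD[OF assms(4), of _ p] assms(3) by (intro prod.cong) auto
  hence "index_trace Y \<sigma> B = (\<Sum>i\<in>PiE C (\<lambda>_. UNIV). \<Sum>x\<in>UNIV. Y p $ x $ x * (\<Prod>y\<in>C. Y y $ i y $ i (\<sigma> y)))"
    unfolding index_trace_def B(1) sum_PiE_insert[OF B(2)] using B(2,3) assms(3) by simp
  also have "\<dots> = trace (Y p) * index_trace Y \<sigma> C"
    unfolding index_trace_def trace_def sum_product by (rule sum.swap)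
  finally show ?thesis by (simp add: C_def)
qed

lemma wordmat_append: "wordmat Y (u @ v) = wordmat Y u ** wordmat Y v"
  by (induction u) (auto simp: matrix_mul_assoc)

lemma wordmat_cong: "(\<And>p. p \<in> set l \<Longrightarrow> Y p = Y' p) \<Longrightarrow> wordmat Y l = wordmat Y' l"
  by (induction l) auto

lemma wordmat_concat: "wordmat Y (concat (map u w)) = wordmat (\<lambda>k. wordmat Y (u k)) w"
  by (induction w) (auto simp: wordmat_append)

lemma index_trace_cycle:
  assumes "is_cycle \<sigma> l" "finite B" "set l \<subseteq> B" "\<sigma> permutes A" "B \<subseteq> A"
  shows "index_trace Y \<sigma> B = trace (wordmat Y l) * index_trace Y \<sigma> (B - set l)"
  using assms
proof (induction "length l" arbitrary: l B \<sigma> Y A rule: less_induct)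
  case less
  note cyc = less.prems(1) and B = less.prems(2,3,5) and \<sigma> = less.prems(4)
  have inj: "inj \<sigma>" by (rule permutes_inj[OF \<sigma>])
  consider x where "l = [x]" | x p ys where "l = x # p # ys"
    using cyc by (cases l rule: remdups_adj.cases) (auto simp: is_cycle_def)
  thus ?case
  proof cases
    case (1 x)
    thus ?thesis using index_trace_fixed[of B x \<sigma> Y] inj cyc B by (simp add: is_cycle_def)
  next
    case (2 x p ys)
    have x: "\<sigma> x = p" "x \<noteq> p" "x \<notin> set ys" "p \<notin> set ys" using cyc by (auto simp: 2 is_cycle_def)
    hence "\<sigma> p \<noteq> p" using inj by (metis injD)
    define Y' where "Y' = Y(x := Y x ** Y p)"
    have "index_trace Y \<sigma> B = index_trace Y' (bypass p \<sigma>) (B - {p})"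
      unfolding Y'_def using B x(1) \<open>\<sigma> p \<noteq> p\<close> inj by (intro index_trace_bypass) (auto simp: 2)
    also have "\<dots> = trace (wordmat Y' (x # ys)) * index_trace Y' (bypass p \<sigma>) (B - {p} - set (x # ys))"
    proof (rule less.hyps)
      show "is_cycle (bypass p \<sigma>) (x # ys)" using is_cycle_bypass_Cons cyc by (simp add: 2)
      show "bypass p \<sigma> permutes A - {p}" using bypass_permutes[OF \<sigma>] B by (auto simp: 2)
    qed (use B x in \<open>auto simp: 2\<close>)
    also have "wordmat Y' (x # ys) = wordmat Y l"
    proof -
      have "wordmat Y' ys = wordmat Y ys" using x by (intro wordmat_cong) (auto simp: Y'_def)
      thus ?thesis by (simp add: 2 Y'_def matrix_mul_assoc)
    qed
    also have "B - {p} - set (x # ys) = B - set l" by (auto simp: 2)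
    also have "index_trace Y' (bypass p \<sigma>) (B - set l) = index_trace Y \<sigma> (B - set l)"
      by (rule index_trace_bypass_outside[OF inj x(1)]) (auto simp: 2 Y'_def)
    finally show ?thesis .
  qed
qed

lemma index_trace_Union_orbits:
  assumes \<sigma>: "\<sigma> permutes A" "finite A" and "finite \<C>" "\<C> \<subseteq> orb \<sigma> ` A"
  shows "index_trace Y \<sigma> (\<Union>\<C>) = (\<Prod>C\<in>\<C>. trace (wordmat Y (cycword \<sigma> (Min C))))"
  using assms(3,4)
proof (induction \<C> rule: finite_induct)
  case empty
  show ?case by (simp add: index_trace_def)
next
  case (insert C \<C>)
  have perm: "permutation \<sigma>" by (rule permutes_imp_permutation[OF \<sigma>(2,1)])
  obtain x where x: "x \<in> A" "C = orb \<sigma> x" using insert.prems by blast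
  have sub: "\<Union>(insert C \<C>) \<subseteq> A" using insert.prems orb_subset[OF \<sigma>(1)] by blast
  hence fin: "finite (\<Union>(insert C \<C>))" using \<sigma>(2) finite_subset by blast
  have "C \<noteq> {}" using x(2) self_in_orb by blast
  hence "Min C \<in> orb \<sigma> x" using Min_in[of C] fin x(2) by simp
  hence C: "orb \<sigma> (Min C) = C" using orb_eq[OF perm] x(2) by simp
  have "z \<notin> C" if D: "D \<in> \<C>" "z \<in> D" for z D
  proof
    assume "z \<in> C"
    obtain y where "D = orb \<sigma> y" using insert.prems D(1) by auto
    hence "D = C" using orb_eq[OF perm, of z x] orb_eq[OF perm, of z y] D(2) \<open>z \<in> C\<close> x(2) by simp
    thus False using insert.hyps(2) D(1) by simp
  qed
  hence disj: "\<Union>(insert C \<C>) - C = \<Union>\<C>" by auto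
  have "index_trace Y \<sigma> (\<Union>(insert C \<C>))
    = trace (wordmat Y (cycword \<sigma> (Min C))) * index_trace Y \<sigma> (\<Union>(insert C \<C>) - C)"
    using index_trace_cycle[OF is_cycle_cycword(1)[OF perm, of "Min C"] fin _ \<sigma>(1) sub, of Y]
    by (auto simp: is_cycle_cycword(3)[OF perm] C)
  thus ?case unfolding disj using insert by simp
qed

lemma index_trace_cycles:
  assumes "\<sigma> permutes {0..n}"
  shows "index_trace Y \<sigma> ({0..n} - orb \<sigma> n)
    = (\<Prod>C\<in>{orb \<sigma> i | i. i < n \<and> n \<notin> orb \<sigma> i}. trace (wordmat Y (cycword \<sigma> (Min C))))"
proof -
  let ?\<C> = "{orb \<sigma> i | i. i < n \<and> n \<notin> orb \<sigma> i}"
  have perm: "permutation \<sigma>" by (rule permutes_imp_permutation[OF finite_atLeastAtMost assms])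
  have "{0..n} - orb \<sigma> n = \<Union>?\<C>"
  proof (intro equalityI subsetI)
    fix x assume x: "x \<in> {0..n} - orb \<sigma> n"
    have "n \<notin> orb \<sigma> x" using x orb_eq[OF perm, of n x] self_in_orb[of x \<sigma>] by (metis DiffD2)
    moreover have "x \<noteq> n" using x self_in_orb[of n \<sigma>] by blast
    hence "x < n" using x by simp
    ultimately have "orb \<sigma> x \<in> ?\<C>" by blast
    thus "x \<in> \<Union>?\<C>" using self_in_orb by (rule UnionI)
  next
    fix x assume "x \<in> \<Union>?\<C>"
    then obtain i where i: "i < n" "n \<notin> orb \<sigma> i" "x \<in> orb \<sigma> i" by (elim UnionE CollectE exE conjE) simp
    have "x \<notin> orb \<sigma> n"
      using i(2) orb_eq[OF perm i(3)] orb_eq[OF perm, of x n] self_in_orb[of n \<sigma>] by auto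
    moreover have "x \<in> {0..n}" using orb_subset[OF assms, of i] i(1,3) by auto
    ultimately show "x \<in> {0..n} - orb \<sigma> n" by simp
  qed
  moreover have "finite ?\<C>" by simp
  moreover have "?\<C> \<subseteq> orb \<sigma> ` {0..n}" by fastforce
  ultimately show ?thesis by (simp only: index_trace_Union_orbits[OF assms finite_atLeastAtMost])
qed

section \<open>Alternating sums and the Cayley--Hamilton quasi-polynomial\<close>

lemma qmul_superset:
  assumes "finite K" "finite L" "Poly_Mapping.keys p \<subseteq> K" "Poly_Mapping.keys q \<subseteq> L"
  shows "qmul p q = (\<Sum>u\<in>K. \<Sum>v\<in>L. Poly_Mapping.single (u @ v) (Poly_Mapping.lookup p u * Poly_Mapping.lookup q v))"
proof -
  have "qmul p q = (\<Sum>u\<in>Poly_Mapping.keys p. \<Sum>v\<in>L.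
      Poly_Mapping.single (u @ v) (Poly_Mapping.lookup p u * Poly_Mapping.lookup q v))"
    unfolding qmul_def using assms by (intro sum.cong refl sum.mono_neutral_left) (auto simp: in_keys_iff)
  also have "\<dots> = (\<Sum>u\<in>K. \<Sum>v\<in>L. Poly_Mapping.single (u @ v) (Poly_Mapping.lookup p u * Poly_Mapping.lookup q v))"
    using assms by (intro sum.mono_neutral_left) (auto simp: in_keys_iff intro!: sum.neutral)
  finally show ?thesis .
qed

lemma qmul_single: "qmul (Poly_Mapping.single u a) (Poly_Mapping.single v b) = Poly_Mapping.single (u @ v) (a * b)"
  by (subst qmul_superset[of "{u}" "{v}"]) auto

lemma qmul_add_left: "qmul (p + p') q = qmul p q + qmul p' q"
proof -
  let ?K = "Poly_Mapping.keys p \<union> Poly_Mapping.keys p'"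
  have "Poly_Mapping.keys (p + p') \<subseteq> ?K" by (rule keys_add)
  thus ?thesis
    by (subst (1 2 3) qmul_superset[of ?K "Poly_Mapping.keys q"])
      (auto simp: lookup_add distrib_right single_add sum.distrib)
qed

lemma qmul_add_right: "qmul p (q + q') = qmul p q + qmul p q'"
proof -
  let ?K = "Poly_Mapping.keys q \<union> Poly_Mapping.keys q'"
  have "Poly_Mapping.keys (q + q') \<subseteq> ?K" by (rule keys_add)
  thus ?thesis
    by (subst (1 2 3) qmul_superset[of "Poly_Mapping.keys p" ?K])
      (auto simp: lookup_add distrib_left single_add sum.distrib)
qed

lemma qmul_0 [simp]: "qmul 0 q = 0" "qmul p 0 = 0"
  by (auto simp: qmul_def)

lemma qmul_sum_left: "qmul (\<Sum>x\<in>X. f x) q = (\<Sum>x\<in>X. qmul (f x) q)"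
  by (induction X rule: infinite_finite_induct) (auto simp: qmul_add_left)

lemma qmul_sum_right: "qmul p (\<Sum>x\<in>X. f x) = (\<Sum>x\<in>X. qmul p (f x))"
  by (induction X rule: infinite_finite_induct) (auto simp: qmul_add_right)

lemma qmul_one_right [simp]: "qmul p (Poly_Mapping.single [] 1) = p"
proof -
  have "qmul p (Poly_Mapping.single [] 1) = (\<Sum>u\<in>Poly_Mapping.keys p. Poly_Mapping.single u (Poly_Mapping.lookup p u))"
    by (subst qmul_superset[of "Poly_Mapping.keys p" "{[]}"]) auto
  thus ?thesis using poly_mapping_sum_single[of p] by simp
qed

lemma single_sum: "Poly_Mapping.single k (\<Sum>x\<in>X. f x) = (\<Sum>x\<in>X. Poly_Mapping.single k (f x))"
  by (induction X rule: infinite_finite_induct) (auto simp: single_add)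

abbreviation qscale :: "('a::comm_ring_1, 'n) cpoly \<Rightarrow> ('a, 'n) qpoly \<Rightarrow> ('a, 'n) qpoly" where
  "qscale c p \<equiv> qmul (Poly_Mapping.single [] c) p"

lemma T_ideal_sum: "T_ideal I \<Longrightarrow> (\<And>x. x \<in> X \<Longrightarrow> f x \<in> I) \<Longrightarrow> (\<Sum>x\<in>X. f x) \<in> I"
  by (induction X rule: infinite_finite_induct) (auto simp: T_ideal_def)

lemma T_ideal_qmul: "T_ideal I \<Longrightarrow> p \<in> I \<Longrightarrow> qmul (qmul a p) b \<in> I"
  by (simp add: T_ideal_def)

lemma T_ideal_qscale: "T_ideal I \<Longrightarrow> p \<in> I \<Longrightarrow> qscale c p \<in> I"
  using T_ideal_qmul[of I p "Poly_Mapping.single [] c" "Poly_Mapping.single [] 1"] by simp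

lemma qsubst_superset:
  assumes "finite K" "Poly_Mapping.keys P \<subseteq> K"
  shows "qsubst H P = (\<Sum>w\<in>K. qscale (cpeval (\<lambda>(k, i, j). Phi (H k) $ i $ j) (Poly_Mapping.lookup P w) cconst) (qword H w))"
  unfolding qsubst_def using assms
  by (intro sum.mono_neutral_left) (auto simp: in_keys_iff cconst_eq_pconst cpeval_pconst.zero)

lemma qsubst_single:
  "qsubst H (Poly_Mapping.single w a) = qscale (cpeval (\<lambda>(k, i, j). Phi (H k) $ i $ j) a cconst) (qword H w)"
  by (subst qsubst_superset[of "{w}"]) auto

lemma qsubst_add: "qsubst H (P + Q) = qsubst H P + qsubst H Q"
proof -
  let ?K = "Poly_Mapping.keys P \<union> Poly_Mapping.keys Q"
  have "Poly_Mapping.keys (P + Q) \<subseteq> ?K" by (rule keys_add)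
  thus ?thesis
    by (subst (1 2 3) qsubst_superset[of ?K])
      (auto simp: lookup_add cconst_eq_pconst cpeval_pconst.add single_add qmul_add_left sum.distrib)
qed

lemma qsubst_sum: "qsubst H (\<Sum>x\<in>X. f x) = (\<Sum>x\<in>X. qsubst H (f x))"
proof -
  have "qsubst H 0 = 0" by (simp add: qsubst_def)
  thus ?thesis by (induction X rule: infinite_finite_induct) (auto simp: qsubst_add)
qed

lemma qword_single: "qword (\<lambda>k. Poly_Mapping.single (u k) 1) w = Poly_Mapping.single (concat (map u w)) 1"
  by (induction w) (auto simp: qword_def qone_def qmul_single)

text \<open>The quasi-monomial of the permutation \<open>\<sigma>\<close> of \<open>A\<close> with the words \<open>H\<close> at its points, where the
  cycle of \<open>d\<close> is not closed to a trace.\<close>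
definition phi :: "nat set \<Rightarrow> nat \<Rightarrow> (nat \<Rightarrow> nat) \<Rightarrow> (nat \<Rightarrow> nat list) \<Rightarrow> ('a::comm_ring_1, 'n::finite) qpoly" where
  "phi A d \<sigma> H = Poly_Mapping.single (concat (map H (cycword \<sigma> d)))
     (index_trace (\<lambda>p. wordmat generic (H p)) \<sigma> (A - orb \<sigma> d))"

lemma phi_cycle:
  "is_cycle \<sigma> (d # l) \<Longrightarrow> phi A d \<sigma> H = Poly_Mapping.single (H d @ concat (map H l))
     (index_trace (\<lambda>p. wordmat generic (H p)) \<sigma> (A - set (d # l)))"
  using cycword_cycle[of \<sigma> "d # l"] orb_cycle[of \<sigma> "d # l"] by (simp add: phi_def)

lemma ex_is_cycle_Cons:
  assumes "finite A" "\<sigma> permutes A"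
  obtains l where "is_cycle \<sigma> (d # l)"
  using ex_is_cycle[OF permutes_imp_permutation[OF assms], of d] by (metis is_cycle_def list.collapse)

lemma qscale_phi: "qscale a (phi A d \<sigma> H) = Poly_Mapping.single (concat (map H (cycword \<sigma> d)))
     (a * index_trace (\<lambda>p. wordmat generic (H p)) \<sigma> (A - orb \<sigma> d))"
  by (simp add: phi_def qmul_single)

lemma phi_fixed:
  assumes "finite A" "\<sigma> permutes A" "p \<in> A" "p \<noteq> d" "\<sigma> p = p"
  shows "(phi A d \<sigma> H :: ('a::comm_ring_1, 'n::finite) qpoly) = qscale (trace (wordmat generic (H p))) (phi (A - {p}) d \<sigma> H)"
proof -
  let ?W = "\<lambda>p. wordmat generic (H p) :: ('a, 'n) cpoly^'n^'n"
  have "is_cycle \<sigma> [p]" using assms(5) by (simp add: is_cycle_def)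
  hence "orb \<sigma> p = {p}" using orb_cycle by fastforce
  hence "p \<notin> orb \<sigma> d"
    using orb_eq[OF permutes_imp_permutation[OF assms(1,2)], of p d] self_in_orb[of d \<sigma>] assms(4) by force
  hence "index_trace ?W \<sigma> (A - orb \<sigma> d) = trace (?W p) * index_trace ?W \<sigma> (A - orb \<sigma> d - {p})"
    using assms permutes_inj[OF assms(2)] by (intro index_trace_fixed) auto
  moreover have "A - orb \<sigma> d - {p} = A - {p} - orb \<sigma> d" by auto
  ultimately show ?thesis by (simp add: phi_def qmul_single)
qed

lemma is_cycle_split_pred:
  assumes "is_cycle \<sigma> (d # l)" "p \<in> set l" "inj \<sigma>" "\<sigma> q = p"
  obtains xs ys where "d # l = xs @ q # p # ys"
proof -
  obtain zs ys where "l = zs @ p # ys" using assms(2) by (metis split_list)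
  then obtain xs q' where l: "d # l = xs @ q' # p # ys" by (cases "d # zs" rule: rev_cases) auto
  have "is_cycle \<sigma> (q' # p # ys @ xs)" using is_cycle_append_commute[of \<sigma> xs "q' # p # ys"] assms(1) l by simp
  hence "\<sigma> q' = \<sigma> q" using assms(4) by (simp add: is_cycle_def)
  thus ?thesis using that l assms(3) by (simp add: inj_eq)
qed

lemma phi_bypass:
  assumes A: "finite A" "\<sigma> permutes A" and p: "p \<in> A" "p \<noteq> d" "\<sigma> q = p" "\<sigma> p \<noteq> p"
  shows "(phi A d \<sigma> H :: ('a::comm_ring_1, 'n::finite) qpoly) = phi (A - {p}) d (bypass p \<sigma>) (H(q := H q @ H p))"
proof -
  have inj: "inj \<sigma>" by (rule permutes_inj[OF A(2)])
  obtain l where l: "is_cycle \<sigma> (d # l)" by (rule ex_is_cycle_Cons[OF A])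
  have "q \<in> A" using A(2) p(1,3) by (metis permutes_not_in)
  let ?H = "H(q := H q @ H p)"
  let ?W = "\<lambda>H p. wordmat generic (H p) :: ('a, 'n) cpoly^'n^'n"
  show ?thesis
  proof (cases "p \<in> set l")
    case True
    obtain xs ys where xy: "d # l = xs @ q # p # ys" by (rule is_cycle_split_pred[OF l True inj p(3)])
    then obtain l' where l': "xs @ q # ys = d # l'" using p(2) by (cases xs) auto
    have cyc': "is_cycle (bypass p \<sigma>) (d # l')" using is_cycle_bypass[of \<sigma> xs q p ys] l xy l' by simp
    have q: "distinct (xs @ q # p # ys)" using l xy by (simp add: is_cycle_def)
    have "concat (map H (d # l)) = concat (map ?H (d # l'))"
      unfolding xy l'[symmetric] using q by (auto intro!: arg_cong[where f = concat] map_cong)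
    moreover have "A - {p} - set (d # l') = A - set (d # l)" unfolding xy l'[symmetric] by auto
    moreover have "index_trace (?W ?H) (bypass p \<sigma>) (A - set (d # l)) = index_trace (?W H) \<sigma> (A - set (d # l))"
      unfolding xy by (rule index_trace_bypass_outside[OF inj p(3)]) auto
    ultimately show ?thesis unfolding phi_cycle[OF l] phi_cycle[OF cyc'] by simp
  next
    case False
    hence pl: "p \<notin> set (d # l)" using p(2) by simp
    hence "q \<notin> set (d # l)" using is_cycle_image_set[OF l] p(3) by blast
    hence "map ?H l = map H l" "?H d = H d" by auto
    moreover have "index_trace (?W H) \<sigma> (A - set (d # l))
        = index_trace ((?W H)(q := ?W H q ** ?W H p)) (bypass p \<sigma>) (A - set (d # l) - {p})"
      using A p pl \<open>q \<in> A\<close> \<open>q \<notin> _\<close> inj by (intro index_trace_bypass) auto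
    moreover have "(?W H)(q := ?W H q ** ?W H p) = ?W ?H" by (auto simp: wordmat_append)
    moreover have "A - set (d # l) - {p} = A - {p} - set (d # l)" by auto
    ultimately show ?thesis
      unfolding phi_cycle[OF l] phi_cycle[OF is_cycle_bypass_disjoint[OF l pl]] by (simp only:)
  qed
qed

lemma phi_reroot:
  assumes A: "finite A" "\<sigma> permutes A" and d: "\<sigma> q = d" "\<sigma> d \<noteq> d"
  shows "(phi A d \<sigma> H :: ('a::comm_ring_1, 'n::finite) qpoly)
    = qmul (qmul (Poly_Mapping.single (H d) 1) (phi (A - {d}) q (bypass d \<sigma>) (H(q := [])))) (Poly_Mapping.single (H q) 1)"
proof -
  have inj: "inj \<sigma>" by (rule permutes_inj[OF A(2)])
  obtain l where l: "is_cycle \<sigma> (d # l)" by (rule ex_is_cycle_Cons[OF A])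
  hence "l \<noteq> []" using d(2) by (auto simp: is_cycle_def)
  then obtain ys q' where ys: "l = ys @ [q']" by (metis rev_exhaust)
  have "is_cycle \<sigma> (q' # d # ys)" using is_cycle_append_commute[of \<sigma> "d # ys" "[q']"] l ys by simp
  moreover from this have "\<sigma> q' = \<sigma> q" using d(1) by (simp add: is_cycle_def)
  hence q': "q' = q" using inj by (simp add: inj_eq)
  ultimately have cyc': "is_cycle (bypass d \<sigma>) (q # ys)" by (simp add: is_cycle_bypass_Cons)
  let ?H = "H(q := [])" and ?W = "\<lambda>H p. wordmat generic (H p) :: ('a, 'n) cpoly^'n^'n"
  have dist: "distinct (d # ys @ [q])" using l ys q' by (simp add: is_cycle_def)
  hence "map ?H ys = map H ys" by auto
  hence "concat (map ?H ys) = concat (map H ys)" by (rule arg_cong)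
  moreover have "A - {d} - set (q # ys) = A - set (d # l)" by (auto simp: ys q')
  moreover have "index_trace (?W ?H) (bypass d \<sigma>) (A - set (d # l)) = index_trace (?W H) \<sigma> (A - set (d # l))"
    by (rule index_trace_bypass_outside[OF inj d(1)]) (auto simp: ys q')
  ultimately show ?thesis unfolding phi_cycle[OF l] phi_cycle[OF cyc'] by (simp add: qmul_single ys q')
qed

lemma is_cycle_map_permutation:
  assumes "is_cycle \<sigma> l" "inj_on f A" "set l \<subseteq> A"
  shows "is_cycle (map_permutation A f \<sigma>) (map f l)"
proof -
  have "map_permutation A f \<sigma> (f x) = f (\<sigma> x)" if "x \<in> set l" for x
    using that assms(3) by (intro map_permutation_apply[OF assms(2)]) auto
  hence "map (map_permutation A f \<sigma>) (map f l) = map f (map \<sigma> l)" by simp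
  also have "\<dots> = rotate1 (map f l)" using assms(1) by (simp add: is_cycle_def rotate1_map)
  finally show ?thesis
    using assms(1) inj_on_subset[OF assms(2,3)] by (simp add: is_cycle_def distinct_map del: map_map)
qed

lemma index_trace_map_permutation:
  assumes f: "inj_on f A" and B: "B \<subseteq> A" "\<sigma> ` B \<subseteq> B"
  shows "index_trace Y (map_permutation A f \<sigma>) (f ` B) = index_trace (Y \<circ> f) \<sigma> B"
  unfolding index_trace_def
proof (rule sum.reindex_bij_witness[of _ "\<lambda>i. restrict (i \<circ> inv_into B f) (f ` B)" "\<lambda>i. restrict (i \<circ> f) B"])
  have inj: "inj_on f B" using inj_on_subset[OF f B(1)] .
  fix i :: "nat \<Rightarrow> 'b" assume i: "i \<in> PiE (f ` B) (\<lambda>_. UNIV)"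
  show "restrict (restrict (i \<circ> f) B \<circ> inv_into B f) (f ` B) = i"
    using i inj by (auto simp: fun_eq_iff PiE_def extensional_def)
  show "(\<Prod>p\<in>B. (Y \<circ> f) p $ restrict (i \<circ> f) B p $ restrict (i \<circ> f) B (\<sigma> p))
      = (\<Prod>p\<in>f ` B. Y p $ i p $ i (map_permutation A f \<sigma> p))"
    unfolding prod.reindex[OF inj] using B by (intro prod.cong) (auto simp: map_permutation_apply[OF f])
next
  fix i :: "nat \<Rightarrow> 'b" assume "i \<in> PiE B (\<lambda>_. UNIV)"
  thus "restrict (restrict (i \<circ> inv_into B f) (f ` B) \<circ> f) B = i"
    using inj_on_subset[OF f B(1)] by (auto simp: fun_eq_iff PiE_def extensional_def)
qed auto

lemma phi_map_permutation:
  assumes A: "finite A" "\<sigma> permutes A" "d \<in> A" and f: "inj_on f A"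
  shows "phi (f ` A) (f d) (map_permutation A f \<sigma>) H = phi A d \<sigma> (H \<circ> f)"
proof -
  obtain l where l: "is_cycle \<sigma> (d # l)" by (rule ex_is_cycle_Cons[OF A(1,2)])
  have sub: "set (d # l) \<subseteq> A" using orb_cycle[OF l] orb_subset[OF A(2,3)] by simp
  have cyc: "is_cycle (map_permutation A f \<sigma>) (f d # map f l)"
    using is_cycle_map_permutation[OF l f sub] by simp
  have "f ` A - set (f d # map f l) = f ` (A - set (d # l))"
    using inj_on_image_set_diff[OF f _ sub] by simp
  moreover have "\<sigma> ` (A - set (d # l)) \<subseteq> A - set (d # l)"
    using is_cycle_image_set[OF l] permutes_image[OF A(2)] image_set_diff[OF permutes_inj[OF A(2)], of A "set (d # l)"]
    by simp
  ultimately show ?thesis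
    unfolding phi_cycle[OF l] phi_cycle[OF cyc]
    by (simp add: index_trace_map_permutation[OF f] comp_def)
qed

definition alternating_phi ::
    "nat set \<Rightarrow> nat set \<Rightarrow> nat \<Rightarrow> (nat \<Rightarrow> nat) \<Rightarrow> (nat \<Rightarrow> nat list) \<Rightarrow> ('a::comm_ring_1, 'n::finite) qpoly" where
  "alternating_phi S A d \<tau> H = (\<Sum>\<pi> | \<pi> permutes S. qscale (of_int (sign \<pi>)) (phi A d (\<pi> \<circ> \<tau>) H))"

context
  fixes S A :: "nat set" and \<tau> :: "nat \<Rightarrow> nat"
  assumes S: "S \<subseteq> A" and A: "finite A" and \<tau>: "\<tau> permutes A"
begin

lemma comp_permutes_superset: "\<pi> permutes S \<Longrightarrow> \<pi> \<circ> \<tau> permutes A"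
  using permutes_subset[OF _ S] permutes_compose[OF \<tau>] by blast

lemma comp_eq_iff_fixed:
  assumes "\<pi> permutes S" "p \<notin> S"
  shows "(\<pi> \<circ> \<tau>) x = p \<longleftrightarrow> \<tau> x = p"
  using permutes_not_in[OF assms] permutes_inj[OF assms(1)] by (metis injD o_apply)

lemma alternating_phi_fixed:
  assumes p: "p \<in> A" "p \<notin> S" "p \<noteq> d" "\<tau> p = p"
  shows "(alternating_phi S A d \<tau> H :: ('a::comm_ring_1, 'n::finite) qpoly)
    = qscale (trace (wordmat generic (H p))) (alternating_phi S (A - {p}) d \<tau> H)"
  unfolding alternating_phi_def qmul_sum_right
proof (rule sum.cong[OF refl])
  fix \<pi> assume "\<pi> \<in> {\<pi>. \<pi> permutes S}"
  hence \<pi>: "\<pi> permutes S" by simp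
  hence "(\<pi> \<circ> \<tau>) p = p" using comp_eq_iff_fixed p by blast
  note fixed = phi_fixed[OF A comp_permutes_superset[OF \<pi>] p(1,3) this]
  show "qscale (of_int (sign \<pi>)) (phi A d (\<pi> \<circ> \<tau>) H)
      = qscale (trace (wordmat generic (H p))) (qscale (of_int (sign \<pi>)) (phi (A - {p}) d (\<pi> \<circ> \<tau>) H) :: ('a, 'n) qpoly)"
    unfolding fixed by (simp add: phi_def qmul_single mult.left_commute)
qed

lemma alternating_phi_bypass:
  assumes p: "p \<in> A" "p \<notin> S" "p \<noteq> d" "\<tau> q = p" "\<tau> p \<noteq> p"
  shows "(alternating_phi S A d \<tau> H :: ('a::comm_ring_1, 'n::finite) qpoly)
    = alternating_phi S (A - {p}) d (bypass p \<tau>) (H(q := H q @ H p))"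
  unfolding alternating_phi_def
proof (rule sum.cong[OF refl])
  fix \<pi> assume "\<pi> \<in> {\<pi>. \<pi> permutes S}"
  hence \<pi>: "\<pi> permutes S" by simp
  hence "(\<pi> \<circ> \<tau>) q = p" "(\<pi> \<circ> \<tau>) p \<noteq> p" using comp_eq_iff_fixed p by blast+
  note bypassed = phi_bypass[OF A comp_permutes_superset[OF \<pi>] p(1,3) this]
  show "qscale (of_int (sign \<pi>)) (phi A d (\<pi> \<circ> \<tau>) H)
      = (qscale (of_int (sign \<pi>)) (phi (A - {p}) d (\<pi> \<circ> bypass p \<tau>) (H(q := H q @ H p))) :: ('a, 'n) qpoly)"
    unfolding bypassed bypass_comp[OF permutes_inj[OF \<pi>] permutes_not_in[OF \<pi> p(2)]] ..
qed

lemma alternating_phi_reroot: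
  assumes d: "d \<notin> S" "\<tau> q = d" "\<tau> d \<noteq> d"
  shows "(alternating_phi S A d \<tau> H :: ('a::comm_ring_1, 'n::finite) qpoly)
    = qmul (qmul (Poly_Mapping.single (H d) 1) (alternating_phi S (A - {d}) q (bypass d \<tau>) (H(q := []))))
        (Poly_Mapping.single (H q) 1)"
  unfolding alternating_phi_def qmul_sum_right qmul_sum_left
proof (rule sum.cong[OF refl])
  fix \<pi> assume "\<pi> \<in> {\<pi>. \<pi> permutes S}"
  hence \<pi>: "\<pi> permutes S" by simp
  hence "(\<pi> \<circ> \<tau>) q = d" "(\<pi> \<circ> \<tau>) d \<noteq> d" using comp_eq_iff_fixed d by blast+
  note rerooted = phi_reroot[OF A comp_permutes_superset[OF \<pi>] this]
  show "qscale (of_int (sign \<pi>)) (phi A d (\<pi> \<circ> \<tau>) H)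
      = qmul (qmul (Poly_Mapping.single (H d) 1)
          (qscale (of_int (sign \<pi>)) (phi (A - {d}) q (\<pi> \<circ> bypass d \<tau>) (H(q := [])))))
        (Poly_Mapping.single (H q) 1 :: ('a, 'n) qpoly)"
    unfolding rerooted bypass_comp[OF permutes_inj[OF \<pi>] permutes_not_in[OF \<pi> d(1)]]
    by (simp add: phi_def qmul_single)
qed

end

lemma index_trace_alternating:
  fixes Y :: "nat \<Rightarrow> ('a::field_char_0, 'n::finite) cpoly^'n^'n"
  assumes "card S = Suc CARD('n)"
  shows "(\<Sum>\<pi> | \<pi> permutes S. of_int (sign \<pi>) * index_trace Y (\<pi> \<circ> \<tau>) S) = 0"
proof -
  have "(\<Sum>\<pi> | \<pi> permutes S. of_int (sign \<pi>) * (\<Prod>p\<in>S. Y p $ i p $ (i \<circ> \<pi>) (\<tau> p))) = 0" for i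
  proof -
    let ?X = "\<Sum>\<pi> | \<pi> permutes S. of_int (sign \<pi>) * (\<Prod>p\<in>S. Y p $ i p $ (i \<circ> \<pi>) (\<tau> p))"
    have "?X = - ?X" using alternating_sum_tuple_antisym[OF assms, of "\<lambda>g. \<Prod>p\<in>S. Y p $ i p $ g (\<tau> p)" i] .
    hence "2 * ?X = 0" unfolding mult_2 by (rule eq_neg_iff_add_eq_0[THEN iffD1])
    thus ?thesis by simp
  qed
  thus ?thesis unfolding index_trace_def sum_distrib_left by (subst sum.swap) simp
qed

lemma alternating_phi_isolated:
  assumes "card S = Suc CARD('n)" "d \<notin> S" "\<tau> d = d"
  shows "(alternating_phi S (insert d S) d \<tau> H :: ('a::field_char_0, 'n::finite) qpoly) = 0"
proof -
  have "(alternating_phi S (insert d S) d \<tau> H :: ('a, 'n) qpoly) = (\<Sum>\<pi> | \<pi> permutes S.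
      Poly_Mapping.single (H d) (of_int (sign \<pi>) * index_trace (\<lambda>p. wordmat generic (H p)) (\<pi> \<circ> \<tau>) S))"
    unfolding alternating_phi_def
  proof (rule sum.cong[OF refl])
    fix \<pi> assume "\<pi> \<in> {\<pi>. \<pi> permutes S}"
    hence "is_cycle (\<pi> \<circ> \<tau>) [d]" using assms(2,3) permutes_not_in by (fastforce simp: is_cycle_def)
    thus "(qscale (of_int (sign \<pi>)) (phi (insert d S) d (\<pi> \<circ> \<tau>) H) :: ('a, 'n) qpoly)
        = Poly_Mapping.single (H d) (of_int (sign \<pi>) * index_trace (\<lambda>p. wordmat generic (H p)) (\<pi> \<circ> \<tau>) S)"
      using assms(2) by (simp add: phi_cycle qmul_single)
  qed
  thus ?thesis by (simp add: index_trace_alternating[OF assms(1)] flip: single_sum)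
qed

lemma alternating_phi_base:
  assumes S: "finite S" "\<tau> permutes S"
  shows "alternating_phi S S d \<tau> H = qscale (of_int (sign \<tau>)) (alternating_phi S S d id H)"
proof -
  let ?g = "\<lambda>\<sigma>. qscale (of_int (sign (\<sigma> \<circ> inv \<tau>))) (phi S d \<sigma> H)"
  have "alternating_phi S S d \<tau> H = (\<Sum>\<pi> | \<pi> permutes S. ?g (\<pi> \<circ> \<tau>))"
    using permutes_inv_o(1)[OF S(2)] by (simp add: alternating_phi_def comp_assoc)
  also have "\<dots> = (\<Sum>\<sigma> | \<sigma> permutes S. ?g \<sigma>)"
    by (rule sum_permutations_compose_right[OF S(2), of ?g, symmetric])
  also have "\<dots> = (\<Sum>\<sigma> | \<sigma> permutes S. qscale (of_int (sign \<tau>)) (qscale (of_int (sign \<sigma>)) (phi S d \<sigma> H)))"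
  proof (rule sum.cong[OF refl])
    fix \<sigma> assume "\<sigma> \<in> {\<sigma>. \<sigma> permutes S}"
    hence "permutation \<sigma>" "permutation \<tau>" using permutes_imp_permutation[OF S(1)] S(2) by auto
    hence "sign (\<sigma> \<circ> inv \<tau>) = sign \<tau> * sign \<sigma>"
      by (simp add: sign_compose permutation_inverse sign_inverse)
    thus "?g \<sigma> = qscale (of_int (sign \<tau>)) (qscale (of_int (sign \<sigma>)) (phi S d \<sigma> H))"
      by (simp add: phi_def qmul_single mult.assoc)
  qed
  finally show ?thesis by (simp add: alternating_phi_def qmul_sum_right)
qed

lemma alternating_phi_relabel:
  fixes f :: "nat \<Rightarrow> nat"
  assumes A: "finite A" "d \<in> A" and f: "inj_on f A"
  shows "(alternating_phi (f ` A) (f ` A) (f d) id H :: ('a::comm_ring_1, 'n::finite) qpoly)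
    = alternating_phi A A d id (H \<circ> f)"
proof -
  have bij: "bij_betw f A (f ` A)" using f by (simp add: bij_betw_def)
  note bij' = bij_betw_inv_into[OF bij]
  have "(alternating_phi A A d id (H \<circ> f) :: ('a, 'n) qpoly)
    = (\<Sum>\<sigma> | \<sigma> permutes A. qscale (of_int (sign \<sigma>)) (phi A d \<sigma> (H \<circ> f)))"
    by (simp add: alternating_phi_def)
  also have "\<dots> = (\<Sum>\<sigma> | \<sigma> permutes f ` A. qscale (of_int (sign \<sigma>)) (phi (f ` A) (f d) \<sigma> H))"
  proof (rule sum.reindex_bij_witness[of _ "map_permutation (f ` A) (inv_into A f)" "map_permutation A f"])
    fix \<sigma> assume "\<sigma> \<in> {\<sigma>. \<sigma> permutes A}"
    hence \<sigma>: "\<sigma> permutes A" by simp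
    show "map_permutation (f ` A) (inv_into A f) (map_permutation A f \<sigma>) = \<sigma>"
      by (rule map_permutation_compose_inv[OF bij \<sigma>]) (simp add: f)
    show "map_permutation A f \<sigma> \<in> {\<sigma>. \<sigma> permutes f ` A}" using map_permutation_permutes[OF bij \<sigma>] by simp
    show "qscale (of_int (sign (map_permutation A f \<sigma>))) (phi (f ` A) (f d) (map_permutation A f \<sigma>) H)
        = (qscale (of_int (sign \<sigma>)) (phi A d \<sigma> (H \<circ> f)) :: ('a, 'n) qpoly)"
      by (simp only: sign_map_permutation[OF f \<sigma> A(1)] phi_map_permutation[OF A(1) \<sigma> A(2) f])
  next
    fix \<sigma> assume "\<sigma> \<in> {\<sigma>. \<sigma> permutes f ` A}"
    hence \<sigma>: "\<sigma> permutes f ` A" by simp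
    show "map_permutation A f (map_permutation (f ` A) (inv_into A f) \<sigma>) = \<sigma>"
      by (rule map_permutation_compose_inv[OF bij' \<sigma>]) (simp add: f_inv_into_f)
    show "map_permutation (f ` A) (inv_into A f) \<sigma> \<in> {\<sigma>. \<sigma> permutes A}"
      using map_permutation_permutes[OF bij' \<sigma>] by simp
  qed
  finally show ?thesis by (simp add: alternating_phi_def)
qed

lemma cpeval_qtr_substitute_words:
  "cpeval (\<lambda>(k, i, j). Phi (Poly_Mapping.single (u k) 1) $ i $ j) (qtr w) pconst
    = (trace (wordmat generic (concat (map u w))) :: ('a::comm_ring_1, 'n::finite) cpoly)"
proof -
  have "(\<lambda>(k, i, j). Phi (Poly_Mapping.single (u k) 1) $ i $ j :: ('a, 'n) cpoly) = point (\<lambda>k. wordmat generic (u k))"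
    by (simp add: point_def fun_eq_iff Phi_single)
  thus ?thesis
    by (simp add: qtr_def trace_def cpeval_pconst.sum pconst.cpeval_wordmat_generic
        wordmat_concat)
qed

lemma cycword_tailword:
  assumes "finite (orb \<sigma> n)"
  shows "cycword \<sigma> n = n # tailword n \<sigma>"
proof -
  have "card (orb \<sigma> n) > 0" using assms self_in_orb[of n \<sigma>] card_gt_0_iff by blast
  hence "[0..<card (orb \<sigma> n)] = 0 # [1..<card (orb \<sigma> n)]" by (simp add: upt_conv_Cons)
  thus ?thesis by (simp add: cycword_def tailword_def)
qed

lemma alternating_phi_Qn:
  fixes u :: "nat \<Rightarrow> nat list"
  shows "(alternating_phi {0..CARD('n)} {0..CARD('n)} CARD('n) id u :: ('a::comm_ring_1, 'n::finite) qpoly)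
    = qmul (Poly_Mapping.single (u CARD('n)) 1) (qsubst (\<lambda>k. Poly_Mapping.single (u k) 1) Qn)"
proof -
  let ?n = "CARD('n)" and ?H = "\<lambda>k. Poly_Mapping.single (u k) 1 :: ('a, 'n) qpoly"
  let ?h = "\<lambda>p. cpeval (\<lambda>(k, i, j). Phi (?H k) $ i $ j) p pconst :: ('a, 'n) cpoly"
  have "qmul (?H ?n) (qsubst ?H (qscale (of_int (sign \<sigma>)) (phi_sigma ?n \<sigma>)))
      = qscale (of_int (sign \<sigma>)) (phi {0..?n} ?n \<sigma> u)" if \<sigma>: "\<sigma> permutes {0..?n}" for \<sigma>
  proof -
    have fin: "finite (orb \<sigma> ?n)"
      using orb_subset[OF \<sigma>, of ?n] by (rule finite_subset) simp_all
    have "?h (\<Prod>Cy\<in>{orb \<sigma> i | i. i < ?n \<and> ?n \<notin> orb \<sigma> i}. qtr (cycword \<sigma> (Min Cy)))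
      = index_trace (\<lambda>p. wordmat generic (u p)) \<sigma> ({0..?n} - orb \<sigma> ?n)"
      unfolding cpeval_pconst.prod cpeval_qtr_substitute_words index_trace_cycles[OF \<sigma>] wordmat_concat ..
    thus ?thesis
      unfolding phi_sigma_def qmul_single qsubst_single qword_single cconst_eq_pconst
        cpeval_pconst.mult cpeval_pconst.of_int qscale_phi
        cycword_tailword[OF fin] by simp
  qed
  thus ?thesis by (simp add: alternating_phi_def Qn_def qsubst_sum qmul_sum_right)
qed

lemma alternating_phi_id_in_T_ideal:
  fixes I :: "('a::comm_ring_1, 'n::finite) qpoly set"
  assumes I: "T_ideal I" "Qn \<in> I" and S: "card S = Suc CARD('n)" "d \<in> S"
  shows "alternating_phi S S d id H \<in> I"
proof -
  let ?n = "CARD('n)"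
  have fin: "finite S" using S(1) by (intro card_ge_0_finite) simp
  obtain g where g: "bij_betw g {0..?n} S"
    using fin S(1) by (metis card_atLeastAtMost diff_zero finite_atLeastAtMost finite_same_card_bij)
  define f where "f = Transposition.transpose (g ?n) d \<circ> g"
  have "g ?n \<in> S" using g by (auto simp: bij_betw_def)
  hence "Transposition.transpose (g ?n) d permutes S" using S(2) by (intro permutes_swap_id)
  hence f: "bij_betw f {0..?n} S" unfolding f_def by (intro bij_betw_trans[OF g] permutes_imp_bij)
  hence f: "f ` {0..?n} = S" "inj_on f {0..?n}" "f ?n = d" by (auto simp: bij_betw_def f_def)
  have "alternating_phi S S d id H = (alternating_phi {0..?n} {0..?n} ?n id (H \<circ> f) :: ('a, 'n) qpoly)"
    using alternating_phi_relabel[of "{0..?n}" ?n f H] f by simp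
  also have "\<dots> \<in> I"
    unfolding alternating_phi_Qn using T_ideal_qmul[OF I(1), of _ _ "Poly_Mapping.single [] 1"] I
    by (simp add: T_ideal_def)
  finally show ?thesis .
qed

lemma alternating_phi_in_T_ideal_step:
  fixes I :: "('a::field_char_0, 'n::finite) qpoly set"
  assumes I: "T_ideal I" and card_S: "card S = Suc CARD('n)"
    and A: "S \<subset> A" "finite A" "\<tau> permutes A" "d \<in> A"
    and smaller: "\<And>p \<tau> d H. p \<in> A \<Longrightarrow> p \<notin> S \<Longrightarrow> \<tau> permutes A - {p} \<Longrightarrow> d \<in> A - {p} \<Longrightarrow>
      alternating_phi S (A - {p}) d \<tau> H \<in> I"
  shows "alternating_phi S A d \<tau> H \<in> I"
proof -
  obtain pred where pred: "\<tau> (pred p) = p" for p using permutes_surj[OF A(3)] by (metis surjD)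
  note perm = psubset_imp_subset[OF A(1)] A(2,3)
  consider p where "p \<in> A" "p \<notin> S" "p \<noteq> d" | "A = insert d S" "d \<notin> S" using A(1,4) by blast
  thus ?thesis
  proof cases
    case (1 p)
    show ?thesis
    proof (cases "\<tau> p = p")
      case True
      have "\<tau> permutes A - {p}" using permutes_superset[OF A(3), of "A - {p}"] True by auto
      thus ?thesis
        unfolding alternating_phi_fixed[OF perm 1 True] using 1 A(4)
        by (intro T_ideal_qscale[OF I] smaller) auto
    next
      case False
      show ?thesis
        unfolding alternating_phi_bypass[OF perm 1 pred False] using 1 A(4)
        by (intro smaller bypass_permutes[OF A(3)]) auto
    qed
  next
    case 2
    show ?thesis
    proof (cases "\<tau> d = d")
      case True
      thus ?thesis using I by (simp add: alternating_phi_isolated[OF card_S 2(2)] 2(1) T_ideal_def)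
    next
      case False
      have "pred d \<in> A - {d}"
        using permutes_not_in[OF A(3), of "pred d"] pred[of d] False A(4) by (metis Diff_iff singletonD)
      thus ?thesis
        unfolding alternating_phi_reroot[OF perm 2(2) pred False]
        by (intro T_ideal_qmul[OF I] smaller bypass_permutes[OF A(3)] A(4) 2(2))
    qed
  qed
qed

theorem alternating_phi_in_T_ideal:
  fixes I :: "('a::field_char_0, 'n::finite) qpoly set"
  assumes I: "T_ideal I" "Qn \<in> I" and S: "card S = Suc CARD('n)"
    and "finite A" "S \<subseteq> A" "\<tau> permutes A" "d \<in> A"
  shows "alternating_phi S A d \<tau> H \<in> I"
  using assms(4-)
proof (induction "card (A - S)" arbitrary: A \<tau> d H rule: less_induct)
  case less
  note A = less.prems
  show ?case
  proof (cases "A = S")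
    case True
    have \<tau>: "finite S" "\<tau> permutes S" and d: "d \<in> S" using A True by simp_all
    show ?thesis
      unfolding True alternating_phi_base[OF \<tau>]
      by (intro T_ideal_qscale[OF I(1)] alternating_phi_id_in_T_ideal[OF I S d])
  next
    case False
    hence "S \<subset> A" using A(2) by blast
    thus ?thesis
    proof (rule alternating_phi_in_T_ideal_step[OF I(1) S _ A(1,3,4)])
      fix p \<tau>' d' H' assume p: "p \<in> A" "p \<notin> S" and "\<tau>' permutes A - {p}" "d' \<in> A - {p}"
      moreover have "card (A - {p} - S) < card (A - S)" using p A(1) by (intro psubset_card_mono) auto
      ultimately show "alternating_phi S (A - {p}) d' \<tau>' H' \<in> I" using A by (intro less.hyps) auto
    qed
  qed
qed

section \<open>Trace identities\<close>

definition letter :: "nat \<Rightarrow> (nat \<Rightarrow> nat) \<Rightarrow> nat \<Rightarrow> nat list" where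
  "letter d k p = (if p < d then [k p] else [])"

abbreviation trace_qmon :: "nat \<Rightarrow> (nat \<Rightarrow> nat) \<Rightarrow> (nat \<Rightarrow> nat) \<Rightarrow> ('a::comm_ring_1, 'n::finite) qpoly" where
  "trace_qmon d k \<sigma> \<equiv> phi {..<Suc d} d \<sigma> (letter d k)"

lemma trace_unit_mat_mult: "trace (unit_mat v u ** A) = A $ u $ v"
proof -
  have "trace (unit_mat v u ** A) = (\<Sum>a\<in>UNIV. \<Sum>b\<in>UNIV. if b = u then (if a = v then A $ b $ a else 0) else 0)"
    unfolding trace_def matrix_matrix_mult_def vec_lambda_beta
    by (intro sum.cong refl) (simp add: unit_mat_def)
  thus ?thesis by simp
qed

text \<open>Close the open path at \<open>d\<close> with a matrix unit.\<close>
lemma Phi_trace_qmon_index_trace: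
  assumes \<sigma>: "\<sigma> permutes {..<Suc d}"
  shows "(Phi (trace_qmon d k \<sigma>) $ u $ v :: ('a::comm_ring_1, 'n::finite) cpoly)
    = index_trace (\<lambda>p. if p < d then generic (k p) else unit_mat v u) \<sigma> {..<Suc d}"
proof -
  let ?Y = "\<lambda>p. if p < d then generic (k p) else unit_mat v u :: ('a, 'n) cpoly^'n^'n"
  let ?W = "\<lambda>p. wordmat generic (letter d k p) :: ('a, 'n) cpoly^'n^'n"
  obtain l where l: "is_cycle \<sigma> (d # l)" by (rule ex_is_cycle_Cons[OF finite_lessThan \<sigma>])
  have sub: "set (d # l) \<subseteq> {..<Suc d}" using orb_cycle[OF l] orb_subset[OF \<sigma>, of d] by simp
  have "d \<notin> set l" using l by (simp add: is_cycle_def)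
  hence "p < d" if "p \<in> set l" for p using sub that by (cases "p = d") auto
  hence "wordmat ?Y l = wordmat ?W l" by (intro wordmat_cong) (simp add: letter_def)
  hence tr: "trace (wordmat ?Y (d # l)) = wordmat generic (concat (map (letter d k) l)) $ u $ v"
    by (simp add: trace_unit_mat_mult wordmat_concat)
  have rest: "index_trace ?Y \<sigma> ({..<Suc d} - set (d # l)) = index_trace ?W \<sigma> ({..<Suc d} - set (d # l))"
    by (rule index_trace_cong) (auto simp: letter_def)
  have "index_trace ?Y \<sigma> {..<Suc d} = trace (wordmat ?Y (d # l)) * index_trace ?W \<sigma> ({..<Suc d} - set (d # l))"
    unfolding rest[symmetric] by (rule index_trace_cycle[OF l _ sub \<sigma>]) simp_all
  thus ?thesis
    unfolding phi_cycle[OF l] Phi_single tr by (simp add: letter_def[of d k d] mult.commute)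
qed

lemma index_trace_place_perm:
  assumes \<sigma>: "\<sigma> permutes {..<r}"
  shows "index_trace Y \<sigma> {..<r} = (\<Sum>i\<in>tuples r. \<Sum>j\<in>tuples r. place_perm \<sigma> i j * (\<Prod>p<r. Y p $ i p $ j p))"
  unfolding index_trace_def
proof (rule sum.cong[OF refl])
  fix i :: "nat \<Rightarrow> 'b" assume "i \<in> tuples r"
  hence "i \<circ> \<sigma> \<in> tuples r" by (rule words_comp_perm[OF _ \<sigma>])
  moreover have "(\<Sum>j\<in>tuples r. place_perm \<sigma> i j * (\<Prod>p<r. Y p $ i p $ j p))
      = (\<Sum>j\<in>tuples r. if j = i \<circ> \<sigma> then \<Prod>p<r. Y p $ i p $ (i \<circ> \<sigma>) p else 0)"
    by (intro sum.cong) (auto simp: place_perm_def)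
  ultimately show "(\<Prod>p<r. Y p $ i p $ i (\<sigma> p)) = (\<Sum>j\<in>tuples r. place_perm \<sigma> i j * (\<Prod>p<r. Y p $ i p $ j p))"
    by (simp del: PiE_UNIV_domain)
qed

lemma Phi_trace_qmon:
  fixes k \<sigma> :: "nat \<Rightarrow> nat"
  assumes \<sigma>: "\<sigma> permutes {..<Suc d}"
  shows "(Phi (trace_qmon d k \<sigma>) $ u $ v :: ('a::comm_ring_1, 'n::finite) cpoly)
    = (\<Sum>i\<in>tuples d. \<Sum>j\<in>tuples d. place_perm \<sigma> (i(d := v)) (j(d := u)) * mon d (zip_word d k (zip_word d i j)))"
proof -
  let ?P = "\<lambda>i j. \<Prod>p<d. pvar (k p, i p, j p) :: ('a, 'n) cpoly"
  let ?Y = "\<lambda>p. if p < d then generic (k p) else unit_mat v u :: ('a, 'n) cpoly^'n^'n"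
  have split: "(\<Sum>i\<in>tuples (Suc d). F i) = (\<Sum>i\<in>tuples d. \<Sum>x\<in>UNIV. F (i(d := x)))" for F :: "(nat \<Rightarrow> 'n) \<Rightarrow> ('a, 'n) cpoly"
    unfolding lessThan_Suc by (rule sum_PiE_insert) simp
  have factor: "(\<Prod>p<Suc d. ?Y p $ (i(d := x)) p $ (j(d := y)) p) = (if x = v then if y = u then ?P i j else 0 else 0)"
    for i j x y
    by (simp add: unit_mat_def)
  have "Phi (trace_qmon d k \<sigma>) $ u $ v = (\<Sum>i\<in>tuples d. \<Sum>x\<in>UNIV. \<Sum>j\<in>tuples d. \<Sum>y\<in>UNIV.
      place_perm \<sigma> (i(d := x)) (j(d := y)) * (if x = v then if y = u then ?P i j else 0 else 0))"
    unfolding Phi_trace_qmon_index_trace[OF \<sigma>] index_trace_place_perm[OF \<sigma>] split factor ..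
  also have "\<dots> = (\<Sum>i\<in>tuples d. \<Sum>j\<in>tuples d. place_perm \<sigma> (i(d := v)) (j(d := u)) * ?P i j)"
  proof (rule sum.cong[OF refl])
    fix i :: "nat \<Rightarrow> 'n"
    have "(\<Sum>x\<in>UNIV. \<Sum>j\<in>tuples d. \<Sum>y\<in>UNIV.
        place_perm \<sigma> (i(d := x)) (j(d := y)) * (if x = v then if y = u then ?P i j else 0 else 0))
      = (\<Sum>x\<in>UNIV. if x = v then \<Sum>j\<in>tuples d. place_perm \<sigma> (i(d := v)) (j(d := u)) * ?P i j else 0)"
      by (intro sum.cong) (auto simp: if_distrib[of "\<lambda>x. _ * x"] cong: if_cong)
    thus "(\<Sum>x\<in>UNIV. \<Sum>j\<in>tuples d. \<Sum>y\<in>UNIV.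
        place_perm \<sigma> (i(d := x)) (j(d := y)) * (if x = v then if y = u then ?P i j else 0 else 0))
      = (\<Sum>j\<in>tuples d. place_perm \<sigma> (i(d := v)) (j(d := u)) * ?P i j)" by simp
  qed
  finally show ?thesis by (simp add: mon_def zip_word_def)
qed

definition trace_qpoly ::
    "nat \<Rightarrow> nat set \<Rightarrow> ((nat \<Rightarrow> nat) \<Rightarrow> (nat \<Rightarrow> nat) \<Rightarrow> 'a) \<Rightarrow> ('a::comm_ring_1, 'n::finite) qpoly" where
  "trace_qpoly d K c = (\<Sum>k\<in>words d K. \<Sum>\<sigma>\<in>perms (Suc d). qscale (pconst (c k \<sigma>)) (trace_qmon d k \<sigma>))"

definition trace_tensor ::
    "nat \<Rightarrow> ((nat \<Rightarrow> nat) \<Rightarrow> (nat \<Rightarrow> nat) \<Rightarrow> 'a) \<Rightarrow> 'n \<Rightarrow> 'n \<Rightarrow> (nat \<Rightarrow> nat \<times> 'n \<times> 'n) \<Rightarrow> 'a::comm_ring_1" where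
  "trace_tensor d c u v w = (\<Sum>\<sigma>\<in>perms (Suc d). c (restrict (fst \<circ> w) {..<d}) \<sigma> *
     place_perm \<sigma> ((restrict (fst \<circ> snd \<circ> w) {..<d})(d := v)) ((restrict (snd \<circ> snd \<circ> w) {..<d})(d := u)))"

lemma trace_tensor_zip_word:
  assumes "k \<in> words d K" "i \<in> tuples d" "j \<in> tuples d"
  shows "trace_tensor d c u v (zip_word d k (zip_word d i j))
    = (\<Sum>\<sigma>\<in>perms (Suc d). c k \<sigma> * place_perm \<sigma> (i(d := v)) (j(d := u)))"
proof -
  let ?w = "zip_word d k (zip_word d i j)"
  have "restrict (fst \<circ> snd \<circ> ?w) {..<d} = restrict (fst \<circ> zip_word d i j) {..<d}"
    "restrict (snd \<circ> snd \<circ> ?w) {..<d} = restrict (snd \<circ> zip_word d i j) {..<d}"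
    by (auto simp: zip_word_def fun_eq_iff)
  thus ?thesis
    by (simp only: trace_tensor_def fst_zip_word[OF assms(1)] fst_zip_word[OF assms(2)] snd_zip_word[OF assms(3)])
qed

lemma Phi_qscale: "Phi (qscale a (phi A d \<sigma> H)) $ u $ v = a * Phi (phi A d \<sigma> H) $ u $ v"
  by (simp add: phi_def qmul_single Phi_single mult.assoc)

lemma Phi_trace_qpoly:
  "(Phi (trace_qpoly d K c) $ u $ v :: ('a::comm_ring_1, 'n::finite) cpoly)
    = restitution (K \<times> UNIV) d (trace_tensor d c u v)"
proof -
  let ?m = "\<lambda>k i j. mon d (zip_word d k (zip_word d i j)) :: ('a, 'n) cpoly"
  let ?\<theta> = "\<lambda>\<sigma> i j. place_perm \<sigma> (i(d := v)) (j(d := u))"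
  have "(\<Sum>\<sigma>\<in>perms (Suc d). pconst (c k \<sigma>) * (\<Sum>i\<in>tuples d. \<Sum>j\<in>tuples d. ?\<theta> \<sigma> i j * ?m k i j))
      = (\<Sum>i\<in>tuples d. \<Sum>j\<in>tuples d. pconst (trace_tensor d c u v (zip_word d k (zip_word d i j))) * ?m k i j)"
    if k: "k \<in> words d K" for k
  proof -
    have "(\<Sum>\<sigma>\<in>perms (Suc d). pconst (c k \<sigma>) * (\<Sum>i\<in>tuples d. \<Sum>j\<in>tuples d. ?\<theta> \<sigma> i j * ?m k i j))
      = (\<Sum>i\<in>tuples d. \<Sum>j\<in>tuples d. (\<Sum>\<sigma>\<in>perms (Suc d). pconst (c k \<sigma>) * ?\<theta> \<sigma> i j) * ?m k i j)"
      unfolding sum_distrib_left sum_distrib_right mult.assoc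
      by (subst sum.swap) (intro sum.cong refl, rule sum.swap)
    also have "\<dots> = (\<Sum>i\<in>tuples d. \<Sum>j\<in>tuples d. pconst (trace_tensor d c u v (zip_word d k (zip_word d i j))) * ?m k i j)"
      by (intro sum.cong refl)
        (simp add: trace_tensor_zip_word[OF k] pconst.sum pconst.mult place_perm_def
        if_distrib[of pconst] hom_simps cong: if_cong)
    finally show ?thesis .
  qed
  thus ?thesis
    unfolding trace_qpoly_def restitution_def UNIV_Times_UNIV[symmetric] sum_zip_word
    by (simp add: Phi_sum Phi_qscale Phi_trace_qmon)
qed

lemma homogeneous_Phi_trace_qpoly: "homogeneous d (Phi (trace_qpoly d K c) $ u $ v)"
  unfolding Phi_trace_qpoly by (rule homogeneous_restitution)

definition conj_invariant :: "nat \<Rightarrow> ((nat \<Rightarrow> nat) \<Rightarrow> (nat \<Rightarrow> nat) \<Rightarrow> 'a) \<Rightarrow> bool" where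
  "conj_invariant d c \<longleftrightarrow> (\<forall>\<rho> k \<sigma>. \<rho> permutes {..<d} \<longrightarrow> c (k \<circ> \<rho>) \<sigma> = c k (\<rho> \<circ> \<sigma> \<circ> inv \<rho>))"

lemma sum_perms_conj:
  assumes "\<rho> permutes {..<N}"
  shows "(\<Sum>\<sigma>\<in>perms N. F (\<rho> \<circ> \<sigma> \<circ> inv \<rho>)) = (\<Sum>\<sigma>\<in>perms N. F \<sigma>)"
proof (rule sum.reindex_bij_witness[of _ "\<lambda>\<sigma>. inv \<rho> \<circ> \<sigma> \<circ> \<rho>" "\<lambda>\<sigma>. \<rho> \<circ> \<sigma> \<circ> inv \<rho>"])
  note inv = permutes_inv_o[OF assms] permutes_inv[OF assms]
  fix \<sigma> assume "\<sigma> \<in> perms N"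
  thus "\<rho> \<circ> \<sigma> \<circ> inv \<rho> \<in> perms N" "inv \<rho> \<circ> \<sigma> \<circ> \<rho> \<in> perms N"
    using assms inv(3) by (auto intro!: permutes_compose)
  show "inv \<rho> \<circ> (\<rho> \<circ> \<sigma> \<circ> inv \<rho>) \<circ> \<rho> = \<sigma>" "\<rho> \<circ> (inv \<rho> \<circ> \<sigma> \<circ> \<rho>) \<circ> inv \<rho> = \<sigma>"
    using permutes_inverses[OF assms] by (simp_all add: fun_eq_iff)
qed simp

lemma place_perm_conj:
  assumes "\<rho> permutes A"
  shows "place_perm \<sigma> (i \<circ> \<rho>) (j \<circ> \<rho>) = place_perm (\<rho> \<circ> \<sigma> \<circ> inv \<rho>) i j"
proof -
  have "j \<circ> \<rho> = i \<circ> \<rho> \<circ> \<sigma> \<longleftrightarrow> j = i \<circ> (\<rho> \<circ> \<sigma> \<circ> inv \<rho>)"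
    using permutes_inverses[OF assms] by (auto simp: fun_eq_iff) metis
  thus ?thesis by (simp add: place_perm_def)
qed

lemma symmetric_trace_tensor:
  assumes "conj_invariant d c"
  shows "symmetric_tensor d (trace_tensor d c u v)"
  unfolding symmetric_tensor_def
proof (intro allI impI)
  fix \<rho> and w :: "nat \<Rightarrow> nat \<times> 'b \<times> 'b" assume \<rho>: "\<rho> permutes {..<d}"
  hence \<rho>': "\<rho> permutes {..<Suc d}" by (rule permutes_subset) auto
  have upd: "(f \<circ> \<rho>)(d := x) = f(d := x) \<circ> \<rho>" for f :: "nat \<Rightarrow> 'b" and x
    using permutes_not_in[OF \<rho>, of d] permutes_inj[OF \<rho>] by (auto simp: fun_eq_iff) (metis injD)
  let ?r = "\<lambda>f. restrict f {..<d}"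
  let ?i = "(?r (fst \<circ> snd \<circ> w))(d := v)" and ?j = "(?r (snd \<circ> snd \<circ> w))(d := u)"
  have "trace_tensor d c u v (w \<circ> \<rho>) = (\<Sum>\<sigma>\<in>perms (Suc d). c (?r (fst \<circ> w) \<circ> \<rho>) \<sigma> * place_perm \<sigma> (?i \<circ> \<rho>) (?j \<circ> \<rho>))"
    unfolding trace_tensor_def comp_assoc[symmetric] restrict_comp_perm[OF \<rho>] upd ..
  also have "\<dots> = (\<Sum>\<sigma>\<in>perms (Suc d). c (?r (fst \<circ> w)) (\<rho> \<circ> \<sigma> \<circ> inv \<rho>) * place_perm (\<rho> \<circ> \<sigma> \<circ> inv \<rho>) ?i ?j)"
    using assms \<rho> by (simp only: conj_invariant_def place_perm_conj[OF \<rho>])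
  also have "\<dots> = trace_tensor d c u v w"
    unfolding trace_tensor_def by (rule sum_perms_conj[OF \<rho>'])
  finally show "trace_tensor d c u v (w \<circ> \<rho>) = trace_tensor d c u v w" .
qed

lemma trace_identity_in_perm_kernel:
  fixes c :: "(nat \<Rightarrow> nat) \<Rightarrow> (nat \<Rightarrow> nat) \<Rightarrow> 'a::field_char_0"
  assumes sym: "conj_invariant d c" and zero: "Phi (trace_qpoly d K c) = (0 :: ('a, 'n::finite) cpoly^'n^'n)"
    and K: "finite K" and k: "k \<in> words d K"
  shows "in_perm_kernel TYPE('n) (Suc d) (c k)"
  unfolding in_perm_kernel_def
proof (intro ballI)
  fix i j :: "nat \<Rightarrow> 'n" assume ij: "i \<in> tuples (Suc d)" "j \<in> tuples (Suc d)"
  let ?r = "\<lambda>f. restrict f {..<d}" and ?V = "K \<times> (UNIV :: ('n \<times> 'n) set)"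
  have upd: "(?r f)(d := f d) = f" if "f \<in> tuples (Suc d)" for f :: "nat \<Rightarrow> 'n"
    using that by (auto simp: fun_eq_iff PiE_def extensional_def)
  have mem: "?r f \<in> tuples d" for f :: "nat \<Rightarrow> 'n" by simp
  have "restitution ?V d (trace_tensor d c (j d) (i d)) = 0"
    using zero by (simp flip: Phi_trace_qpoly)
  moreover have "zip_word d k (zip_word d (?r i) (?r j)) \<in> words d ?V"
    by (rule zip_word_mem[OF k]) (simp add: zip_word_def)
  ultimately have "trace_tensor d c (j d) (i d) (zip_word d k (zip_word d (?r i) (?r j))) = 0"
    using K by (intro restitution_symmetric_eq_0[OF _ symmetric_trace_tensor[OF sym]]) auto
  thus "(\<Sum>\<sigma>\<in>perms (Suc d). c k \<sigma> * place_perm \<sigma> i j) = 0"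
    unfolding trace_tensor_zip_word[OF k mem mem] upd[OF ij(1)] upd[OF ij(2)] .
qed

lemma map_permutation_eq_conj:
  assumes "\<rho> permutes A" "\<sigma> permutes A"
  shows "map_permutation A \<rho> \<sigma> = \<rho> \<circ> \<sigma> \<circ> inv \<rho>"
proof
  fix x
  have "map_permutation A \<rho> \<sigma> (\<rho> y) = \<rho> (\<sigma> y)" for y
  proof (cases "y \<in> A")
    case False
    hence "\<rho> y = y" "\<sigma> y = y" using assms by (simp_all add: permutes_not_in)
    thus ?thesis using map_permutation_permutes[OF permutes_imp_bij[OF assms(1)] assms(2)] False
      by (simp add: permutes_not_in)
  qed (simp add: map_permutation_apply permutes_inj_on[OF assms(1)])
  thus "map_permutation A \<rho> \<sigma> x = (\<rho> \<circ> \<sigma> \<circ> inv \<rho>) x"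
    using permutes_inverses(1)[OF assms(1)] by (metis comp_apply)
qed

lemma trace_qmon_conj:
  assumes \<rho>: "\<rho> permutes {..<d}" and \<sigma>: "\<sigma> permutes {..<Suc d}"
  shows "trace_qmon d k (\<rho> \<circ> \<sigma> \<circ> inv \<rho>) = trace_qmon d (k \<circ> \<rho>) \<sigma>"
proof -
  have \<rho>': "\<rho> permutes {..<Suc d}" using \<rho> by (rule permutes_subset) auto
  have "letter d k \<circ> \<rho> = letter d (k \<circ> \<rho>)"
    using permutes_in_image[OF \<rho>] by (auto simp: fun_eq_iff letter_def)
  thus ?thesis
    using phi_map_permutation[OF finite_lessThan \<sigma>, of d \<rho> "letter d k"] permutes_inj_on[OF \<rho>']
    by (simp add: map_permutation_eq_conj[OF \<rho>' \<sigma>] permutes_image[OF \<rho>'] permutes_not_in[OF \<rho>])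
qed

definition conj_average ::
    "nat \<Rightarrow> ((nat \<Rightarrow> nat) \<Rightarrow> (nat \<Rightarrow> nat) \<Rightarrow> 'a) \<Rightarrow> (nat \<Rightarrow> nat) \<Rightarrow> (nat \<Rightarrow> nat) \<Rightarrow> 'a::field_char_0" where
  "conj_average d c k \<sigma> = (\<Sum>\<rho>\<in>perms d. c (k \<circ> \<rho>) (inv \<rho> \<circ> \<sigma> \<circ> \<rho>)) / fact d"

lemma conj_invariant_conj_average: "conj_invariant d (conj_average d c)"
  unfolding conj_invariant_def conj_average_def
proof (intro allI impI arg_cong2[where f = "(/)"] refl)
  fix \<tau> k \<sigma> assume \<tau>: "\<tau> permutes {..<d}"
  have "inv (\<tau> \<circ> \<rho>) \<circ> (\<tau> \<circ> \<sigma> \<circ> inv \<tau>) \<circ> (\<tau> \<circ> \<rho>) = inv \<rho> \<circ> \<sigma> \<circ> \<rho>" if "\<rho> permutes {..<d}" for \<rho>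
    using permutes_inverses[OF \<tau>] by (simp add: fun_eq_iff o_inv_distrib permutes_bij[OF \<tau>] permutes_bij[OF that])
  thus "(\<Sum>\<rho>\<in>perms d. c (k \<circ> \<tau> \<circ> \<rho>) (inv \<rho> \<circ> \<sigma> \<circ> \<rho>))
      = (\<Sum>\<rho>\<in>perms d. c (k \<circ> \<rho>) (inv \<rho> \<circ> (\<tau> \<circ> \<sigma> \<circ> inv \<tau>) \<circ> \<rho>))"
    by (subst setum_permutations_compose_left[OF \<tau>]) (simp add: comp_assoc)
qed

lemma qscale_pconst_0: "qscale (pconst 0) p = 0"
  by (simp add: hom_simps)

lemma qscale_pconst_add: "qscale (pconst (a + b)) p = qscale (pconst a) p + qscale (pconst b) p"
  by (simp add: hom_simps single_add qmul_add_left)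

lemma bij_betw_conj_action:
  assumes \<rho>: "\<rho> permutes {..<d}"
  shows "bij_betw (\<lambda>x. (fst x \<circ> \<rho>, inv \<rho> \<circ> snd x \<circ> \<rho>)) (words d K \<times> perms (Suc d)) (words d K \<times> perms (Suc d))"
proof -
  let ?act = "\<lambda>\<rho> (x :: (nat \<Rightarrow> 'a) \<times> (nat \<Rightarrow> nat)). (fst x \<circ> \<rho>, inv \<rho> \<circ> snd x \<circ> \<rho>)"
  let ?X = "words d K \<times> perms (Suc d)"
  have mem: "?act \<rho> x \<in> ?X" if "\<rho> permutes {..<d}" "x \<in> ?X" for \<rho> x
  proof -
    have \<rho>: "\<rho> permutes {..<Suc d}" using that(1) by (rule permutes_subset) auto
    have "fst x \<circ> \<rho> \<in> words d K" by (rule words_comp_perm[OF _ that(1)]) (use that(2) in \<open>simp add: mem_Times_iff\<close>)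
    moreover have "inv \<rho> \<circ> snd x \<circ> \<rho> permutes {..<Suc d}"
      using that(2) by (intro permutes_compose permutes_inv \<rho>) (simp add: mem_Times_iff)
    ultimately show ?thesis by (simp add: mem_Times_iff)
  qed
  show ?thesis
  proof (rule bij_betw_byWitness[where f' = "?act (inv \<rho>)"])
    show "\<forall>x\<in>?X. ?act (inv \<rho>) (?act \<rho> x) = x" "\<forall>x\<in>?X. ?act \<rho> (?act (inv \<rho>) x) = x"
      using permutes_inverses[OF \<rho>] by (auto simp: fun_eq_iff permutes_inv_inv[OF \<rho>])
    show "?act \<rho> ` ?X \<subseteq> ?X" "?act (inv \<rho>) ` ?X \<subseteq> ?X"
      using mem[OF \<rho>] mem[OF permutes_inv[OF \<rho>]] by blast+
  qed
qed

lemma trace_qpoly_conj_average: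
  "(trace_qpoly d K (conj_average d c) :: ('a::field_char_0, 'n::finite) qpoly) = trace_qpoly d K c"
proof -
  let ?g = "\<lambda>a x. qscale (pconst a) (trace_qmon d (fst x) (snd x)) :: ('a, 'n) qpoly"
  have pairs: "trace_qpoly d K c = (\<Sum>x\<in>words d K \<times> perms (Suc d). ?g (c (fst x) (snd x)) x)" for c
    by (simp add: trace_qpoly_def sum.cartesian_product case_prod_unfold)
  have "trace_qmon d (k \<circ> \<rho>) (inv \<rho> \<circ> \<sigma> \<circ> \<rho>) = (trace_qmon d k \<sigma> :: ('a, 'n) qpoly)"
    if \<rho>: "\<rho> permutes {..<d}" and \<sigma>: "\<sigma> permutes {..<Suc d}" for k \<rho> \<sigma>
  proof -
    have "\<rho> permutes {..<Suc d}" using \<rho> by (rule permutes_subset) auto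
    hence "inv \<rho> \<circ> \<sigma> \<circ> \<rho> permutes {..<Suc d}" by (intro permutes_compose permutes_inv \<sigma>)
    moreover have "\<rho> \<circ> (inv \<rho> \<circ> \<sigma> \<circ> \<rho>) \<circ> inv \<rho> = \<sigma>" using permutes_inverses[OF \<rho>] by (simp add: fun_eq_iff)
    ultimately show ?thesis by (simp flip: trace_qmon_conj[OF \<rho>])
  qed
  hence inv: "trace_qmon d (fst x \<circ> \<rho>) (inv \<rho> \<circ> snd x \<circ> \<rho>) = (trace_qmon d (fst x) (snd x) :: ('a, 'n) qpoly)"
    if "\<rho> \<in> perms d" "x \<in> words d K \<times> perms (Suc d)" for \<rho> x
    using that by (simp add: mem_Times_iff)
  show ?thesis
    unfolding pairs conj_average_def
    by (rule sum_perms_average[where act = "\<lambda>\<rho> x. (fst x \<circ> \<rho>, inv \<rho> \<circ> snd x \<circ> \<rho>)" and g = ?g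
          and c = "\<lambda>x. c (fst x) (snd x)", unfolded fst_conv snd_conv])
      (simp_all add: qscale_pconst_0 qscale_pconst_add bij_betw_conj_action inv)
qed

lemma qscale_qscale: "qscale a (qscale b p) = qscale (a * b) p"
proof -
  have "qscale a (qscale b (\<Sum>w\<in>Poly_Mapping.keys p. Poly_Mapping.single w (Poly_Mapping.lookup p w)))
    = qscale (a * b) (\<Sum>w\<in>Poly_Mapping.keys p. Poly_Mapping.single w (Poly_Mapping.lookup p w))"
    by (simp add: qmul_sum_right qmul_single mult.assoc)
  thus ?thesis by (simp add: poly_mapping_sum_single)
qed

lemma perm_kernel_sum_in_T_ideal:
  fixes I :: "('a::field_char_0, 'n::finite) qpoly set"
  assumes I: "T_ideal I" "Qn \<in> I" and c: "in_perm_kernel TYPE('n) (Suc d) c"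
  shows "(\<Sum>\<sigma>\<in>perms (Suc d). qscale (pconst (c \<sigma>)) (trace_qmon d k \<sigma>)) \<in> I"
  using c
proof (induction rule: perm_kernel_induct)
  case (zero c)
  thus ?case using I(1) by (simp add: qscale_pconst_0 T_ideal_def)
next
  case (alt c a S \<tau>)
  let ?q = "trace_qmon d k :: _ \<Rightarrow> ('a, 'n) qpoly"
  have "(\<Sum>\<sigma>\<in>perms (Suc d). qscale (pconst (a * alt_coeff S \<tau> \<sigma>)) (?q \<sigma>))
    = (\<Sum>\<pi> | \<pi> permutes S. qscale (pconst (a * of_int (sign \<pi>))) (?q (\<pi> \<circ> \<tau>)))"
    by (rule sum_alt_coeff[OF alt.hyps(1,3), where \<psi> = "\<lambda>b \<sigma>. qscale (pconst (a * b)) (?q \<sigma>)"])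
      (simp_all add: qscale_pconst_0 qscale_pconst_add distrib_left)
  also have "\<dots> = qscale (pconst a) (alternating_phi S {..<Suc d} d \<tau> (letter d k))"
    by (simp add: alternating_phi_def qmul_sum_right qscale_qscale hom_simps)
  also have "\<dots> \<in> I"
    by (intro T_ideal_qscale[OF I(1)] alternating_phi_in_T_ideal[OF I] alt.hyps) auto
  finally show ?case
    using alt.IH I(1) by (simp add: qscale_pconst_add sum.distrib T_ideal_def)
qed

lemma trace_qpoly_identity_in_T_ideal:
  fixes I :: "('a::field_char_0, 'n::finite) qpoly set"
  assumes I: "T_ideal I" "Qn \<in> I" and K: "finite K"
    and zero: "Phi (trace_qpoly d K c :: ('a, 'n) qpoly) = 0"
  shows "trace_qpoly d K c \<in> I"
proof -
  have "in_perm_kernel TYPE('n) (Suc d) (conj_average d c k)" if "k \<in> words d K" for k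
    using conj_invariant_conj_average _ K that
    by (rule trace_identity_in_perm_kernel) (simp add: trace_qpoly_conj_average zero)
  hence "trace_qpoly d K (conj_average d c) \<in> I"
    unfolding trace_qpoly_def by (intro T_ideal_sum[OF I(1)] perm_kernel_sum_in_T_ideal[OF I])
  thus ?thesis by (simp only: trace_qpoly_conj_average)
qed

lemma trace_qpoly_sum:
  "(\<Sum>x\<in>X. trace_qpoly d K (c x)) = trace_qpoly d K (\<lambda>k \<sigma>. \<Sum>x\<in>X. c x k \<sigma>)"
proof (induction X rule: infinite_finite_induct)
  case (insert x X)
  thus ?case by (simp add: trace_qpoly_def qscale_pconst_add sum.distrib)
qed (simp_all add: trace_qpoly_def qscale_pconst_0)

lemma sum_trace_qpolys_in_T_ideal:
  fixes I :: "('a::field_char_0, 'n::finite) qpoly set"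
  assumes I: "T_ideal I" "Qn \<in> I" and K: "finite K" and X: "finite X"
    and zero: "Phi (\<Sum>x\<in>X. trace_qpoly (d x) K (c x) :: ('a, 'n) qpoly) = 0"
  shows "(\<Sum>x\<in>X. trace_qpoly (d x) K (c x)) \<in> I"
proof -
  define C where "C = (\<lambda>e k \<sigma>. \<Sum>x\<in>{x\<in>X. d x = e}. c x k \<sigma>)"
  have by_degree: "(\<Sum>x\<in>X. trace_qpoly (d x) K (c x) :: ('a, 'n) qpoly) = (\<Sum>e\<in>d ` X. trace_qpoly e K (C e))"
    unfolding C_def trace_qpoly_sum[symmetric] using X by (subst sum.image_gen[OF X, of _ d]) simp
  have "Phi (trace_qpoly e K (C e) :: ('a, 'n) qpoly) = 0" if "e \<in> d ` X" for e
  proof -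
    have "Phi (trace_qpoly e K (C e) :: ('a, 'n) qpoly) $ u $ v = 0" for u v
    proof (rule sum_homogeneous_eq_0[where f = "\<lambda>e. Phi (trace_qpoly e K (C e)) $ u $ v"])
      show "finite (d ` X)" using X by simp
      show "homogeneous e (Phi (trace_qpoly e K (C e) :: ('a, 'n) qpoly) $ u $ v)" for e
        by (rule homogeneous_Phi_trace_qpoly)
      show "(\<Sum>e\<in>d ` X. Phi (trace_qpoly e K (C e) :: ('a, 'n) qpoly) $ u $ v) = 0"
        using zero unfolding by_degree Phi_sum by (simp flip: sum_component)
    qed (rule that)
    thus ?thesis by (simp add: vec_eq_iff)
  qed
  thus ?thesis
    unfolding by_degree by (intro T_ideal_sum[OF I(1)] trace_qpoly_identity_in_T_ideal[OF I K])
qed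

lemma qscale_trace_qmon_eq_trace_qpoly:
  assumes K: "finite K" "k \<in> words d K" and \<sigma>: "\<sigma> permutes {..<Suc d}"
  shows "\<exists>c. (qscale (pconst a) (trace_qmon d k \<sigma>) :: ('a::comm_ring_1, 'n::finite) qpoly) = trace_qpoly d K c"
proof -
  let ?c = "\<lambda>l \<tau>. if \<tau> = \<sigma> then if l = k then a else 0 else 0"
  let ?q = "qscale (pconst a) (trace_qmon d k \<sigma>) :: ('a, 'n) qpoly"
  have "qscale (pconst (?c l \<tau>)) (trace_qmon d l \<tau>) = (if \<tau> = \<sigma> then if l = k then ?q else 0 else 0)" for l \<tau>
    by (auto simp: qscale_pconst_0)
  hence "trace_qpoly d K ?c = ?q" using K \<sigma> by (simp add: trace_qpoly_def)
  thus ?thesis by (intro exI) (rule sym)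
qed

lemma permutes_append_cycle:
  assumes \<sigma>: "\<sigma> permutes {..<r}" and "r \<le> d"
  obtains \<sigma>' where "\<sigma>' permutes {..<Suc d}" "is_cycle \<sigma>' (d # [r..<d])" "\<And>p. p < r \<Longrightarrow> \<sigma>' p = \<sigma> p"
proof
  define l where "l = [r..<d]"
  define \<sigma>' where "\<sigma>' = \<sigma> \<circ> cycle_of_list (d # l)"
  have set_l: "set (d # l) = {r..d}" using assms(2) by (auto simp: l_def)
  have dist: "distinct (d # l)" by (simp add: l_def)
  have "\<sigma> permutes {..<Suc d}" by (rule permutes_subset[OF \<sigma>]) (use assms(2) in auto)
  moreover have "cycle_of_list (d # l) permutes {..<Suc d}"
    by (rule permutes_subset[OF cycle_permutes]) (auto simp: set_l simp del: set_simps)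
  ultimately show "\<sigma>' permutes {..<Suc d}" unfolding \<sigma>'_def by (intro permutes_compose)
  show "\<sigma>' p = \<sigma> p" if "p < r" for p
  proof -
    have "p \<notin> set (d # l)" using that unfolding set_l by simp
    from id_outside_supp[OF this] show ?thesis by (simp only: \<sigma>'_def o_apply)
  qed
  have fixed: "\<sigma> p = p" if "p \<in> set (rotate1 (d # l))" for p
    using that unfolding set_rotate1 set_l by (intro permutes_not_in[OF \<sigma>]) simp
  have "map (cycle_of_list (d # l)) (d # l) = rotate1 (d # l)"
    using cyclic_rotation[OF dist, of 1] unfolding One_nat_def rotate_def funpow.simps comp_id .
  hence "map \<sigma>' (d # l) = map \<sigma> (rotate1 (d # l))" by (simp only: \<sigma>'_def flip: map_map)
  also have "\<dots> = rotate1 (d # l)" using fixed by (rule map_idI)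
  finally show "is_cycle \<sigma>' (d # [r..<d])" using dist by (simp add: is_cycle_def l_def)
qed

lemma single_trace_mon_eq_trace_qmon:
  assumes \<sigma>: "\<sigma> permutes {..<r}" and k: "k \<in> words r K" and w: "set w \<subseteq> K"
  obtains k' \<sigma>' where "k' \<in> words (r + length w) K" "\<sigma>' permutes {..<Suc (r + length w)}"
    "(Poly_Mapping.single w (trace_mon r k \<sigma>) :: ('a::comm_ring_1, 'n::finite) qpoly) = trace_qmon (r + length w) k' \<sigma>'"
proof -
  define d where "d = r + length w"
  define k' where "k' = restrict (\<lambda>p. if p < r then k p else w ! (p - r)) {..<d}"
  have "k p \<in> K" if "p < r" for p using k that by auto
  moreover have "w ! (p - r) \<in> K" if "p < d" "\<not> p < r" for p
    using that by (intro subsetD[OF w] nth_mem) (simp add: d_def)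
  ultimately have k': "k' \<in> words d K" by (simp add: k'_def)
  obtain \<sigma>' where \<sigma>': "\<sigma>' permutes {..<Suc d}" and cyc: "is_cycle \<sigma>' (d # [r..<d])"
    and low: "\<And>p. p < r \<Longrightarrow> \<sigma>' p = \<sigma> p"
    using permutes_append_cycle[OF \<sigma>, of d] by (auto simp: d_def)
  have letters: "map (letter d k') [r..<d] = map (\<lambda>p. [k' p]) [r..<d]" by (auto simp: letter_def)
  have word: "concat (map (letter d k') [r..<d]) = w"
    unfolding letters concat_map_singleton by (rule nth_equalityI) (auto simp: k'_def d_def)
  have rest: "{..<Suc d} - set (d # [r..<d]) = {..<r}" by (auto simp: d_def)
  have "trace_mon r k \<sigma> = (index_trace (\<lambda>p. wordmat generic (letter d k' p)) \<sigma>' {..<r} :: ('a, 'n) cpoly)"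
    unfolding trace_mon_def index_trace_def
    by (intro sum.cong prod.cong refl) (simp add: letter_def k'_def low d_def)
  hence "(Poly_Mapping.single w (trace_mon r k \<sigma>) :: ('a, 'n) qpoly) = trace_qmon d k' \<sigma>'"
    unfolding phi_cycle[OF cyc] rest word by (simp add: letter_def[of d k' d])
  thus ?thesis using that k' \<sigma>' by (simp add: d_def)
qed

lemma single_invariant_eq_trace_qpoly:
  fixes f :: "('a::field_char_0, 'n::finite) cpoly"
  assumes K: "finite K" "f \<in> vars_in (K \<times> UNIV)" "set w \<subseteq> K" and hom: "homogeneous r f"
    and inv: "\<And>u v. ad (unit_mat u v) f = 0"
  shows "\<exists>c. Poly_Mapping.single w f = trace_qpoly (r + length w) K c"
proof -
  obtain c where f: "f = (\<Sum>k\<in>words r K. \<Sum>\<sigma>\<in>perms r. pconst (c k \<sigma>) * trace_mon r k \<sigma>)"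
    using invariant_imp_sum_trace_mons[OF K(1,2) hom inv] by blast
  have "\<forall>x\<in>words r K \<times> perms r. \<exists>e.
      Poly_Mapping.single w (pconst (c (fst x) (snd x)) * trace_mon r (fst x) (snd x) :: ('a, 'n) cpoly)
      = trace_qpoly (r + length w) K e"
  proof
    fix x assume "x \<in> words r K \<times> perms r"
    hence k: "fst x \<in> words r K" and \<sigma>: "snd x permutes {..<r}" by (simp_all add: mem_Times_iff)
    obtain k' \<sigma>' where k': "k' \<in> words (r + length w) K" and \<sigma>': "\<sigma>' permutes {..<Suc (r + length w)}"
      and eq: "(Poly_Mapping.single w (trace_mon r (fst x) (snd x)) :: ('a, 'n) qpoly) = trace_qmon (r + length w) k' \<sigma>'"
      by (rule single_trace_mon_eq_trace_qmon[OF \<sigma> k K(3)])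
    have "\<exists>e. (qscale (pconst (c (fst x) (snd x))) (trace_qmon (r + length w) k' \<sigma>') :: ('a, 'n) qpoly)
        = trace_qpoly (r + length w) K e"
      by (rule qscale_trace_qmon_eq_trace_qpoly[OF K(1) k' \<sigma>'])
    thus "\<exists>e. Poly_Mapping.single w (pconst (c (fst x) (snd x)) * trace_mon r (fst x) (snd x) :: ('a, 'n) cpoly)
        = trace_qpoly (r + length w) K e"
      by (simp add: qmul_single flip: eq)
  qed
  from bchoice[OF this] obtain e where e: "\<forall>x\<in>words r K \<times> perms r.
      Poly_Mapping.single w (pconst (c (fst x) (snd x)) * trace_mon r (fst x) (snd x) :: ('a, 'n) cpoly)
      = trace_qpoly (r + length w) K (e x)" ..
  have "Poly_Mapping.single w f = (\<Sum>x\<in>words r K \<times> perms r.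
      Poly_Mapping.single w (pconst (c (fst x) (snd x)) * trace_mon r (fst x) (snd x)))"
    by (simp add: f single_sum sum.cartesian_product case_prod_unfold)
  also have "\<dots> = (\<Sum>x\<in>words r K \<times> perms r. trace_qpoly (r + length w) K (e x))"
    using e by (intro sum.cong refl) blast
  finally show ?thesis unfolding trace_qpoly_sum by blast
qed

theorem invariant_identity_in_T_ideal:
  fixes f :: "nat \<Rightarrow> ('a::field_char_0, 'n::finite) cpoly"
  assumes I: "T_ideal I" "Qn \<in> I" and S: "finite S"
    and inv: "\<And>s u v. s \<in> S \<Longrightarrow> ad (unit_mat u v) (f s) = 0"
    and zero: "Phi (\<Sum>s\<in>S. Poly_Mapping.single (w s) (f s)) = 0"
  shows "(\<Sum>s\<in>S. Poly_Mapping.single (w s) (f s)) \<in> I"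
proof -
  define X where "X = (SIGMA s:S. {..total_degree (f s)})"
  let ?f = "\<lambda>x. homogeneous_component (snd x) (f (fst x))"
  have X: "finite X" using S by (simp add: X_def)
  have "\<forall>x. \<exists>A. finite A \<and> ?f x \<in> vars_in A" using ex_finite_vars_in by metis
  from choice[OF this] obtain A where "\<forall>x. finite (A x) \<and> ?f x \<in> vars_in (A x)" ..
  hence A: "finite (A x)" "?f x \<in> vars_in (A x)" for x by blast+
  define K where "K = (\<Union>x\<in>X. fst ` A x \<union> set (w (fst x)))"
  have K: "finite K" using X A(1) by (simp add: K_def)
  have "\<forall>x\<in>X. \<exists>c. Poly_Mapping.single (w (fst x)) (?f x) = trace_qpoly (snd x + length (w (fst x))) K c"
  proof (intro ballI single_invariant_eq_trace_qpoly[OF K])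
    fix x assume x: "x \<in> X"
    have "A x \<subseteq> K \<times> UNIV" using x by (force simp: K_def)
    thus "?f x \<in> vars_in (K \<times> UNIV)" using A(2) vars_in_mono by blast
    show "set (w (fst x)) \<subseteq> K" using x by (auto simp: K_def)
    show "ad (unit_mat u v) (?f x) = 0" for u v
      using x by (intro ad_homogeneous_component inv) (auto simp: X_def)
  qed (rule homogeneous_homogeneous_component)
  from bchoice[OF this] obtain c where c: "\<forall>x\<in>X.
      Poly_Mapping.single (w (fst x)) (?f x) = trace_qpoly (snd x + length (w (fst x))) K (c x)" ..
  have "(\<Sum>s\<in>S. Poly_Mapping.single (w s) (f s))
      = (\<Sum>s\<in>S. \<Sum>r\<le>total_degree (f s). Poly_Mapping.single (w s) (homogeneous_component r (f s)))"
    by (simp flip: single_sum add: sum_homogeneous_components)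
  also have "\<dots> = (\<Sum>x\<in>X. Poly_Mapping.single (w (fst x)) (?f x))"
    unfolding X_def using S by (subst sum.Sigma) (auto simp: case_prod_unfold)
  also have "\<dots> = (\<Sum>x\<in>X. trace_qpoly (snd x + length (w (fst x))) K (c x))" using c by simp
  finally have "(\<Sum>s\<in>S. Poly_Mapping.single (w s) (f s)) = (\<Sum>x\<in>X. trace_qpoly (snd x + length (w (fst x))) K (c x))" .
  thus ?thesis using sum_trace_qpolys_in_T_ideal[OF I K X] zero by simp
qed

theorem mainTheorem15:
  fixes lam :: "nat \<Rightarrow> ('a::field_char_0, 'n::finite) cpoly"
    and M :: "nat \<Rightarrow> nat list"
    and t :: nat
    and P :: "('a, 'n) qpoly"
  assumes "P = (\<Sum>i\<in>{0..t}. Poly_Mapping.single (M i) (lam i))"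
    and "quasi_identity P"
    and "loc_lin_indep TYPE('n) t M TYPE('a)"
  shows "P \<in> T_ideal_gen (Qn :: ('a, 'n) qpoly)"
proof -
  have rel: "word_relation t M lam"
    using assms(1,2) by (simp add: word_relation_def quasi_identity_iff_Phi_eq_0)
  have "P \<in> I" if I: "T_ideal I" "Qn \<in> I" for I :: "('a, 'n) qpoly set"
  proof (cases "lam 0 = 0")
    case True
    hence "P = 0" using word_relation_trivial[OF rel assms(3)] by (simp add: assms(1))
    thus ?thesis using I(1) by (simp add: T_ideal_def)
  next
    case False
    then obtain \<mu> :: "nat \<Rightarrow> ('a, 'n) cpoly" and h
      where \<mu>: "word_relation t M \<mu>" "\<And>a b s. s \<in> {0..t} \<Longrightarrow> ad (unit_mat a b) (\<mu> s) = 0"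
        and lam: "\<And>s. s \<in> {0..t} \<Longrightarrow> lam s = h * \<mu> s"
      using invariant_word_relation_generator[OF rel _ assms(3)] by metis
    have "(\<Sum>s\<in>{0..t}. Poly_Mapping.single (M s) (\<mu> s)) \<in> I"
      using \<mu> unfolding word_relation_def by (intro invariant_identity_in_T_ideal[OF I]) auto
    hence "qscale h (\<Sum>s\<in>{0..t}. Poly_Mapping.single (M s) (\<mu> s)) \<in> I" by (rule T_ideal_qscale[OF I(1)])
    thus ?thesis by (simp add: assms(1) lam qmul_sum_right qmul_single)
  qed
  thus ?thesis by (auto simp: T_ideal_gen_def)
qed

end
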